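(* Let $1\le r\le\alpha<\infty$, $p\in[1,\infty]$, $\gamma\in\mathbb{R}\setminus\{0\}$, $s\in(0,1)$, and $q\in[1,p]$ with $\frac1q=\frac{1-s}{p}+s$. If $r=1$ and $\gamma\in(-\infty,0)$, assume further that $\gamma\in(-\infty,-1)$ and $n=1$. Write $X:=M^\alpha_r(\mathbb{R}^n)$. (i) If $p\in[1,\infty)$, there exists $C>0$ such that for every $f\in C^1(\mathbb{R}^n)$ with $|\nabla f|\in C_{\mathrm c}(\mathbb{R}^n)$, $$\sup_{\lambda>0}\lambda\left\|\left[\int_{\mathbb{R}^n}\mathbf{1}_{D_{\lambda,\gamma/q,s}[f]}(\cdot,y)|\cdot-y|^{\gamma-n}dy\right]^{1/q}\right\|_{X^q}\le C\|f\|_{X^p}^{1-s}\|\,|\nabla f|\,\|_X^s.$$ (ii) If $p=\infty$, there exists $\widetilde C>0$ such that for every $f\in C^1(\mathbb{R}^n)$ with $|\nabla f|\in C_{\mathrm c}(\mathbb{R}^n)$, $$\sup_{\lambda>0}\lambda\left\|\left[\int_{\mathbb{R}^n}\mathbf{1}_{D_{\lambda,\gamma/q,s}[f]}(\cdot,y)|\cdot-y|^{\gamma-n}dy\right]^{1/q}\right\|_{X^q}\le\widetilde C\|f\|_{L^\infty(\mathbb{R}^n)}^{1-s}\|\,|\nabla f|\,\|_X^s.$$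
   Context: For $0<r\le\alpha<\infty$, the Morrey space $M^\alpha_r(\mathbb{R}^n)$ is the set of measurable $f$ with $\|f\|_{M^\alpha_r}:=\sup_B|B|^{\frac1\alpha-\frac1r}\|f\|_{L^r(B)}<\infty$ (supremum over balls). For $t>0$, $X^t:=\{f:|f|^t\in X\}$ with $\|f\|_{X^t}:=\|\,|f|^t\|_X^{1/t}$. For $\lambda>0$, $\beta\in\mathbb{R}$, $\sigma\in[0,1]$, $D_{\lambda,\beta,\sigma}[f]:=\{(x,y)\in\mathbb{R}^n\times\mathbb{R}^n:x\ne y,\ |f(x)-f(y)|/|x-y|^{\sigma+\beta}>\lambda\}$. *)

theory Defs
  imports "HOL-Analysis.Analysis"
begin

text \<open>Real power of an extended nonnegative real (used only with positive exponents t):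
  \<infinity>^t = \<infinity>.\<close>
definition epow :: "ennreal \<Rightarrow> real \<Rightarrow> ennreal" where
  "epow x t = (if x = top then top else ennreal (enn2real x powr t))"

definition morrey_norm :: "real \<Rightarrow> real \<Rightarrow> ('a::euclidean_space \<Rightarrow> ennreal) \<Rightarrow> ennreal" where
  "morrey_norm \<alpha> r F =
     (SUP x\<in>UNIV. SUP \<rho>\<in>{0<..}.
        ennreal (measure lebesgue (ball x \<rho>) powr (1/\<alpha> - 1/r)) *
        epow (\<integral>\<^sup>+ y\<in>ball x \<rho>. epow (F y) r \<partial>lebesgue) (1/r))"

text \<open>Norm in the convexification X^t of X = M^alpha_r: ||F||_{X^t} = || |F|^t ||_X^(1/t).\<close>
definition morrey_pow_norm :: "real \<Rightarrow> real \<Rightarrow> real \<Rightarrow> ('a::euclidean_space \<Rightarrow> ennreal) \<Rightarrow> ennreal" where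
  "morrey_pow_norm \<alpha> r t F = epow (morrey_norm \<alpha> r (\<lambda>x. epow (F x) t)) (1/t)"

definition Dset :: "real \<Rightarrow> real \<Rightarrow> real \<Rightarrow> ('a::euclidean_space \<Rightarrow> real) \<Rightarrow> ('a \<times> 'a) set" where
  "Dset lam \<beta> \<sigma> f = {(x, y). x \<noteq> y \<and> \<bar>f x - f y\<bar> / dist x y powr (\<sigma> + \<beta>) > lam}"

definition Dint :: "real \<Rightarrow> real \<Rightarrow> real \<Rightarrow> real \<Rightarrow> ('a::euclidean_space \<Rightarrow> real) \<Rightarrow> 'a \<Rightarrow> ennreal" where
  "Dint lam \<beta> \<sigma> \<gamma> f x =
     (\<integral>\<^sup>+ y. indicator (Dset lam \<beta> \<sigma> f) (x, y) *
              ennreal (dist x y powr (\<gamma> - real DIM('a))) \<partial>lebesgue)"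

definition LHS :: "real \<Rightarrow> real \<Rightarrow> real \<Rightarrow> real \<Rightarrow> real \<Rightarrow> ('a::euclidean_space \<Rightarrow> real) \<Rightarrow> ennreal" where
  "LHS \<alpha> r \<gamma> s q f =
     (SUP lam\<in>{0<..}. ennreal lam *
        morrey_pow_norm \<alpha> r q (\<lambda>x. epow (Dint lam (\<gamma>/q) s \<gamma> f x) (1/q)))"

definition C1_grad_cc :: "('a::euclidean_space \<Rightarrow> real) \<Rightarrow> ('a \<Rightarrow> 'a) \<Rightarrow> bool" where
  "C1_grad_cc f g \<longleftrightarrow>
     (\<forall>x. (f has_derivative (\<lambda>h. g x \<bullet> h)) (at x)) \<and> continuous_on UNIV g \<and>
     compact (closure {x. g x \<noteq> 0})"

end

theory Submission
  imports Defs
begin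

text \<open>
  Writing \<open>\<gamma>/q = (1 - s)\<gamma>/p + s\<gamma>\<close>, the level set with parameters \<open>(\<gamma>/q, s)\<close> lies in the union of the
  one with parameters \<open>(\<gamma>, 1)\<close> at height \<open>A\<close> and the one with parameters \<open>(\<gamma>/p, 0)\<close> at height \<open>B\<close>
  whenever \<open>A\<^sup>s B\<^sup>1\<^sup>-\<^sup>s\<close> is the given height, so it suffices to bound these two endpoint level sets in
  the Morrey norm and to optimize \<open>A\<close> and \<open>B\<close>.

  The integral over a level set is discretized to the scales \<open>|x - y| \<sim> 2\<^sup>k\<close>: a pair in the level set
  at this scale has a member in some set \<open>U k\<close>, and the integral is dominated by a sum over \<open>k\<close> of
  \<open>2 powr (k \<gamma>)\<close> times the indicator of \<open>U k\<close> and its average over balls of radius \<open>2\<^sup>k\<close>. For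
  \<open>(\<gamma>/p, 0)\<close> the sets are superlevel sets of \<open>|f|\<^sup>p\<close>. For \<open>(\<gamma>, 1)\<close>, averaging
  \<open>f x - f u\<close> over a ball and using the fundamental theorem of calculus on the segments bounds
  \<open>f x - f y\<close> by averages of \<open>|\<nabla>f|\<close> over balls of radius at most \<open>2\<^sup>k\<close> around \<open>x\<close> and \<open>y\<close>.

  If \<open>r > 1\<close>, everything is controlled by the Hardy-Littlewood maximal function, which is bounded on
  the Morrey space. If \<open>r = 1\<close>, Fubini leaves a sum over scales \<open>m\<close> of \<open>2 powr (m \<gamma>)\<close> times the
  measure of the set where the integral of \<open>|\<nabla>f|\<close> over a ball of radius \<open>2\<^sup>m\<close> exceeds
  \<open>\<Lambda> 2 powr (m (n + \<gamma>))\<close>; only the largest such balls matter for \<open>\<gamma> > 0\<close> (Vitali covering), and only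
  the smallest such intervals for \<open>\<gamma> < -1\<close>, \<open>n = 1\<close> (dyadic intervals).
\<close>

text \<open>For r = 1 the maximal function is not bounded on the space, so the scale 2^k of the pair
  and the scale 2^(k - j) of a ball carrying much of the gradient have to be kept apart and both
  summed. This succeeds because the average over segments tolerates a loss t powr (-1/2), integrable
  at 0: thresholds may grow like 2^(j/2), and after reindexing by m = k - j a summable factor
  2^(-j/2) is left. With n = 1 and \<gamma> < -1 the threshold \<Lambda> 2^(m (1 + \<gamma>))
  decreases in m, so the dyadic ancestors of a heavy interval are heavy too; this monotonicity takes
  the place of the covering argument, which needs weights 2^(m \<gamma>) that increase with the
  scale. Global estimates become Morrey estimates by one recurring device, which rests on \<theta> =
  r/\<alpha> > 0: around a ball of radius \<rho>, scales up to \<rho> see only the doubled ball,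
  while at scales 2^k above \<rho> the Morrey bound itself supplies the decay 2^(- k n
  \<theta>).\<close>

section \<open>Powers of extended nonnegative reals\<close>

lemma epow_ennreal [simp]: "0 \<le> x \<Longrightarrow> epow (ennreal x) t = ennreal (x powr t)"
  by (simp add: epow_def)

lemma epow_top [simp]: "epow top t = top"
  by (simp add: epow_def)

lemma epow_0 [simp]: "epow 0 t = 0"
  by (simp add: epow_def)

lemma epow_eq_0_iff [simp]: "epow x t = 0 \<longleftrightarrow> x = 0"
  by (cases x rule: ennreal_cases) (auto simp: ennreal_eq_0_iff)

lemma epow_eq_top_iff [simp]: "epow x t = top \<longleftrightarrow> x = top"
  by (cases x rule: ennreal_cases) auto

lemma epow_1 [simp]: "epow x 1 = x"
  by (cases x rule: ennreal_cases) auto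

lemma epow_epow: "epow (epow x a) b = epow x (a * b)"
  by (cases x rule: ennreal_cases) (auto simp: powr_powr)

lemma epow_mult: "epow (x * y) t = epow x t * epow y t"
proof (cases "x = top \<or> y = top")
  case True
  then show ?thesis
    by (auto simp: ennreal_top_mult ennreal_mult_top)
next
  case False
  then show ?thesis
    by (cases x rule: ennreal_cases; cases y rule: ennreal_cases)
       (auto simp: ennreal_mult[symmetric] powr_mult)
qed

lemma epow_add: "epow x (a + b) = epow x a * epow x b"
  by (cases x rule: ennreal_cases) (auto simp: powr_add ennreal_mult ennreal_top_mult)

lemma epow_mono: "0 \<le> t \<Longrightarrow> x \<le> y \<Longrightarrow> epow x t \<le> epow y t"
  by (cases x rule: ennreal_cases; cases y rule: ennreal_cases)
     (auto intro!: ennreal_leI powr_mono2 simp: top_unique)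

lemma epow_less: "0 < t \<Longrightarrow> x < y \<Longrightarrow> epow x t < epow y t"
proof -
  assume t: "0 < t" and xy: "x < y"
  have "epow x t \<noteq> epow y t"
    using t xy by (metis epow_1 epow_epow less_irrefl nonzero_mult_div_cancel_left times_divide_eq_right mult.right_neutral less_numeral_extra(3))
  with epow_mono[of t x y] t xy show ?thesis by (simp add: less_le)
qed

lemma epow_le_iff: "0 < t \<Longrightarrow> epow x t \<le> epow y t \<longleftrightarrow> x \<le> y"
  by (meson epow_less epow_mono less_le_not_le linorder_not_le order_less_imp_le)

text \<open>A sum is at most twice the maximum, which treats exponents below and above 1
  alike.\<close>

lemma epow_sum_le: "0 \<le> t \<Longrightarrow> epow (x + y) t \<le> ennreal (2 powr t) * (epow x t + epow y t)"
proof -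
  assume t: "0 \<le> t"
  have "epow (x + y) t \<le> epow (2 * max x y) t"
    by (rule epow_mono[OF t]) (metis add_mono max.cobounded1 max.cobounded2 mult_2)
  also have "\<dots> = ennreal (2 powr t) * epow (max x y) t"
    by (simp add: epow_mult) (metis epow_ennreal ennreal_numeral zero_le_numeral)
  also have "epow (max x y) t \<le> epow x t + epow y t"
    by (auto simp: max_def)
  finally show ?thesis by (simp add: mult_left_mono)
qed

lemma borel_measurable_epow [measurable (raw)]:
  "f \<in> borel_measurable M \<Longrightarrow> (\<lambda>x. epow (f x) t) \<in> borel_measurable M"
proof -
  assume f [measurable]: "f \<in> borel_measurable M"
  have [measurable]: "Measurable.pred M (\<lambda>x. f x = top)"
    unfolding pred_def by (rule borel_measurable_eq) auto
  show ?thesis unfolding epow_def by measurable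
qed

subsection \<open>Sums over the dyadic scales\<close>

text \<open>A two-sided series written as an integral over counting measure, so that Tonelli,
  monotone convergence and reindexing by bijections of the integers are facts about
  \<open>nn_integral\<close>.\<close>

abbreviation zsum :: "(int \<Rightarrow> ennreal) \<Rightarrow> ennreal" (binder "\<Sum>z" 10)
  where "zsum a \<equiv> \<integral>\<^sup>+k. a k \<partial>count_space UNIV"

abbreviation dy :: "int \<Rightarrow> real \<Rightarrow> real"
  where "dy k a \<equiv> 2 powr (of_int k * a)"

lemma zsum_mem_le: "a k \<le> (\<Sum>z k. a k)"
  using nn_integral_ge_point[of k UNIV a] by simp

text \<open>Symmetric windows exhaust the integers. Measurability and uniform bounds pass from
  finite sums to \<open>zsum\<close>, and the argument on the line starts its induction at the
  bottom of such a window.\<close>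

lemma zsum_eq_SUP: "(\<Sum>z k. a k) = (SUP i. \<Sum>k\<in>{- int i..int i}. a k)"
proof -
  have "(\<Sum>z k. a k) = (\<integral>\<^sup>+k. (SUP i. a k * indicator {- int i..int i} k) \<partial>count_space UNIV)"
  proof (rule nn_integral_cong, rule antisym)
    fix k :: int
    show "a k \<le> (SUP i. a k * indicator {- int i..int i} k)"
      by (rule SUP_upper2[of "nat \<bar>k\<bar>"]) (auto simp: indicator_def)
    show "(SUP i. a k * indicator {- int i..int i} k) \<le> a k"
      by (rule SUP_least) (auto simp: indicator_def)
  qed
  also have "\<dots> = (SUP i. \<integral>\<^sup>+k. a k * indicator {- int i..int i} k \<partial>count_space UNIV)"
    by (rule nn_integral_monotone_convergence_SUP)
       (auto simp: incseq_def le_fun_def indicator_def)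
  also have "(\<lambda>i. \<integral>\<^sup>+k. a k * indicator {- int i..int i} k \<partial>count_space UNIV)
      = (\<lambda>i. \<Sum>k\<in>{- int i..int i}. a k)"
  proof
    fix i
    show "(\<integral>\<^sup>+k. a k * indicator {- int i..int i} k \<partial>count_space UNIV)
        = (\<Sum>k\<in>{- int i..int i}. a k)"
      by (subst nn_integral_count_space'[of "{- int i..int i}"]) (auto simp: indicator_def)
  qed
  finally show ?thesis .
qed

lemma zsum_le_of_finite:
  assumes "\<And>A. finite A \<Longrightarrow> (\<Sum>k\<in>A. a k) \<le> B"
  shows "(\<Sum>z k. a k) \<le> B"
  unfolding zsum_eq_SUP by (rule SUP_least) (simp add: assms)

lemma borel_measurable_zsum [measurable]:
  "(\<And>k. f k \<in> borel_measurable M) \<Longrightarrow> (\<lambda>x. \<Sum>z k. f k x) \<in> borel_measurable M"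
  unfolding zsum_eq_SUP by measurable

lemma dy_add: "dy k (a + b) = dy k a * dy k b"
  by (simp add: powr_add distrib_left)

lemma dy_inverse: "dy k (- a) * dy k a = 1"
  by (simp add: powr_minus)

lemma zsum_nn_integral:
  assumes "\<And>k::int. f k \<in> borel_measurable M"
  shows "(\<integral>\<^sup>+x. (\<Sum>z k. f k x) \<partial>M) = (\<Sum>z k. \<integral>\<^sup>+x. f k x \<partial>M)"
  by (rule nn_integral_count_space_nn_integral) (use assms in auto)

lemma zsum_uminus: "(\<Sum>z k. a (- k)) = (\<Sum>z k. a k)"
  by (rule nn_integral_bij_count_space) (auto simp: bij_uminus)

lemma zsum_shift: "(\<Sum>z k. a (k - j)) = (\<Sum>z k. a k)"
  by (rule nn_integral_bij_count_space) (auto intro!: bij_betwI[where g="\<lambda>k. k + j"])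

lemma zsum_scales_atMost:
  assumes c: "c > 0"
  shows "(\<Sum>z k. ennreal (dy k c) * indicator {..m} k) \<le> ennreal (dy m c / (1 - 2 powr - c))"
proof (rule zsum_le_of_finite)
  fix A :: "int set" assume A: "finite A"
  let ?q = "2 powr - c"
  have q: "0 \<le> ?q" "?q < 1" using c by (auto simp: powr_less_one)
  have "(\<Sum>k\<in>A. ennreal (dy k c) * indicator {..m} k) = (\<Sum>k\<in>A \<inter> {..m}. ennreal (dy k c))"
    by (rule sum.mono_neutral_cong_right) (use A in \<open>auto simp: indicator_def\<close>)
  also have "\<dots> = ennreal (\<Sum>k\<in>A \<inter> {..m}. dy k c)" by simp
  also have "(\<Sum>k\<in>A \<inter> {..m}. dy k c) = (\<Sum>i\<in>(\<lambda>k. nat (m - k)) ` (A \<inter> {..m}). dy m c * ?q ^ i)"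
    by (subst sum.reindex)
       (auto simp: inj_on_def powr_realpow[symmetric] powr_powr powr_add[symmetric] algebra_simps intro!: sum.cong)
  also have "\<dots> = dy m c * (\<Sum>i\<in>(\<lambda>k. nat (m - k)) ` (A \<inter> {..m}). ?q ^ i)"
    by (simp add: sum_distrib_left)
  also have "\<dots> \<le> dy m c * (\<Sum>i. ?q ^ i)"
    by (intro mult_left_mono sum_le_suminf) (use A q in auto)
  also have "\<dots> = dy m c / (1 - ?q)"
    using q by (simp add: suminf_geometric)
  finally show "(\<Sum>k\<in>A. ennreal (dy k c) * indicator {..m} k) \<le> ennreal (dy m c / (1 - ?q))"
    by (simp add: ennreal_leI)
qed

lemma scale_exists:
  assumes x: "x > 0" obtains k :: int where "dy k 1 \<le> x" "x < dy (k + 1) 1"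
proof
  show "dy \<lfloor>log 2 x\<rfloor> 1 \<le> x"
    using x by (simp add: le_log_iff[symmetric])
  have "log 2 x < of_int (\<lfloor>log 2 x\<rfloor> + 1)" by linarith
  then show "x < dy (\<lfloor>log 2 x\<rfloor> + 1) 1"
    using x by (simp add: less_powr_iff log_less_iff)
qed

lemma zsum_geometric_real:
  assumes c: "c > 0" and H: "H \<ge> 0"
  shows "(\<Sum>z k. ennreal (dy k c) * indicator {k. dy k c \<le> H} k) \<le> ennreal (1 / (1 - 2 powr - c)) * ennreal H"
proof (cases "H = 0")
  case True
  then show ?thesis by simp
next
  case False
  with H have H: "H > 0" by simp
  define m where "m = \<lfloor>log 2 H / c\<rfloor>"
  have *: "dy k c \<le> H \<longleftrightarrow> k \<le> m" for k
  proof -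
    have "dy k c \<le> H \<longleftrightarrow> of_int k * c \<le> log 2 H"
      using H by (simp add: le_log_iff)
    also have "\<dots> \<longleftrightarrow> k \<le> m"
      unfolding m_def le_floor_iff using c by (simp add: pos_le_divide_eq)
    finally show ?thesis .
  qed
  have q: "2 powr - c < 1" using c by (auto simp: powr_less_one)
  have "(\<Sum>z k. ennreal (dy k c) * indicator {k. dy k c \<le> H} k)
      = (\<Sum>z k. ennreal (dy k c) * indicator {..m} k)"
    by (intro nn_integral_cong) (auto simp: * indicator_def)
  also have "\<dots> \<le> ennreal (dy m c / (1 - 2 powr - c))"
    by (rule zsum_scales_atMost[OF c])
  also have "\<dots> \<le> ennreal (H / (1 - 2 powr - c))"
    using *[of m] q by (intro ennreal_leI divide_right_mono) auto
  also have "\<dots> = ennreal (1 / (1 - 2 powr - c)) * ennreal H"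
    using q H by (simp add: ennreal_mult[symmetric])
  finally show ?thesis .
qed

text \<open>The value of the geometric series with ratio \<open>2 powr - \<bar>c\<bar>\<close>; the
  absolute value lets one constant serve increasing and decreasing weights.\<close>

definition geo :: "real \<Rightarrow> real" where "geo c = 1 / (1 - 2 powr - \<bar>c\<bar>)"

lemma geo_pos: "c \<noteq> 0 \<Longrightarrow> geo c > 0"
  by (simp add: geo_def powr_less_one)

text \<open>The admissible k form a half line along which the terms decay geometrically from an
  extreme term that is at most H. Reflecting k reduces c < 0 to c > 0. Most sums over scales below
  converge by this lemma.\<close>

lemma zsum_geometric:
  assumes c: "c \<noteq> 0"
  shows "(\<Sum>z k. ennreal (dy k c) * indicator {k. ennreal (dy k c) \<le> H} k) \<le> ennreal (geo c) * H"
proof (cases H rule: ennreal_cases)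
  case top
  with geo_pos[OF c] show ?thesis by (simp add: ennreal_mult_top)
next
  case (real h)
  show ?thesis
  proof (cases "c > 0")
    case True
    with zsum_geometric_real[OF True, of h] real show ?thesis by (simp add: geo_def)
  next
    case False
    with c have c': "- c > 0" by simp
    have "(\<Sum>z k. ennreal (dy k c) * indicator {k. ennreal (dy k c) \<le> H} k)
      = (\<Sum>z k. ennreal (dy k (-c)) * indicator {k. dy k (-c) \<le> h} k)"
      using real by (subst zsum_uminus[symmetric]) (auto simp: indicator_def intro!: nn_integral_cong)
    with zsum_geometric_real[OF c', of h] real c' show ?thesis by (simp add: geo_def)
  qed
qed

subsection \<open>Balls\<close>

abbreviation rad :: "int \<Rightarrow> real" where "rad k \<equiv> 2 powr of_int k"

abbreviation ubv :: "'a::euclidean_space itself \<Rightarrow> real"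
  where "ubv _ \<equiv> unit_ball_vol (real DIM('a))"

abbreviation vol :: "'a::euclidean_space set \<Rightarrow> ennreal"
  where "vol \<equiv> emeasure lborel"

abbreviation ball_int :: "('a::euclidean_space \<Rightarrow> ennreal) \<Rightarrow> 'a \<Rightarrow> real \<Rightarrow> ennreal"
  where "ball_int u x R \<equiv> \<integral>\<^sup>+y\<in>ball x R. u y \<partial>lborel"

lemma ubv_pos [simp]: "ubv TYPE('a::euclidean_space) > 0"
  by (rule unit_ball_vol_pos) simp

lemma ubv_nonzero [simp]: "ubv TYPE('a::euclidean_space) \<noteq> 0"
  using ubv_pos[where 'a='a] by linarith

lemma ubv_nonneg [simp]: "ubv TYPE('a::euclidean_space) \<ge> 0"
  using ubv_pos[where 'a='a] by linarith

lemma borel_ball [measurable]: "ball x r \<in> sets borel"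
  by simp

lemma ball_subset_double:
  fixes x :: "'a::euclidean_space"
  assumes "x \<in> ball c \<rho>" "\<rho> \<le> R" "\<sigma> \<le> R" shows "ball x \<sigma> \<subseteq> ball c (2 * R)"
  using assms by (auto simp: ball_subset_ball_iff dist_commute)

lemma rad_Suc: "rad (k + 1) = 2 * rad k"
  by (simp add: powr_add)

lemma emeasure_ball_powr:
  fixes x :: "'a::euclidean_space"
  assumes "\<rho> > 0"
  shows "vol (ball x \<rho>) = ennreal (ubv TYPE('a) * \<rho> powr real DIM('a))"
  using assms by (simp add: emeasure_ball powr_realpow)

lemma emeasure_ball_rad:
  fixes x :: "'a::euclidean_space"
  shows "vol (ball x (rad k)) = ennreal (ubv TYPE('a) * dy k (real DIM('a)))"
  by (simp add: emeasure_ball_powr powr_powr)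

lemma borel_measurable_ball_nn_integral [measurable]:
  fixes u :: "'a::euclidean_space \<Rightarrow> ennreal"
  assumes [measurable]: "u \<in> borel_measurable borel"
  shows "(\<lambda>x. \<integral>\<^sup>+y\<in>ball x R. u y \<partial>lborel) \<in> borel_measurable borel"
proof -
  have "(\<lambda>z. u (snd z) * indicator {z. dist (fst z) (snd z) < R} z)
      \<in> borel_measurable ((borel :: 'a measure) \<Otimes>\<^sub>M lborel)"
    by measurable
  then have "(\<lambda>x. \<integral>\<^sup>+y. u (snd (x, y)) * indicator {z. dist (fst z) (snd z) < R} (x, y) \<partial>lborel)
      \<in> borel_measurable borel"
    by (intro sigma_finite_measure.borel_measurable_nn_integral sigma_finite_lborel) simp
  then show ?thesis
    by (simp add: indicator_def ball_def)
qed

lemma borel_measurable_emeasure_ball_Int [measurable]: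
  fixes U :: "'a::euclidean_space set"
  assumes [measurable]: "U \<in> sets borel"
  shows "(\<lambda>x. vol (ball x R \<inter> U)) \<in> borel_measurable borel"
proof -
  have "(\<lambda>x. \<integral>\<^sup>+y\<in>ball x R. indicator U y \<partial>lborel) \<in> borel_measurable borel"
    by measurable
  moreover have "(ball_int (\<lambda>y. indicator U y) x R) = vol (ball x R \<inter> U)" for x
    by (simp add: indicator_inter_arith[symmetric] Int_commute)
  ultimately show ?thesis by simp
qed

text \<open>Tonelli for the kernel that is 1 where the distance is less than R: it is symmetric, so
  integration over balls of a fixed radius is self-adjoint.\<close>

lemma nn_integral_ball_swap:
  fixes u v :: "'a::euclidean_space \<Rightarrow> ennreal"
  assumes [measurable]: "u \<in> borel_measurable borel" "v \<in> borel_measurable borel"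
  shows "(\<integral>\<^sup>+x. v x * (ball_int u x R) \<partial>lborel)
    = (\<integral>\<^sup>+y. u y * (ball_int v y R) \<partial>lborel)"
proof -
  let ?I = "indicator {z::'a \<times> 'a. dist (fst z) (snd z) < R} :: _ \<Rightarrow> ennreal"
  have *: "(ball_int u x R) = (\<integral>\<^sup>+y. u y * ?I (x, y) \<partial>lborel)" for x and u :: "'a \<Rightarrow> ennreal"
    by (auto intro!: nn_integral_cong simp: indicator_def)
  have "(\<integral>\<^sup>+x. v x * (ball_int u x R) \<partial>lborel)
    = (\<integral>\<^sup>+x. (\<integral>\<^sup>+y. v x * (u y * ?I (x, y)) \<partial>lborel) \<partial>lborel)"
    unfolding * by (subst nn_integral_cmult) measurable
  also have "\<dots> = (\<integral>\<^sup>+y. (\<integral>\<^sup>+x. v x * (u y * ?I (x, y)) \<partial>lborel) \<partial>lborel)"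
    by (rule lborel_pair.Fubini') measurable
  also have "\<dots> = (\<integral>\<^sup>+y. (\<integral>\<^sup>+x. u y * (v x * ?I (y, x)) \<partial>lborel) \<partial>lborel)"
    by (intro nn_integral_cong) (auto simp: mult_ac indicator_def dist_commute)
  also have "\<dots> = (\<integral>\<^sup>+y. u y * (ball_int v y R) \<partial>lborel)"
    unfolding * by (subst nn_integral_cmult) measurable
  finally show ?thesis .
qed

text \<open>Swapping against the indicator of the outer ball leaves, for each y, the volume of an
  intersection of two balls. It is at most the volume of one of them, and it is 0 when y lies
  outside the enlarged ball.\<close>

lemma nn_integral_ball_ball_le:
  fixes u :: "'a::euclidean_space \<Rightarrow> ennreal"
  assumes [measurable]: "u \<in> borel_measurable borel"
  shows "(ball_int (\<lambda>x. (ball_int u x R)) c \<rho>)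
    \<le> vol (ball (0::'a) R) * (ball_int u c (\<rho> + R))"
proof -
  have R: "vol (ball y R) = vol (ball (0::'a) R)" for y :: 'a
    by (cases "R > 0") (simp_all add: emeasure_ball_powr ball_empty)
  have "(ball_int (\<lambda>x. (ball_int u x R)) c \<rho>)
    = (\<integral>\<^sup>+x. indicator (ball c \<rho>) x * (ball_int u x R) \<partial>lborel)"
    by (intro nn_integral_cong) (rule mult.commute)
  also have "\<dots> = (\<integral>\<^sup>+y. u y * (ball_int (\<lambda>x. indicator (ball c \<rho>) x) y R) \<partial>lborel)"
    by (rule nn_integral_ball_swap) measurable
  also have "\<dots> \<le> (\<integral>\<^sup>+y. vol (ball (0::'a) R) * (u y * indicator (ball c (\<rho> + R)) y) \<partial>lborel)"
  proof (rule nn_integral_mono)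
    fix y
    show "u y * (ball_int (\<lambda>x. indicator (ball c \<rho>) x) y R)
        \<le> vol (ball (0::'a) R) * (u y * indicator (ball c (\<rho> + R)) y)"
    proof (cases "y \<in> ball c (\<rho> + R)")
      case True
      have "(ball_int (\<lambda>x. indicator (ball c \<rho>) x) y R) \<le> (\<integral>\<^sup>+x. indicator (ball y R) x \<partial>lborel)"
        by (intro nn_integral_mono) (auto simp: indicator_def)
      also have "\<dots> = vol (ball (0::'a) R)" using R[of y] by simp
      finally have "u y * (ball_int (\<lambda>x. indicator (ball c \<rho>) x) y R)
          \<le> u y * vol (ball (0::'a) R)"
        by (rule mult_left_mono) simp
      then show ?thesis using True by (simp add: mult.commute[of "u y"])
    next
      case False
      have "indicator (ball c \<rho>) x * indicator (ball y R) x = (0::ennreal)" for x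
      proof -
        have "\<not> (dist c x < \<rho> \<and> dist y x < R)"
          using False dist_triangle[of c y x] by (auto simp: dist_commute)
        then show ?thesis by (auto simp: indicator_def)
      qed
      then have "(ball_int (\<lambda>x. indicator (ball c \<rho>) x) y R) = 0"
        by (simp only: nn_integral_const mult_zero_left)
      then show ?thesis by simp
    qed
  qed
  also have "\<dots> = vol (ball (0::'a) R) * (ball_int u c (\<rho> + R))"
    by (subst nn_integral_cmult) measurable
  finally show ?thesis .
qed

lemma nn_integral_emeasure_ball_Int_le:
  fixes U :: "'a::euclidean_space set"
  assumes [measurable]: "U \<in> sets borel"
  shows "(ball_int (\<lambda>x. vol (ball x R \<inter> U)) c \<rho>)
    \<le> vol (ball (0::'a) R) * vol (U \<inter> ball c (\<rho> + R))"
proof -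
  have *: "(ball_int (\<lambda>y. indicator U y) x R) = vol (ball x R \<inter> U)" for x R
    by (simp add: indicator_inter_arith[symmetric] Int_commute)
  from nn_integral_ball_ball_le[where u="indicator U" and \<rho>=\<rho> and R=R and c=c] show ?thesis
    by (simp add: * Int_commute)
qed

subsection \<open>Discretization of the level-set integral\<close>

text \<open>The part of the level set at distance about \<open>2\<^sup>k\<close> is controlled by a set \<open>U k\<close>
  that at least one of the two points must belong to.\<close>

definition Dop :: "real \<Rightarrow> (int \<Rightarrow> 'a::euclidean_space set) \<Rightarrow> 'a \<Rightarrow> ennreal" where
  "Dop \<gamma> U x = (\<Sum>z k. ennreal (dy k \<gamma>) *
     (indicator (U k) x + ennreal (dy k (- real DIM('a))) * vol (ball x (rad k) \<inter> U k)))"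

lemma borel_measurable_Dop [measurable]:
  assumes [measurable]: "\<And>k. U k \<in> sets borel"
  shows "Dop \<gamma> U \<in> borel_measurable borel"
  unfolding Dop_def
  by measurable

text \<open>The power of 2 is the variation of the kernel over one annulus. The maximum covers both
  terms of \<open>Dop\<close>: one carries the volume of a ball, the other has coefficient
  1.\<close>

definition disc_const :: "'a::euclidean_space itself \<Rightarrow> real \<Rightarrow> real" where
  "disc_const _ \<gamma> = 2 powr \<bar>\<gamma> - DIM('a)\<bar> * max 1 (ubv TYPE('a))"

lemma disc_const_pos: "disc_const TYPE('a::euclidean_space) \<gamma> > 0"
  by (simp add: disc_const_def)

text \<open>On the annulus of scale k the kernel is comparable to 2^(k (\<gamma> - n)). If x is in
  \<open>U k\<close>, the whole ball may contribute, with volume about 2^(k n); otherwise y is in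
  \<open>U k\<close> and only the part of the ball inside \<open>U k\<close> contributes. These are
  the two terms of \<open>Dop\<close>.\<close>

lemma Dint_le_Dop:
  fixes f :: "'a::euclidean_space \<Rightarrow> real"
  assumes U [measurable]: "\<And>k. U k \<in> sets borel"
    and D: "\<And>x y k. (x, y) \<in> Dset lam \<beta> \<sigma> f \<Longrightarrow> rad (k - 1) \<le> dist x y \<Longrightarrow> dist x y < rad k
        \<Longrightarrow> x \<in> U k \<or> y \<in> U k"
  shows "Dint lam \<beta> \<sigma> \<gamma> f x \<le> ennreal (disc_const TYPE('a) \<gamma>) * Dop \<gamma> U x"
proof -
  let ?n = "real DIM('a)"
  let ?c = "2 powr \<bar>\<gamma> - ?n\<bar>"
  let ?v = "\<lambda>k y. (indicator (ball x (rad k)) y * indicator (U k) x + indicator (ball x (rad k) \<inter> U k) y) :: ennreal"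
  have pt: "indicator (Dset lam \<beta> \<sigma> f) (x, y) * ennreal (dist x y powr (\<gamma> - ?n))
      \<le> (\<Sum>z k. ennreal (?c * dy k (\<gamma> - ?n)) * ?v k y)" for y
  proof (cases "(x, y) \<in> Dset lam \<beta> \<sigma> f")
    case True
    then have "dist x y > 0" by (auto simp: Dset_def)
    then obtain j where j: "rad j \<le> dist x y" "dist x y < rad (j + 1)"
      using scale_exists[of "dist x y"] by (auto simp del: of_int_add)
    \<comment> \<open>Annuli are indexed by their outer radius, whereas \<open>scale_exists\<close>
      returns the inner one.\<close>
    define k where "k = j + 1"
    have k: "rad (k - 1) \<le> dist x y" "dist x y < rad k"
      using j by (simp_all add: k_def)
    have "dist x y powr (\<gamma> - ?n) \<le> ?c * dy k (\<gamma> - ?n)"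
    proof (cases "\<gamma> - ?n \<ge> 0")
      case True
      have "dist x y powr (\<gamma> - ?n) \<le> rad k powr (\<gamma> - ?n)"
        using k True by (intro powr_mono2) auto
      also have "\<dots> \<le> ?c * dy k (\<gamma> - ?n)"
        using True ge_one_powr_ge_zero[of 2 "\<gamma> - ?n"] by (simp add: powr_powr mult_le_cancel_right1)
      finally show ?thesis .
    next
      case False
      have "dist x y powr (\<gamma> - ?n) \<le> rad (k - 1) powr (\<gamma> - ?n)"
        using k False by (intro powr_mono2') auto
      also have "\<dots> = ?c * dy k (\<gamma> - ?n)"
      proof -
        have "of_int (k - 1) * (\<gamma> - ?n) = \<bar>\<gamma> - ?n\<bar> + of_int k * (\<gamma> - ?n)"
          using False by (simp add: algebra_simps)
        then show ?thesis by (simp only: powr_powr powr_add[symmetric])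
      qed
      finally show ?thesis .
    qed
    moreover have "?v k y \<ge> 1"
      using D[OF True k] k by (auto simp: indicator_def)
    ultimately have "ennreal (dist x y powr (\<gamma> - ?n)) * 1 \<le> ennreal (?c * dy k (\<gamma> - ?n)) * ?v k y"
      by (intro mult_mono ennreal_leI) auto
    also have "\<dots> \<le> (\<Sum>z k. ennreal (?c * dy k (\<gamma> - ?n)) * ?v k y)"
      by (rule zsum_mem_le)
    finally show ?thesis using True by simp
  qed simp
  have "Dint lam \<beta> \<sigma> \<gamma> f x \<le> (\<integral>\<^sup>+y. (\<Sum>z k. ennreal (?c * dy k (\<gamma> - ?n)) * ?v k y) \<partial>lborel)"
    unfolding Dint_def nn_integral_completion by (rule nn_integral_mono) (rule pt)
  also have "\<dots> = (\<Sum>z k. \<integral>\<^sup>+y. ennreal (?c * dy k (\<gamma> - ?n)) * ?v k y \<partial>lborel)"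
    by (rule zsum_nn_integral) measurable
  also have "\<dots> \<le> (\<Sum>z k. ennreal (disc_const TYPE('a) \<gamma>) * (ennreal (dy k \<gamma>) *
     (indicator (U k) x + ennreal (dy k (- ?n)) * vol (ball x (rad k) \<inter> U k))))"
  proof (rule nn_integral_mono)
    fix k
    have "(\<integral>\<^sup>+y. ennreal (?c * dy k (\<gamma> - ?n)) * ?v k y \<partial>lborel)
      = ennreal (?c * dy k (\<gamma> - ?n)) * (vol (ball x (rad k)) * indicator (U k) x
           + vol (ball x (rad k) \<inter> U k))"
      by (simp add: nn_integral_cmult nn_integral_add nn_integral_multc)
    also have "\<dots> = ennreal (?c * dy k (\<gamma> - ?n)) * (ennreal (ubv TYPE('a) * dy k ?n) * indicator (U k) x
           + ennreal 1 * vol (ball x (rad k) \<inter> U k))"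
      by (simp add: emeasure_ball_rad)
    also have "\<dots> \<le> ennreal (?c * dy k (\<gamma> - ?n)) * (ennreal (max 1 (ubv TYPE('a)) * dy k ?n) * indicator (U k) x
           + ennreal (max 1 (ubv TYPE('a))) * vol (ball x (rad k) \<inter> U k))"
      by (intro mult_left_mono add_mono mult_right_mono ennreal_leI) auto
    also have "\<dots> = (ennreal (?c * dy k (\<gamma> - ?n)) * ennreal (max 1 (ubv TYPE('a)) * dy k ?n)) * indicator (U k) x
           + (ennreal (?c * dy k (\<gamma> - ?n)) * ennreal (max 1 (ubv TYPE('a)))) * vol (ball x (rad k) \<inter> U k)"
      by (simp add: distrib_left mult.assoc)
    also have "ennreal (?c * dy k (\<gamma> - ?n)) * ennreal (max 1 (ubv TYPE('a)) * dy k ?n)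
        = ennreal (disc_const TYPE('a) \<gamma>) * ennreal (dy k \<gamma>)"
    proof -
      have "?c * dy k (\<gamma> - ?n) * (max 1 (ubv TYPE('a)) * dy k ?n)
          = disc_const TYPE('a) \<gamma> * (dy k (\<gamma> - ?n) * dy k ?n)"
        unfolding disc_const_def by (simp only: mult_ac)
      also have "dy k (\<gamma> - ?n) * dy k ?n = dy k \<gamma>"
        by (subst dy_add[symmetric]) simp
      finally show ?thesis by (simp flip: ennreal_mult'')
    qed
    also have "ennreal (?c * dy k (\<gamma> - ?n)) * ennreal (max 1 (ubv TYPE('a)))
        = ennreal (disc_const TYPE('a) \<gamma>) * ennreal (dy k \<gamma>) * ennreal (dy k (- ?n))"
    proof -
      have "dy k (\<gamma> - ?n) = dy k \<gamma> * dy k (- ?n)"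
        by (subst dy_add[symmetric]) simp
      then have "?c * dy k (\<gamma> - ?n) * max 1 (ubv TYPE('a))
          = disc_const TYPE('a) \<gamma> * dy k \<gamma> * dy k (- ?n)"
        unfolding disc_const_def by (simp only: mult_ac)
      then show ?thesis using disc_const_pos[where 'a='a, of \<gamma>]
        by (simp add: ennreal_mult'[symmetric] ennreal_mult''[symmetric])
    qed
    finally show "(\<integral>\<^sup>+y. ennreal (?c * dy k (\<gamma> - ?n)) * ?v k y \<partial>lborel)
       \<le> ennreal (disc_const TYPE('a) \<gamma>) * (ennreal (dy k \<gamma>) *
     (indicator (U k) x + ennreal (dy k (- ?n)) * vol (ball x (rad k) \<inter> U k)))"
      by (simp add: distrib_left mult.assoc)
  qed
  also have "\<dots> = ennreal (disc_const TYPE('a) \<gamma>) * Dop \<gamma> U x"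
    unfolding Dop_def by (subst nn_integral_cmult) auto
  finally show ?thesis .
qed

subsection \<open>Morrey bounds\<close>

text \<open>For \<theta> = r/\<alpha> this is the Morrey bound with the root and the powers of the
  volume cleared away (\<open>morrey_norm_le_iff\<close>); K is the r-th power of the norm up to a
  fixed factor. Replacing F by its power F^b and r by r/b leaves \<theta> and K unchanged.\<close>

definition mb :: "real \<Rightarrow> real \<Rightarrow> real \<Rightarrow> ('a::euclidean_space \<Rightarrow> ennreal) \<Rightarrow> bool" where
  "mb r \<theta> K F \<longleftrightarrow> (\<forall>x. \<forall>\<rho>>0. (ball_int (\<lambda>y. epow (F y) r) x \<rho>)
      \<le> ennreal (K * \<rho> powr (real DIM('a) * (1 - \<theta>))))"

lemma mbD:
  fixes F :: "'a::euclidean_space \<Rightarrow> ennreal"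
  shows "mb r \<theta> K F \<Longrightarrow> \<rho> > 0 \<Longrightarrow> (ball_int (\<lambda>y. epow (F y) r) x \<rho>)
      \<le> ennreal (K * \<rho> powr (real DIM('a) * (1 - \<theta>)))"
  by (simp add: mb_def)

lemma mb_mono:
  assumes "mb r \<theta> K F" "0 < r" "\<And>x. G x \<le> F x" "K \<le> L"
  shows "mb r \<theta> L G"
  unfolding mb_def
proof (intro allI impI)
  fix x :: 'a and \<rho> :: real assume \<rho>: "\<rho> > 0"
  have "(ball_int (\<lambda>y. epow (G y) r) x \<rho>) \<le> (ball_int (\<lambda>y. epow (F y) r) x \<rho>)"
    using assms by (intro nn_integral_mono mult_right_mono epow_mono) auto
  also have "\<dots> \<le> ennreal (K * \<rho> powr (real DIM('a) * (1 - \<theta>)))"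
    using assms(1) \<rho> by (rule mbD)
  also have "\<dots> \<le> ennreal (L * \<rho> powr (real DIM('a) * (1 - \<theta>)))"
    using assms(4) by (intro ennreal_leI mult_right_mono) auto
  finally show "(ball_int (\<lambda>y. epow (G y) r) x \<rho>) \<le> ennreal (L * \<rho> powr (real DIM('a) * (1 - \<theta>)))" .
qed

lemma mb_cmult:
  assumes F: "F \<in> borel_measurable borel" and "mb r \<theta> K F" "0 \<le> c"
  shows "mb r \<theta> (c powr r * K) (\<lambda>x. ennreal c * F x)"
  unfolding mb_def
proof (intro allI impI)
  fix x :: 'a and \<rho> :: real assume \<rho>: "\<rho> > 0"
  have "(ball_int (\<lambda>y. epow (ennreal c * F y) r) x \<rho>)
     = ennreal (c powr r) * (ball_int (\<lambda>y. epow (F y) r) x \<rho>)"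
  proof -
    note F [measurable]
    have "(ball_int (\<lambda>y. epow (ennreal c * F y) r) x \<rho>)
      = (\<integral>\<^sup>+y. ennreal (c powr r) * (epow (F y) r * indicator (ball x \<rho>) y) \<partial>lborel)"
      using \<open>0 \<le> c\<close> by (simp add: epow_mult mult.assoc)
    also have "\<dots> = ennreal (c powr r) * (ball_int (\<lambda>y. epow (F y) r) x \<rho>)"
      by (rule nn_integral_cmult) measurable
    finally show ?thesis .
  qed
  also have "\<dots> \<le> ennreal (c powr r) * ennreal (K * \<rho> powr (real DIM('a) * (1 - \<theta>)))"
    by (intro mult_left_mono mbD assms \<rho>) auto
  also have "\<dots> = ennreal (c powr r * K * \<rho> powr (real DIM('a) * (1 - \<theta>)))"
    by (simp add: ennreal_mult'[symmetric] mult.assoc)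
  finally show "(ball_int (\<lambda>y. epow (ennreal c * F y) r) x \<rho>)
    \<le> ennreal (c powr r * K * \<rho> powr (real DIM('a) * (1 - \<theta>)))" .
qed

lemma mb_add:
  assumes [measurable]: "F \<in> borel_measurable borel" "G \<in> borel_measurable borel"
    and "mb r \<theta> K F" "mb r \<theta> L G" "0 \<le> r" "0 \<le> K" "0 \<le> L"
  shows "mb r \<theta> (2 powr r * (K + L)) (\<lambda>x. F x + G x)"
  unfolding mb_def
proof (intro allI impI)
  fix x :: 'a and \<rho> :: real assume \<rho>: "\<rho> > 0"
  let ?R = "\<rho> powr (real DIM('a) * (1 - \<theta>))"
  have "(ball_int (\<lambda>y. epow (F y + G y) r) x \<rho>)
     \<le> (\<integral>\<^sup>+y. ennreal (2 powr r) * (epow (F y) r * indicator (ball x \<rho>) y + epow (G y) r * indicator (ball x \<rho>) y) \<partial>lborel)"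
    using epow_sum_le[OF \<open>0 \<le> r\<close>] by (intro nn_integral_mono) (auto simp: indicator_def)
  also have "\<dots> = ennreal (2 powr r) * ((ball_int (\<lambda>y. epow (F y) r) x \<rho>) + (ball_int (\<lambda>y. epow (G y) r) x \<rho>))"
    by (subst nn_integral_cmult; (subst nn_integral_add)?) auto
  also have "\<dots> \<le> ennreal (2 powr r) * (ennreal (K * ?R) + ennreal (L * ?R))"
    by (intro mult_left_mono add_mono mbD assms \<rho>) auto
  also have "\<dots> = ennreal (2 powr r * (K + L) * ?R)"
    using assms by (simp add: ennreal_mult'[symmetric] ennreal_plus[symmetric] algebra_simps del: ennreal_plus)
  finally show "(ball_int (\<lambda>y. epow (F y + G y) r) x \<rho>)
    \<le> ennreal (2 powr r * (K + L) * ?R)" .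
qed

text \<open>For exponent 1 it suffices to control the sets \<open>U k\<close> themselves: at scales below the
  radius of the ball Fubini applies on the doubled ball, while larger scales gain a geometric factor.\<close>

lemma mb_1_Dop:
  fixes U :: "int \<Rightarrow> 'a::euclidean_space set"
  assumes U [measurable]: "\<And>k. U k \<in> sets borel" and \<theta>: "\<theta> > 0" and K: "K \<ge> 0"
    and bd: "\<And>x \<rho>. \<rho> > 0 \<Longrightarrow> (\<Sum>z k. ennreal (dy k \<gamma>) * vol (U k \<inter> ball x \<rho>))
      \<le> ennreal (K * \<rho> powr (real DIM('a) * (1 - \<theta>)))"
  shows "mb 1 \<theta> ((1 + ubv TYPE('a) * 2 powr (real DIM('a) * (1 - \<theta>)) * (1 + geo (real DIM('a) * \<theta>))) * K) (Dop \<gamma> U)"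
  unfolding mb_def
proof (intro allI impI)
  fix x0 :: 'a and \<rho> :: real assume \<rho>: "\<rho> > 0"
  let ?n = "real DIM('a)" and ?w = "ubv TYPE('a)"
  let ?e = "?n * (1 - \<theta>)"
  let ?B = "ball x0 \<rho>"
  define b where "b = ?w * \<rho> powr ?n * K * 2 powr ?e"
  have b: "b \<ge> 0" using K by (simp add: b_def less_imp_le)
  have w: "?w > 0" by simp
  \<comment> \<open>For \<open>rad k\<close> above \<rho> the factor 2^(- k n \<theta>) is at most
    \<rho> powr (- n \<theta>), so all far scales fall into the range that
    \<open>zsum_geometric\<close> sums.\<close>
  let ?H = "ennreal (\<rho> powr - (?n * \<theta>))"
  let ?far = "\<lambda>k. ennreal (dy k (- (?n * \<theta>))) * indicator {k. ennreal (dy k (- (?n * \<theta>))) \<le> ?H} k"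
  have scale_bd: "ennreal (dy k \<gamma>) * (ennreal (dy k (- ?n)) * (\<integral>\<^sup>+x\<in>?B. vol (ball x (rad k) \<inter> U k) \<partial>lborel))
     \<le> ennreal ?w * (ennreal (dy k \<gamma>) * vol (U k \<inter> ball x0 (2 * \<rho>)))
       + ennreal b * ?far k" (is "?L \<le> _") for k
  proof (cases "rad k \<le> \<rho>")
    case True
    have "(\<integral>\<^sup>+x\<in>?B. vol (ball x (rad k) \<inter> U k) \<partial>lborel)
        \<le> vol (ball (0::'a) (rad k)) * vol (U k \<inter> ball x0 (\<rho> + rad k))"
      by (rule nn_integral_emeasure_ball_Int_le) simp
    also have "\<dots> \<le> ennreal (?w * dy k ?n) * vol (U k \<inter> ball x0 (2 * \<rho>))"
      unfolding emeasure_ball_rad using True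
      by (intro mult_left_mono emeasure_mono) (auto intro!: subset_ball)
    finally have "?L \<le> ennreal (dy k \<gamma>) * (ennreal (dy k (- ?n)) * (ennreal (?w * dy k ?n) * vol (U k \<inter> ball x0 (2 * \<rho>))))"
      by (intro mult_left_mono) auto
    also have "\<dots> = ennreal (dy k (- ?n)) * ennreal (?w * dy k ?n) * (ennreal (dy k \<gamma>) * vol (U k \<inter> ball x0 (2 * \<rho>)))"
      by (simp add: mult_ac)
    also have "ennreal (dy k (- ?n)) * ennreal (?w * dy k ?n) = ennreal ?w"
      by (simp add: ennreal_mult'[symmetric] powr_minus)
    finally show ?thesis by (rule order_trans) simp
  next
    case False
    then have k: "\<rho> < rad k" by simp
    have "(\<integral>\<^sup>+x\<in>?B. vol (ball x (rad k) \<inter> U k) \<partial>lborel)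
      \<le> (\<integral>\<^sup>+x\<in>?B. vol (U k \<inter> ball x0 (2 * rad k)) \<partial>lborel)"
    proof (intro nn_integral_mono)
      fix x
      show "vol (ball x (rad k) \<inter> U k) * indicator ?B x
        \<le> vol (U k \<inter> ball x0 (2 * rad k)) * indicator ?B x"
      proof (cases "x \<in> ?B")
        case True
        have "ball x (rad k) \<subseteq> ball x0 (2 * rad k)"
          using k by (intro ball_subset_double[OF True]) auto
        then show ?thesis
          by (intro mult_right_mono emeasure_mono) auto
      qed simp
    qed
    also have "\<dots> = ennreal (?w * \<rho> powr ?n) * vol (U k \<inter> ball x0 (2 * rad k))"
      using \<rho> by (subst nn_integral_cmult) (simp_all add: emeasure_ball_powr mult.commute[of "ennreal (?w * \<rho> powr ?n)"])
    finally have "?L \<le> ennreal (dy k \<gamma>) * (ennreal (dy k (- ?n)) * (ennreal (?w * \<rho> powr ?n) * vol (U k \<inter> ball x0 (2 * rad k))))"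
      by (intro mult_left_mono) auto
    also have "\<dots> = ennreal (dy k (- ?n)) * ennreal (?w * \<rho> powr ?n) * (ennreal (dy k \<gamma>) * vol (U k \<inter> ball x0 (2 * rad k)))"
      by (simp add: mult_ac)
    also have "\<dots> \<le> ennreal (dy k (- ?n)) * ennreal (?w * \<rho> powr ?n) * ennreal (K * (2 * rad k) powr ?e)"
    proof (intro mult_left_mono)
      \<comment> \<open>Only the k-th term of the sum in \<open>bd\<close> is kept, on a ball whose
        radius depends on k.\<close>
      show "ennreal (dy k \<gamma>) * vol (U k \<inter> ball x0 (2 * rad k)) \<le> ennreal (K * (2 * rad k) powr ?e)"
        by (rule order_trans[OF zsum_mem_le bd]) simp
    qed auto
    also have "\<dots> = ennreal (dy k (- ?n) * (?w * \<rho> powr ?n) * (K * (2 * rad k) powr ?e))"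
      by (simp add: ennreal_mult'[symmetric] ennreal_mult''[symmetric] K)
    also have "dy k (- ?n) * (?w * \<rho> powr ?n) * (K * (2 * rad k) powr ?e) = b * dy k (- (?n * \<theta>))"
    proof -
      have "(2 * rad k) powr ?e = 2 powr ?e * dy k ?e"
        by (simp add: powr_mult powr_powr)
      moreover have "dy k (- ?n) * dy k ?e = dy k (- (?n * \<theta>))"
        by (simp add: powr_add[symmetric] algebra_simps)
      ultimately show ?thesis by (simp add: b_def mult_ac)
    qed
    also have "ennreal (b * dy k (- (?n * \<theta>))) = ennreal b * ?far k"
    proof -
      have "dy k (- (?n * \<theta>)) = rad k powr (- (?n * \<theta>))"
        by (simp add: powr_powr)
      also have "\<dots> \<le> \<rho> powr (- (?n * \<theta>))"
        using k \<rho> \<theta> by (intro powr_mono2') auto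
      finally show ?thesis using b by (simp add: ennreal_mult)
    qed
    finally show ?thesis by (rule order_trans) simp
  qed
  have "(\<integral>\<^sup>+x\<in>?B. epow (Dop \<gamma> U x) 1 \<partial>lborel)
    = (\<integral>\<^sup>+x. (\<Sum>z k. (ennreal (dy k \<gamma>) * (indicator (U k) x + ennreal (dy k (- ?n)) * vol (ball x (rad k) \<inter> U k))) * indicator ?B x) \<partial>lborel)"
    unfolding Dop_def epow_1 by (subst nn_integral_multc) auto
  also have "\<dots> = (\<Sum>z k. \<integral>\<^sup>+x. (ennreal (dy k \<gamma>) * (indicator (U k) x + ennreal (dy k (- ?n)) * vol (ball x (rad k) \<inter> U k))) * indicator ?B x \<partial>lborel)"
    by (rule zsum_nn_integral) measurable
  also have "\<dots> = (\<Sum>z k. ennreal (dy k \<gamma>) * vol (U k \<inter> ?B) +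
      ennreal (dy k \<gamma>) * (ennreal (dy k (- ?n)) * (\<integral>\<^sup>+x\<in>?B. vol (ball x (rad k) \<inter> U k) \<partial>lborel)))"
  proof (rule nn_integral_cong)
    fix k
    have "(\<integral>\<^sup>+x. (ennreal (dy k \<gamma>) * (indicator (U k) x + ennreal (dy k (- ?n)) * vol (ball x (rad k) \<inter> U k))) * indicator ?B x \<partial>lborel)
      = (\<integral>\<^sup>+x. ennreal (dy k \<gamma>) * indicator (U k \<inter> ?B) x + ennreal (dy k \<gamma>) * (ennreal (dy k (- ?n)) * (vol (ball x (rad k) \<inter> U k) * indicator ?B x)) \<partial>lborel)"
      by (intro nn_integral_cong) (auto simp: indicator_def distrib_left)
    also have "\<dots> = ennreal (dy k \<gamma>) * vol (U k \<inter> ?B) +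
      ennreal (dy k \<gamma>) * (ennreal (dy k (- ?n)) * (\<integral>\<^sup>+x\<in>?B. vol (ball x (rad k) \<inter> U k) \<partial>lborel))"
      by (simp add: nn_integral_cmult nn_integral_add)
    finally show "(\<integral>\<^sup>+x. (ennreal (dy k \<gamma>) * (indicator (U k) x + ennreal (dy k (- ?n)) * vol (ball x (rad k) \<inter> U k))) * indicator ?B x \<partial>lborel) = \<dots>" .
  qed
  also have "\<dots> \<le> (\<Sum>z k. ennreal (dy k \<gamma>) * vol (U k \<inter> ?B) +
       (ennreal ?w * (ennreal (dy k \<gamma>) * vol (U k \<inter> ball x0 (2 * \<rho>))) + ennreal b * ?far k))"
    by (intro nn_integral_mono add_mono scale_bd order_refl)
  also have "\<dots> = (\<Sum>z k. ennreal (dy k \<gamma>) * vol (U k \<inter> ?B)) +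
      (ennreal ?w * (\<Sum>z k. ennreal (dy k \<gamma>) * vol (U k \<inter> ball x0 (2 * \<rho>))) + ennreal b * (\<Sum>z k. ?far k))"
    by (simp add: nn_integral_add nn_integral_cmult)
  also have "\<dots> \<le> ennreal (K * \<rho> powr ?e) + (ennreal ?w * ennreal (K * (2 * \<rho>) powr ?e)
     + ennreal b * (ennreal (geo (- (?n * \<theta>))) * ?H))"
    using \<rho> \<theta> by (intro add_mono mult_left_mono bd zsum_geometric) auto
  also have "\<dots> = ennreal (K * \<rho> powr ?e + (?w * (K * (2 * \<rho>) powr ?e) + b * (geo (- (?n * \<theta>)) * \<rho> powr - (?n * \<theta>))))"
    using b K w geo_pos[of "- (?n * \<theta>)"] \<theta>
    by (simp add: ennreal_mult'[symmetric] ennreal_plus[symmetric] del: ennreal_plus)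
  also have "K * \<rho> powr ?e + (?w * (K * (2 * \<rho>) powr ?e) + b * (geo (- (?n * \<theta>)) * \<rho> powr - (?n * \<theta>)))
    = ((1 + ?w * 2 powr ?e * (1 + geo (?n * \<theta>))) * K) * \<rho> powr ?e"
  proof -
    have "\<rho> powr ?n * \<rho> powr - (?n * \<theta>) = \<rho> powr ?e"
      by (simp add: powr_add[symmetric] algebra_simps)
    then have "b * (geo (- (?n * \<theta>)) * \<rho> powr - (?n * \<theta>)) = ?w * K * 2 powr ?e * geo (?n * \<theta>) * \<rho> powr ?e"
      by (simp add: b_def geo_def mult_ac)
    then show ?thesis using \<rho> by (simp add: powr_mult algebra_simps)
  qed
  finally show "(\<integral>\<^sup>+x\<in>?B. epow (Dop \<gamma> U x) 1 \<partial>lborel)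
    \<le> ennreal (((1 + ?w * 2 powr ?e * (1 + geo (?n * \<theta>))) * K) * \<rho> powr ?e)" .
qed

subsection \<open>Covering estimates\<close>

lemma countable_disjoint_nn_integral_le:
  fixes A :: "'i \<Rightarrow> 'a::euclidean_space set"
  assumes [measurable]: "g \<in> borel_measurable borel" and C: "countable C"
    and A [measurable]: "\<And>i. A i \<in> sets borel" and dis: "disjoint_family_on A C"
  shows "(\<integral>\<^sup>+i. (\<integral>\<^sup>+y\<in>A i. g y \<partial>lborel) \<partial>count_space C) \<le> (\<integral>\<^sup>+y. g y \<partial>lborel)"
proof -
  have *: "emeasure (density lborel g) (A i) = (\<integral>\<^sup>+y\<in>A i. g y \<partial>lborel)" for i
    by (subst emeasure_density) auto
  have "(\<integral>\<^sup>+i. (\<integral>\<^sup>+y\<in>A i. g y \<partial>lborel) \<partial>count_space C)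
      = emeasure (density lborel g) (\<Union>i\<in>C. A i)"
    unfolding *[symmetric] by (rule emeasure_UN_countable[symmetric]) (use C dis in auto)
  also have "\<dots> \<le> emeasure (density lborel g) (space lborel)"
    by (rule emeasure_mono) auto
  also have "\<dots> = (\<integral>\<^sup>+y. g y \<partial>lborel)"
    by (subst emeasure_density) auto
  finally show ?thesis .
qed

text \<open>Vitali covering applied to the balls of mass above \<Lambda> times the power \<delta> of
  their radius: the selected balls are disjoint, so their masses add up to at most the total. The
  exponent is left free because \<delta> = n gives the weak type bound and \<delta> = n + \<gamma>
  the sum over scales.\<close>

lemma ball_family_cover:
  fixes g :: "'a::euclidean_space \<Rightarrow> ennreal"
  assumes g [measurable]: "g \<in> borel_measurable borel" and fin: "(\<integral>\<^sup>+y. g y \<partial>lborel) < top"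
    and \<Lambda>: "\<Lambda> > 0" and \<delta>: "\<delta> > 0"
  obtains C :: "('a \<times> int) set" where "countable C"
    "\<And>x k. (ball_int g x (rad k)) > ennreal (\<Lambda> * dy k \<delta>)
       \<Longrightarrow> \<exists>z l. (z, l) \<in> C \<and> x \<in> ball z (5 * rad l) \<and> k \<le> l + 3"
    "ennreal \<Lambda> * (\<integral>\<^sup>+p. ennreal (dy (snd p) \<delta>) \<partial>count_space C) \<le> (\<integral>\<^sup>+y. g y \<partial>lborel)"
proof -
  obtain G where G: "(\<integral>\<^sup>+y. g y \<partial>lborel) = ennreal G" "G \<ge> 0"
    using fin by (cases "\<integral>\<^sup>+y. g y \<partial>lborel" rule: ennreal_cases) auto
  define F where "F = {p :: 'a \<times> int. (ball_int g (fst p) (rad (snd p))) > ennreal (\<Lambda> * dy (snd p) \<delta>)}"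
  \<comment> \<open>Finite total mass and \<delta> > 0 bound the radii, as the covering lemma
    requires.\<close>
  have bd: "0 < rad (snd p) \<and> rad (snd p) \<le> (G / \<Lambda>) powr (1 / \<delta>)" if "p \<in> F" for p
  proof -
    have "ennreal (\<Lambda> * dy (snd p) \<delta>) \<le> (ball_int g (fst p) (rad (snd p)))"
      using that by (simp add: F_def)
    also have "\<dots> \<le> (\<integral>\<^sup>+y. g y \<partial>lborel)"
      by (intro nn_integral_mono) (auto simp: indicator_def)
    finally have "\<Lambda> * dy (snd p) \<delta> \<le> G" using G by (simp add: ennreal_le_iff)
    then have "dy (snd p) \<delta> \<le> G / \<Lambda>" using \<Lambda> by (simp add: field_simps)
    then have "dy (snd p) \<delta> powr (1 / \<delta>) \<le> (G / \<Lambda>) powr (1 / \<delta>)"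
      using \<delta> by (intro powr_mono2) auto
    then show ?thesis using \<delta> by (simp add: powr_powr)
  qed
  obtain C where C: "countable C" "C \<subseteq> F"
     "pairwise (\<lambda>p q. disjnt (cball (fst p) (rad (snd p))) (cball (fst q) (rad (snd q)))) C"
     and cov: "\<And>p. p \<in> F \<Longrightarrow> \<exists>q. q \<in> C \<and>
                        \<not> disjnt (cball (fst p) (rad (snd p))) (cball (fst q) (rad (snd q))) \<and>
                        cball (fst p) (rad (snd p)) \<subseteq> ball (fst q) (5 * rad (snd q))"
    by (rule Vitali_covering_lemma_cballs_balls[of F "\<lambda>p. rad (snd p)" _ fst, OF bd]) blast+
  show thesis
  proof (rule that)
    show "countable C" by (rule C)
    fix x k assume "(ball_int g x (rad k)) > ennreal (\<Lambda> * dy k \<delta>)"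
    then have "(x, k) \<in> F" by (simp add: F_def)
    from cov[OF this] obtain z l where q: "(z, l) \<in> C" "cball x (rad k) \<subseteq> ball z (5 * rad l)"
      by auto
    then have "dist x z + rad k < 5 * rad l"
      by (simp add: cball_subset_ball_iff)
    moreover have "rad k > 0" by simp
    ultimately have "dist x z < 5 * rad l" "rad k < 5 * rad l"
      using zero_le_dist[of x z] by linarith+
    then have "x \<in> ball z (5 * rad l)" "rad k < 5 * rad l"
      by (simp_all add: dist_commute)
    \<comment> \<open>The offset 3 comes from 5 < 8.\<close>
    moreover have "5 * rad l \<le> rad (l + 3)" by (simp add: powr_add)
    ultimately have "rad k < rad (l + 3)" by linarith
    then have "k \<le> l + 3" by simp
    with q \<open>x \<in> ball z (5 * rad l)\<close> show "\<exists>z l. (z, l) \<in> C \<and> x \<in> ball z (5 * rad l) \<and> k \<le> l + 3"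
      by blast
  next
    have "ennreal \<Lambda> * (\<integral>\<^sup>+p. ennreal (dy (snd p) \<delta>) \<partial>count_space C)
      = (\<integral>\<^sup>+p. ennreal (\<Lambda> * dy (snd p) \<delta>) \<partial>count_space C)"
      using \<Lambda> by (subst nn_integral_cmult[symmetric]) (auto simp: ennreal_mult)
    also have "\<dots> \<le> (\<integral>\<^sup>+p. (\<integral>\<^sup>+y\<in>cball (fst p) (rad (snd p)). g y \<partial>lborel) \<partial>count_space C)"
    proof (rule nn_integral_mono)
      fix p assume "p \<in> space (count_space C)"
      then have "p \<in> F" using C by auto
      then have "ennreal (\<Lambda> * dy (snd p) \<delta>) \<le> (ball_int g (fst p) (rad (snd p)))"
        by (simp add: F_def)
      also have "\<dots> \<le> (\<integral>\<^sup>+y\<in>cball (fst p) (rad (snd p)). g y \<partial>lborel)"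
        by (intro nn_integral_mono) (auto simp: indicator_def)
      finally show "ennreal (\<Lambda> * dy (snd p) \<delta>) \<le> (\<integral>\<^sup>+y\<in>cball (fst p) (rad (snd p)). g y \<partial>lborel)" .
    qed
    also have "\<dots> \<le> (\<integral>\<^sup>+y. g y \<partial>lborel)"
      using C by (intro countable_disjoint_nn_integral_le)
        (auto simp: disjoint_family_on_def pairwise_def disjnt_def)
    finally show "ennreal \<Lambda> * (\<integral>\<^sup>+p. ennreal (dy (snd p) \<delta>) \<partial>count_space C) \<le> (\<integral>\<^sup>+y. g y \<partial>lborel)" .
  qed
qed

lemma emeasure_ball_5_rad:
  fixes z :: "'a::euclidean_space"
  shows "vol (ball z (5 * rad l)) = ennreal (ubv TYPE('a) * 5 ^ DIM('a) * dy l (real DIM('a)))"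
  by (simp add: emeasure_ball_powr powr_powr powr_mult powr_realpow mult.assoc)

text \<open>Volume of the fivefold ball, times the sum of the weights of all scales up to l + 3
  relative to the weight of scale l.\<close>

definition scale_const :: "'a::euclidean_space itself \<Rightarrow> real \<Rightarrow> real" where
  "scale_const _ \<gamma> = ubv TYPE('a) * 5 ^ DIM('a) * (dy 3 \<gamma> / (1 - 2 powr - \<gamma>))"

text \<open>A point in the set of scale m lies in the fivefold enlargement of a selected ball of
  some scale l with m at most l + 3. Since \<gamma> > 0, the weights up to l + 3 sum to a multiple
  of 2^(l \<gamma>); with the volume 2^(l n) this is the power n + \<gamma> that the mass of the
  selected ball pays for.\<close>

lemma scale_sum_pos:
  fixes g :: "'a::euclidean_space \<Rightarrow> ennreal"
  assumes g [measurable]: "g \<in> borel_measurable borel" and \<Lambda>: "\<Lambda> > 0" and \<gamma>: "\<gamma> > 0"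
  shows "(\<Sum>z m. ennreal (dy m \<gamma>) *
      vol {x. (ball_int g x (rad m)) > ennreal (\<Lambda> * dy m (real DIM('a) + \<gamma>))})
    \<le> ennreal (scale_const TYPE('a) \<gamma> / \<Lambda>) * (\<integral>\<^sup>+y. g y \<partial>lborel)"
proof (cases "(\<integral>\<^sup>+y. g y \<partial>lborel) < top")
  case False
  have "scale_const TYPE('a) \<gamma> > 0"
    using \<gamma> by (simp add: scale_const_def powr_less_one)
  moreover have "(\<integral>\<^sup>+y. g y \<partial>lborel) = top" using False top.not_eq_extremum by blast
  ultimately show ?thesis
    using \<Lambda> by (simp add: ennreal_mult_top)
next
  case True
  let ?n = "real DIM('a)"
  define S where "S = (\<lambda>m. {x::'a. (ball_int g x (rad m)) > ennreal (\<Lambda> * dy m (?n + \<gamma>))})"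
  have S [measurable]: "S m \<in> sets borel" for m
    unfolding S_def by measurable
  have n\<gamma>: "?n + \<gamma> > 0" using \<gamma> by simp
  obtain C :: "('a \<times> int) set" where C: "countable C"
    "\<And>x k. (ball_int g x (rad k)) > ennreal (\<Lambda> * dy k (?n + \<gamma>))
       \<Longrightarrow> \<exists>z l. (z, l) \<in> C \<and> x \<in> ball z (5 * rad l) \<and> k \<le> l + 3"
    "ennreal \<Lambda> * (\<integral>\<^sup>+p. ennreal (dy (snd p) (?n + \<gamma>)) \<partial>count_space C) \<le> (\<integral>\<^sup>+y. g y \<partial>lborel)"
    by (rule ball_family_cover[OF g True \<Lambda> n\<gamma>]) (rule that; assumption)
  let ?q = "1 - 2 powr - \<gamma>"
  have q: "?q > 0" using \<gamma> by (simp add: powr_less_one)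
  let ?c = "dy 3 \<gamma> / ?q"
  have pt: "(\<Sum>z m. ennreal (dy m \<gamma>) * indicator (S m) x)
     \<le> (\<integral>\<^sup>+p. ennreal (?c * dy (snd p) \<gamma>) * indicator (ball (fst p) (5 * rad (snd p))) x \<partial>count_space C)" for x
  proof -
    have "(\<Sum>z m. ennreal (dy m \<gamma>) * indicator (S m) x)
      \<le> (\<Sum>z m. \<integral>\<^sup>+p. ennreal (dy m \<gamma>) * indicator {..snd p + 3} m * indicator (ball (fst p) (5 * rad (snd p))) x \<partial>count_space C)"
    proof (rule nn_integral_mono)
      fix m
      show "ennreal (dy m \<gamma>) * indicator (S m) x \<le> (\<integral>\<^sup>+p. ennreal (dy m \<gamma>) * indicator {..snd p + 3} m * indicator (ball (fst p) (5 * rad (snd p))) x \<partial>count_space C)"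
      proof (cases "x \<in> S m")
        case True
        then obtain z l where zl: "(z, l) \<in> C" "x \<in> ball z (5 * rad l)" "m \<le> l + 3"
          using C(2)[where x=x and k=m] by (auto simp: S_def)
        then have "ennreal (dy m \<gamma>) * indicator (S m) x
          \<le> ennreal (dy m \<gamma>) * indicator {..snd (z,l) + 3} m * indicator (ball (fst (z,l)) (5 * rad (snd (z,l)))) x"
          by (simp add: indicator_def)
        also have "\<dots> \<le> (\<integral>\<^sup>+p. ennreal (dy m \<gamma>) * indicator {..snd p + 3} m * indicator (ball (fst p) (5 * rad (snd p))) x \<partial>count_space C)"
          by (rule nn_integral_ge_point[OF zl(1)])
        finally show ?thesis .
      qed simp
    qed
    also have "\<dots> = (\<integral>\<^sup>+p. (\<Sum>z m. ennreal (dy m \<gamma>) * indicator {..snd p + 3} m * indicator (ball (fst p) (5 * rad (snd p))) x) \<partial>count_space C)"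
      by (rule nn_integral_count_space_nn_integral[symmetric]) auto
    also have "\<dots> \<le> (\<integral>\<^sup>+p. ennreal (?c * dy (snd p) \<gamma>) * indicator (ball (fst p) (5 * rad (snd p))) x \<partial>count_space C)"
    proof (rule nn_integral_mono)
      fix p :: "'a \<times> int"
      have "(\<Sum>z m. ennreal (dy m \<gamma>) * indicator {..snd p + 3} m * indicator (ball (fst p) (5 * rad (snd p))) x)
        = (\<Sum>z m. ennreal (dy m \<gamma>) * indicator {..snd p + 3} m) * indicator (ball (fst p) (5 * rad (snd p))) x"
        by (rule nn_integral_multc) simp
      also have "\<dots> \<le> ennreal (dy (snd p + 3) \<gamma> / ?q) * indicator (ball (fst p) (5 * rad (snd p))) x"
        by (intro mult_right_mono zsum_scales_atMost \<gamma>) simp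
      also have "dy (snd p + 3) \<gamma> / ?q = ?c * dy (snd p) \<gamma>"
        by (simp add: distrib_right powr_add)
      finally show "(\<Sum>z m. ennreal (dy m \<gamma>) * indicator {..snd p + 3} m * indicator (ball (fst p) (5 * rad (snd p))) x)
        \<le> ennreal (?c * dy (snd p) \<gamma>) * indicator (ball (fst p) (5 * rad (snd p))) x" .
    qed
    finally show ?thesis .
  qed
  have "(\<Sum>z m. ennreal (dy m \<gamma>) * vol (S m))
    = (\<Sum>z m. \<integral>\<^sup>+x. ennreal (dy m \<gamma>) * indicator (S m) x \<partial>lborel)"
    by (intro nn_integral_cong) (simp add: nn_integral_cmult)
  also have "\<dots> = (\<integral>\<^sup>+x. (\<Sum>z m. ennreal (dy m \<gamma>) * indicator (S m) x) \<partial>lborel)"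
    by (rule zsum_nn_integral[symmetric]) measurable
  also have "\<dots> \<le> (\<integral>\<^sup>+x. (\<integral>\<^sup>+p. ennreal (?c * dy (snd p) \<gamma>) * indicator (ball (fst p) (5 * rad (snd p))) x \<partial>count_space C) \<partial>lborel)"
    by (rule nn_integral_mono) (rule pt)
  also have "\<dots> = (\<integral>\<^sup>+p. (\<integral>\<^sup>+x. ennreal (?c * dy (snd p) \<gamma>) * indicator (ball (fst p) (5 * rad (snd p))) x \<partial>lborel) \<partial>count_space C)"
    by (rule nn_integral_count_space_nn_integral) (use C in auto)
  also have "\<dots> = (\<integral>\<^sup>+p. ennreal (scale_const TYPE('a) \<gamma> / \<Lambda>) * (ennreal \<Lambda> * ennreal (dy (snd p) (?n + \<gamma>))) \<partial>count_space C)"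
  proof (rule nn_integral_cong)
    fix p :: "'a \<times> int"
    have "(\<integral>\<^sup>+x. ennreal (?c * dy (snd p) \<gamma>) * indicator (ball (fst p) (5 * rad (snd p))) x \<partial>lborel)
      = ennreal (?c * dy (snd p) \<gamma>) * ennreal (ubv TYPE('a) * 5 ^ DIM('a) * dy (snd p) ?n)"
      by (simp add: nn_integral_cmult emeasure_ball_5_rad)
    also have "\<dots> = ennreal ((?c * dy (snd p) \<gamma>) * (ubv TYPE('a) * 5 ^ DIM('a) * dy (snd p) ?n))"
      by (rule ennreal_mult''[symmetric]) (simp add: less_imp_le)
    also have "(?c * dy (snd p) \<gamma>) * (ubv TYPE('a) * 5 ^ DIM('a) * dy (snd p) ?n)
       = scale_const TYPE('a) \<gamma> / \<Lambda> * (\<Lambda> * dy (snd p) (?n + \<gamma>))"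
      using \<Lambda> unfolding scale_const_def dy_add by simp
    also have "ennreal \<dots> = ennreal (scale_const TYPE('a) \<gamma> / \<Lambda>) * (ennreal \<Lambda> * ennreal (dy (snd p) (?n + \<gamma>)))"
      using \<Lambda> by (simp add: ennreal_mult''[symmetric])
    finally show "(\<integral>\<^sup>+x. ennreal (?c * dy (snd p) \<gamma>) * indicator (ball (fst p) (5 * rad (snd p))) x \<partial>lborel) = \<dots>" .
  qed
  also have "\<dots> = ennreal (scale_const TYPE('a) \<gamma> / \<Lambda>) * (ennreal \<Lambda> * (\<integral>\<^sup>+p. ennreal (dy (snd p) (?n + \<gamma>)) \<partial>count_space C))"
    by (subst nn_integral_cmult, simp, subst nn_integral_cmult) auto
  also have "\<dots> \<le> ennreal (scale_const TYPE('a) \<gamma> / \<Lambda>) * (\<integral>\<^sup>+y. g y \<partial>lborel)"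
    by (intro mult_left_mono C) auto
  finally show ?thesis by (simp add: S_def)
qed

subsection \<open>The maximal function\<close>

text \<open>The centred Hardy-Littlewood maximal function over dyadic radii only: a countable
  supremum, hence Borel, and only dyadic radii occur in the argument.\<close>

definition maxfun :: "('a::euclidean_space \<Rightarrow> ennreal) \<Rightarrow> 'a \<Rightarrow> ennreal" where
  "maxfun g x = (SUP k. ennreal (1 / (ubv TYPE('a) * dy k (real DIM('a)))) * (ball_int g x (rad k)))"

lemma borel_measurable_maxfun [measurable]:
  assumes [measurable]: "g \<in> borel_measurable borel"
  shows "maxfun g \<in> borel_measurable borel"
  unfolding maxfun_def by measurable

lemma ball_nn_integral_le_maxfun:
  fixes g :: "'a::euclidean_space \<Rightarrow> ennreal"
  shows "(ball_int g x (rad k)) \<le> ennreal (ubv TYPE('a) * dy k (real DIM('a))) * maxfun g x"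
proof -
  let ?a = "ubv TYPE('a) * dy k (real DIM('a))"
  have a: "?a > 0" by simp
  then have "ennreal ?a * ennreal (1 / ?a) = 1"
    by (subst ennreal_mult[symmetric]) auto
  then have "(ball_int g x (rad k)) = ennreal ?a * (ennreal (1 / ?a) * (ball_int g x (rad k)))"
    by (simp add: mult.assoc[symmetric])
  also have "\<dots> \<le> ennreal ?a * maxfun g x"
    unfolding maxfun_def by (intro mult_left_mono SUP_upper) auto
  finally show ?thesis .
qed

lemma maxfun_less_iff:
  fixes g :: "'a::euclidean_space \<Rightarrow> ennreal"
  assumes "c \<ge> 0"
  shows "ennreal c < maxfun g x \<longleftrightarrow> (\<exists>k. ennreal (c * ubv TYPE('a) * dy k (real DIM('a))) < (ball_int g x (rad k)))"
proof -
  have "ennreal c < ennreal (1 / a) * X \<longleftrightarrow> ennreal (c * a) < X" if "a > 0" for a X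
    using that assms
    by (cases X rule: ennreal_cases)
       (auto simp: ennreal_mult[symmetric] ennreal_mult_top field_simps ennreal_less_iff)
  from this[of "ubv TYPE('a) * dy _ (real DIM('a))"] show ?thesis
    by (simp add: maxfun_def less_SUP_iff mult.assoc)
qed

text \<open>The weak type (1,1) inequality: with exponent n the threshold for the mass is c times
  the volume of the ball, so the enlarged selected balls have total volume at most 5^n/c times the
  mass.\<close>

lemma maxfun_weak:
  fixes g :: "'a::euclidean_space \<Rightarrow> ennreal"
  assumes g [measurable]: "g \<in> borel_measurable borel" and c: "c > 0"
  shows "vol {x. ennreal c < maxfun g x} \<le> ennreal (5 ^ DIM('a) / c) * (\<integral>\<^sup>+y. g y \<partial>lborel)"
proof (cases "(\<integral>\<^sup>+y. g y \<partial>lborel) < top")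
  case False
  then have "(\<integral>\<^sup>+y. g y \<partial>lborel) = top" using top.not_eq_extremum by blast
  then show ?thesis using c by (simp add: ennreal_mult_top)
next
  case True
  let ?n = "real DIM('a)" and ?w = "ubv TYPE('a)"
  have cw: "c * ?w > 0" "?n > 0" using c by auto
  obtain C :: "('a \<times> int) set" where C: "countable C"
    "\<And>x k. (ball_int g x (rad k)) > ennreal (c * ?w * dy k ?n)
       \<Longrightarrow> \<exists>z l. (z, l) \<in> C \<and> x \<in> ball z (5 * rad l) \<and> k \<le> l + 3"
    "ennreal (c * ?w) * (\<integral>\<^sup>+p. ennreal (dy (snd p) ?n) \<partial>count_space C) \<le> (\<integral>\<^sup>+y. g y \<partial>lborel)"
    by (rule ball_family_cover[OF g True cw]) (rule that; assumption)
  have "vol {x. ennreal c < maxfun g x} = (\<integral>\<^sup>+x. indicator {x. ennreal c < maxfun g x} x \<partial>lborel)"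
    by simp
  also have "\<dots> \<le> (\<integral>\<^sup>+x. (\<integral>\<^sup>+p. indicator (ball (fst p) (5 * rad (snd p))) x \<partial>count_space C) \<partial>lborel)"
  proof (rule nn_integral_mono)
    fix x
    show "indicator {x. ennreal c < maxfun g x} x \<le> (\<integral>\<^sup>+p. indicator (ball (fst p) (5 * rad (snd p))) x \<partial>count_space C)"
    proof (cases "ennreal c < maxfun g x")
      case True
      then obtain k where "(ball_int g x (rad k)) > ennreal (c * ?w * dy k ?n)"
        using c by (auto simp: maxfun_less_iff)
      from C(2)[OF this] obtain z l where zl: "(z, l) \<in> C" "x \<in> ball z (5 * rad l)"
        by blast
      have "indicator (ball (fst (z, l)) (5 * rad (snd (z, l)))) x \<le> (\<integral>\<^sup>+p. indicator (ball (fst p) (5 * rad (snd p))) x \<partial>count_space C)"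
        by (rule nn_integral_ge_point[OF zl(1)])
      then show ?thesis using zl True by simp
    qed simp
  qed
  also have "\<dots> = (\<integral>\<^sup>+p. (\<integral>\<^sup>+x. indicator (ball (fst p) (5 * rad (snd p))) x \<partial>lborel) \<partial>count_space C)"
    by (rule nn_integral_count_space_nn_integral) (use C in auto)
  also have "\<dots> = (\<integral>\<^sup>+p. ennreal (5 ^ DIM('a) / c) * (ennreal (c * ?w) * ennreal (dy (snd p) ?n)) \<partial>count_space C)"
    using c by (intro nn_integral_cong) (simp add: emeasure_ball_5_rad ennreal_mult''[symmetric])
  also have "\<dots> = ennreal (5 ^ DIM('a) / c) * (ennreal (c * ?w) * (\<integral>\<^sup>+p. ennreal (dy (snd p) ?n) \<partial>count_space C))"
    by (subst nn_integral_cmult, simp, subst nn_integral_cmult) auto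
  also have "\<dots> \<le> ennreal (5 ^ DIM('a) / c) * (\<integral>\<^sup>+y. g y \<partial>lborel)"
    by (intro mult_left_mono C) auto
  finally show ?thesis .
qed

text \<open>Averages of a constant are that constant. Used to discard the part of g that is at most
  half of the level under consideration.\<close>

lemma maxfun_le_add:
  fixes g :: "'a::euclidean_space \<Rightarrow> ennreal"
  assumes [measurable]: "u \<in> borel_measurable borel" and "\<And>y. g y \<le> u y + ennreal c" "c \<ge> 0"
  shows "maxfun g x \<le> maxfun u x + ennreal c"
  unfolding maxfun_def[of g]
proof (rule SUP_least)
  fix k
  let ?a = "ubv TYPE('a) * dy k (real DIM('a))"
  have "ennreal (1 / ?a) * (ball_int g x (rad k))
      \<le> ennreal (1 / ?a) * (\<integral>\<^sup>+y. u y * indicator (ball x (rad k)) y + ennreal c * indicator (ball x (rad k)) y \<partial>lborel)"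
    using assms by (intro mult_left_mono nn_integral_mono) (auto simp: indicator_def)
  also have "\<dots> = ennreal (1 / ?a) * ((ball_int u x (rad k)) + ennreal c * ennreal ?a)"
    by (simp add: nn_integral_add nn_integral_cmult emeasure_ball_rad)
  also have "\<dots> = ennreal (1 / ?a) * (ball_int u x (rad k)) + ennreal c"
  proof -
    have "ennreal (1 / ?a) * (ennreal c * ennreal ?a) = ennreal c"
      using \<open>c \<ge> 0\<close> by (simp add: ennreal_mult[symmetric])
    then show ?thesis by (simp add: distrib_left)
  qed
  also have "\<dots> \<le> maxfun u x + ennreal c"
    unfolding maxfun_def by (intro add_mono SUP_upper) auto
  finally show "ennreal (1 / ?a) * (ball_int g x (rad k)) \<le> maxfun u x + ennreal c" .
qed

text \<open>A dyadic layer cake decomposition: for finite positive X the largest k with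
  \<open>rad k\<close> < X already gives a sufficient term, because X is at most
  \<open>rad (k + 1)\<close>; for infinite X the terms are unbounded.\<close>

lemma epow_le_zsum:
  assumes "r > 0"
  shows "epow X r \<le> (\<Sum>z k. ennreal (dy (k + 1) r) * indicator {k. ennreal (rad k) < X} k)" (is "_ \<le> zsum ?a")
proof (cases X rule: ennreal_cases)
  case (real x)
  show ?thesis
  proof (cases "x = 0")
    case True
    with real show ?thesis by simp
  next
    case False
    with real have x: "x > 0" by simp
    obtain j where j: "rad j \<le> x" "x < rad (j + 1)"
      using scale_exists[OF x] by (auto simp del: of_int_add)
    \<comment> \<open>The strict inequality fails when x is itself a power of 2; then the scale
      below is taken.\<close>
    define k where "k = (if rad j = x then j - 1 else j)"
    have k: "rad k < x" "x \<le> rad (k + 1)"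
    proof -
      have "rad (j - 1) < rad j" by simp
      then show "rad k < x" "x \<le> rad (k + 1)" using j by (auto simp: k_def simp del: of_int_add of_int_diff)
    qed
    have "x powr r \<le> rad (k + 1) powr r"
      using k x assms by (intro powr_mono2) auto
    also have "\<dots> = dy (k + 1) r" by (simp add: powr_powr)
    finally have "epow X r \<le> ?a k"
      using real k by (simp add: ennreal_less_iff ennreal_leI)
    also have "\<dots> \<le> zsum ?a" by (rule zsum_mem_le)
    finally show ?thesis .
  qed
next
  case top
  have "zsum ?a = top"
  proof (cases "zsum ?a" rule: ennreal_cases)
    case (real B)
    obtain m :: int where m: "rad m > (B + 1) powr (1 / r)"
      using scale_exists[of "(B + 1) powr (1 / r)"] real by (metis add_nonneg_pos less_numeral_extra(1) less_irrefl mult.right_neutral powr_gt_zero)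
    have "B + 1 = ((B + 1) powr (1 / r)) powr r"
      using assms real by (simp add: powr_powr)
    also have "\<dots> \<le> rad m powr r"
      using m assms by (intro powr_mono2) auto
    also have "\<dots> \<le> dy (m + 1) r"
      using assms by (simp add: powr_powr)
    finally have "ennreal (B + 1) \<le> ?a m" using top by (simp add: ennreal_leI)
    also have "\<dots> \<le> zsum ?a" by (rule zsum_mem_le)
    finally show ?thesis using real by (simp add: ennreal_le_iff)
  qed simp
  then show ?thesis by simp
qed

text \<open>The factor 5^n is from the weak type bound, 4^r from trading \<open>dy (k + 1) r\<close>
  over \<open>rad (k - 1)\<close> for \<open>dy (k - 1) (r - 1)\<close>, and \<open>geo\<close> from
  the sum over levels.\<close>

definition max_const :: "'a::euclidean_space itself \<Rightarrow> real \<Rightarrow> real" where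
  "max_const _ r = 5 ^ DIM('a) * 4 powr r * geo (r - 1)"

lemma max_const_pos: "r > 1 \<Longrightarrow> max_const TYPE('a::euclidean_space) r > 0"
  by (simp add: max_const_def geo_pos)

text \<open>Marcinkiewicz interpolation done by hand. At level 2^k the part of g up to 2^(k - 1)
  contributes at most half the level, so the weak type bound is applied to the rest. For each x the
  levels below g x then sum to a multiple of g x times its power r - 1; this series converges
  because r > 1.\<close>

lemma maxfun_strong:
  fixes g :: "'a::euclidean_space \<Rightarrow> ennreal"
  assumes g [measurable]: "g \<in> borel_measurable borel" and r: "r > 1"
  shows "(\<integral>\<^sup>+x. epow (maxfun g x) r \<partial>lborel) \<le> ennreal (max_const TYPE('a) r) * (\<integral>\<^sup>+x. epow (g x) r \<partial>lborel)"
proof -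
  let ?n = "DIM('a)"
  let ?I = "\<lambda>k. indicator {x. ennreal (rad (k - 1)) < g x} :: 'a \<Rightarrow> ennreal"
  let ?h = "\<lambda>k x. g x * ?I k x"
  have level: "vol {x. ennreal (rad k) < maxfun g x}
      \<le> ennreal (5 ^ ?n / rad (k - 1)) * (\<integral>\<^sup>+x. ?h k x \<partial>lborel)" for k
  proof -
    have "vol {x. ennreal (rad k) < maxfun g x}
      \<le> vol {x. ennreal (rad (k - 1)) < maxfun (?h k) x}"
    proof (rule emeasure_mono)
      show "{x. ennreal (rad k) < maxfun g x} \<subseteq> {x. ennreal (rad (k - 1)) < maxfun (?h k) x}"
      proof safe
        fix x assume "ennreal (rad k) < maxfun g x"
        also have "maxfun g x \<le> maxfun (?h k) x + ennreal (rad (k - 1))"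
          by (rule maxfun_le_add) (measurable, auto simp: indicator_def not_less)
        also have "ennreal (rad k) = ennreal (rad (k - 1)) + ennreal (rad (k - 1))"
          using rad_Suc[of "k - 1"] by (simp add: ennreal_plus[symmetric] del: ennreal_plus)
        finally show "ennreal (rad (k - 1)) < maxfun (?h k) x"
          by (metis add_right_mono leD leI)
      qed
    qed measurable
    also have "\<dots> \<le> ennreal (5 ^ ?n / rad (k - 1)) * (\<integral>\<^sup>+x. ?h k x \<partial>lborel)"
      by (rule maxfun_weak) auto
    finally show ?thesis .
  qed
  let ?J = "\<lambda>x k. ennreal (dy k (r - 1)) * indicator {k. ennreal (dy k (r - 1)) \<le> epow (g x) (r - 1)} k"
  let ?c = "5 ^ ?n * 4 powr r"
  have "(\<integral>\<^sup>+x. epow (maxfun g x) r \<partial>lborel)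
     \<le> (\<integral>\<^sup>+x. (\<Sum>z k. ennreal (dy (k + 1) r) * indicator {x. ennreal (rad k) < maxfun g x} x) \<partial>lborel)"
    using epow_le_zsum[of r "maxfun g _"] r by (intro nn_integral_mono) (simp add: indicator_def)
  also have "\<dots> = (\<Sum>z k. \<integral>\<^sup>+x. ennreal (dy (k + 1) r) * indicator {x. ennreal (rad k) < maxfun g x} x \<partial>lborel)"
    by (rule zsum_nn_integral) measurable
  also have "\<dots> = (\<Sum>z k. ennreal (dy (k + 1) r) * vol {x. ennreal (rad k) < maxfun g x})"
    by (intro nn_integral_cong) (simp add: nn_integral_cmult)
  also have "\<dots> \<le> (\<Sum>z k. ennreal (dy (k + 1) r) * (ennreal (5 ^ ?n / rad (k - 1)) * (\<integral>\<^sup>+x. ?h k x \<partial>lborel)))"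
    by (intro nn_integral_mono mult_left_mono level) auto
  also have "\<dots> = (\<Sum>z k. \<integral>\<^sup>+x. ennreal ?c * (g x * (ennreal (dy (k - 1) (r - 1)) * ?I k x)) \<partial>lborel)"
  proof (rule nn_integral_cong)
    fix k
    have e: "dy (k + 1) r * (5 ^ ?n / rad (k - 1)) = ?c * dy (k - 1) (r - 1)"
    proof -
      have "(4::real) powr r = 2 powr (2 * r)" by (simp add: powr_powr[symmetric])
      moreover have "dy (k + 1) r / rad (k - 1) = 2 powr (2 * r) * dy (k - 1) (r - 1)"
        by (simp add: powr_diff[symmetric] powr_add[symmetric] algebra_simps)
      ultimately have "dy (k + 1) r / rad (k - 1) = 4 powr r * dy (k - 1) (r - 1)"
        by (simp only:)
      then show ?thesis by (simp only: times_divide_eq_right mult.commute[of _ "5 ^ ?n"] mult.assoc times_divide_eq_right[symmetric])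
    qed
    have "ennreal (dy (k + 1) r) * (ennreal (5 ^ ?n / rad (k - 1)) * (\<integral>\<^sup>+x. ?h k x \<partial>lborel))
      = ennreal (?c * dy (k - 1) (r - 1)) * (\<integral>\<^sup>+x. ?h k x \<partial>lborel)"
    proof -
      have "ennreal (dy (k + 1) r) * ennreal (5 ^ ?n / rad (k - 1)) = ennreal (dy (k + 1) r * (5 ^ ?n / rad (k - 1)))"
        by (rule ennreal_mult[symmetric]) auto
      then show ?thesis by (simp only: e mult.assoc[symmetric])
    qed
    also have "\<dots> = (\<integral>\<^sup>+x. ennreal ?c * (g x * (ennreal (dy (k - 1) (r - 1)) * ?I k x)) \<partial>lborel)"
      by (subst nn_integral_cmult[symmetric]) (auto intro!: nn_integral_cong simp: ennreal_mult mult_ac)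
    finally show "ennreal (dy (k + 1) r) * (ennreal (5 ^ ?n / rad (k - 1)) * (\<integral>\<^sup>+x. ?h k x \<partial>lborel)) = \<dots>" .
  qed
  also have "\<dots> = (\<integral>\<^sup>+x. (\<Sum>z k. ennreal ?c * (g x * (ennreal (dy (k - 1) (r - 1)) * ?I k x))) \<partial>lborel)"
    by (rule zsum_nn_integral[symmetric]) measurable
  also have "\<dots> = (\<integral>\<^sup>+x. ennreal ?c * (g x * (\<Sum>z k. ennreal (dy (k - 1) (r - 1)) * ?I k x)) \<partial>lborel)"
    by (simp add: nn_integral_cmult)
  also have "\<dots> \<le> (\<integral>\<^sup>+x. ennreal ?c * (g x * (\<Sum>z k. ?J x k)) \<partial>lborel)"
  proof (rule nn_integral_mono, rule mult_left_mono, rule mult_left_mono)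
    fix x
    have "(\<Sum>z k. ennreal (dy (k - 1) (r - 1)) * ?I k x) \<le> (\<Sum>z k. ?J x (k - 1))"
    proof (rule nn_integral_mono)
      fix k
      show "ennreal (dy (k - 1) (r - 1)) * ?I k x \<le> ?J x (k - 1)"
      proof (cases "ennreal (rad (k - 1)) < g x")
        case True
        then have "epow (ennreal (rad (k - 1))) (r - 1) \<le> epow (g x) (r - 1)"
          using r by (intro epow_mono) auto
        then have "ennreal (dy (k - 1) (r - 1)) \<le> epow (g x) (r - 1)"
          by (simp add: powr_powr)
        then show ?thesis by (simp add: indicator_def)
      qed simp
    qed
    also have "\<dots> = (\<Sum>z k. ?J x k)" by (rule zsum_shift)
    finally show "(\<Sum>z k. ennreal (dy (k - 1) (r - 1)) * ?I k x) \<le> (\<Sum>z k. ?J x k)" .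
  qed auto
  also have "\<dots> \<le> (\<integral>\<^sup>+x. ennreal ?c * (g x * (ennreal (geo (r - 1)) * epow (g x) (r - 1))) \<partial>lborel)"
    using r by (intro nn_integral_mono mult_left_mono zsum_geometric) auto
  also have "\<dots> = (\<integral>\<^sup>+x. ennreal (max_const TYPE('a) r) * epow (g x) r \<partial>lborel)"
  proof (rule nn_integral_cong)
    fix x
    have "g x * epow (g x) (r - 1) = epow (g x) r"
      using epow_add[of "g x" 1 "r - 1"] by simp
    then have e: "epow (g x) r = g x * epow (g x) (r - 1)" ..
    show "ennreal ?c * (g x * (ennreal (geo (r - 1)) * epow (g x) (r - 1))) = ennreal (max_const TYPE('a) r) * epow (g x) r"
      unfolding e max_const_def using geo_pos[of "r - 1"] r
      by (subst ennreal_mult) (auto simp: mult_ac)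
  qed
  also have "\<dots> = ennreal (max_const TYPE('a) r) * (\<integral>\<^sup>+x. epow (g x) r \<partial>lborel)"
    by (rule nn_integral_cmult) measurable
  finally show ?thesis .
qed

text \<open>A form of Young's inequality; it replaces Jensen's inequality for averages of \<open>u\<close>.\<close>

lemma le_add_epow:
  assumes t: "t > 0" and r: "r > 1"
  shows "u \<le> ennreal t + ennreal (t powr (1 - r)) * epow u r"
proof (cases u rule: ennreal_cases)
  case (real v)
  have "v \<le> t + t powr (1 - r) * v powr r"
  proof (cases "v \<le> t")
    case True
    then show ?thesis by (simp add: add_increasing2)
  next
    case False
    with t have v: "v > 0" by simp
    have "v = v powr (1 - r) * v powr r" using v by (simp add: powr_add[symmetric])
    also have "\<dots> \<le> t powr (1 - r) * v powr r"
      using False t r by (intro mult_right_mono powr_mono2') auto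
    finally show ?thesis using t by simp
  qed
  with real t show ?thesis
    by (simp add: ennreal_mult''[symmetric] ennreal_plus[symmetric] ennreal_leI del: ennreal_plus)
next
  case top
  with t show ?thesis by (simp add: ennreal_mult_top)
qed

text \<open>The Morrey bound makes the averages of the r-th power decay with the radius like the
  power - n \<theta>. Hence one bound, fixed by \<rho>, holds for all radii from \<rho> on.\<close>

lemma avg_le_of_mb:
  fixes g :: "'a::euclidean_space \<Rightarrow> ennreal"
  assumes g [measurable]: "g \<in> borel_measurable borel" and r: "r > 1" and \<theta>: "\<theta> > 0" and K: "K > 0"
    and mb: "mb r \<theta> K g" and \<rho>: "\<rho> > 0" "\<rho> \<le> rad k"
  shows "ennreal (1 / (ubv TYPE('a) * dy k (real DIM('a)))) * (ball_int g x (rad k))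
    \<le> ennreal (2 * (K / ubv TYPE('a) * \<rho> powr (- (real DIM('a) * \<theta>))) powr (1 / r))"
proof -
  let ?n = "real DIM('a)" and ?w = "ubv TYPE('a)"
  define D where "D = K / ?w * \<rho> powr (- (?n * \<theta>))"
  \<comment> \<open>D bounds the averages of the r-th power; this t balances the two terms of
    \<open>le_add_epow\<close>, since t powr (1 - r) * D = t.\<close>
  define t where "t = D powr (1 / r)"
  have D: "D > 0" using K \<rho> by (simp add: D_def)
  have t: "t > 0" using D by (simp add: t_def)
  have tD: "t powr (1 - r) * D = t"
  proof -
    have "D = t powr r" using D r by (simp add: t_def powr_powr)
    then show ?thesis using t by (simp add: powr_add[symmetric])
  qed
  let ?a = "?w * dy k ?n"
  have a: "?a > 0" by simp
  have "(ball_int g x (rad k))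
    \<le> (\<integral>\<^sup>+y. ennreal t * indicator (ball x (rad k)) y + ennreal (t powr (1 - r)) * (epow (g y) r * indicator (ball x (rad k)) y) \<partial>lborel)"
    using le_add_epow[OF t r] by (intro nn_integral_mono) (auto simp: indicator_def)
  also have "\<dots> = ennreal t * ennreal ?a + ennreal (t powr (1 - r)) * (ball_int (\<lambda>y. epow (g y) r) x (rad k))"
    by (simp add: nn_integral_add nn_integral_cmult emeasure_ball_rad)
  also have "\<dots> \<le> ennreal t * ennreal ?a + ennreal (t powr (1 - r)) * ennreal (K * rad k powr (?n * (1 - \<theta>)))"
    by (intro add_left_mono mult_left_mono mbD[OF mb]) auto
  also have "\<dots> = ennreal (t * ?a + t powr (1 - r) * (K * rad k powr (?n * (1 - \<theta>))))"
    using t K by (simp add: ennreal_mult'[symmetric] ennreal_plus[symmetric] del: ennreal_plus)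
  also have "\<dots> \<le> ennreal (t * ?a + t powr (1 - r) * (D * ?a))"
  proof (intro ennreal_leI add_left_mono mult_left_mono)
    have "rad k powr (?n * (1 - \<theta>)) = dy k ?n * rad k powr (- (?n * \<theta>))"
      by (simp add: powr_powr powr_add[symmetric] algebra_simps)
    also have "rad k powr (- (?n * \<theta>)) \<le> \<rho> powr (- (?n * \<theta>))"
      using \<rho> \<theta> by (intro powr_mono2') auto
    finally have "K * rad k powr (?n * (1 - \<theta>)) \<le> K * (dy k ?n * \<rho> powr (- (?n * \<theta>)))"
      using K by (simp add: mult_left_mono)
    then show "K * rad k powr (?n * (1 - \<theta>)) \<le> D * ?a"
      by (simp add: D_def mult_ac)
  qed auto
  also have "t * ?a + t powr (1 - r) * (D * ?a) = 2 * t * ?a"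
    using tD by (simp add: mult.assoc[symmetric])
  finally have "ennreal (1 / ?a) * (ball_int g x (rad k)) \<le> ennreal (1 / ?a) * ennreal (2 * t * ?a)"
    by (intro mult_left_mono) auto
  also have "\<dots> = ennreal (2 * t)"
    using a t by (subst ennreal_mult[symmetric]) auto
  finally show ?thesis by (simp add: t_def D_def)
qed

text \<open>The outer power of 2 comes from splitting the r-th power of a sum. Inside stand the
  strong type bound on the doubled ball and the contribution of the large radii.\<close>

definition max_mb_const :: "'a::euclidean_space itself \<Rightarrow> real \<Rightarrow> real \<Rightarrow> real" where
  "max_mb_const T r \<theta> = 2 powr r * (max_const T r * 2 powr (real DIM('a) * (1 - \<theta>)) + 2 powr r)"

lemma max_mb_const_pos: "r > 1 \<Longrightarrow> max_mb_const TYPE('a::euclidean_space) r \<theta> > 0"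
  using max_const_pos[of r, where 'a='a] by (simp add: max_mb_const_def add_pos_pos)

text \<open>For x in a ball of radius \<rho>, averages over radii up to \<rho> see only g on the
  doubled ball, where the strong type bound applies. Averages over larger radii are at most the
  constant \<tau> by \<open>avg_le_of_mb\<close>.\<close>

lemma mb_maxfun:
  fixes g :: "'a::euclidean_space \<Rightarrow> ennreal"
  assumes g [measurable]: "g \<in> borel_measurable borel" and r: "r > 1" and \<theta>: "\<theta> > 0" and K: "K > 0"
    and mb: "mb r \<theta> K g"
  shows "mb r \<theta> (max_mb_const TYPE('a) r \<theta> * K) (maxfun g)"
  unfolding mb_def
proof (intro allI impI)
  fix x0 :: 'a and \<rho> :: real assume \<rho>: "\<rho> > 0"
  let ?n = "real DIM('a)" and ?w = "ubv TYPE('a)" and ?B = "ball x0 \<rho>"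
  let ?h = "\<lambda>y. g y * indicator (ball x0 (2 * \<rho>)) y"
  define D where "D = K / ?w * \<rho> powr (- (?n * \<theta>))"
  define \<tau> where "\<tau> = 2 * D powr (1 / r)"
  have D: "D > 0" using K \<rho> by (simp add: D_def)
  have \<tau>: "\<tau> > 0" "\<tau> powr r = 2 powr r * D" using D r by (simp_all add: \<tau>_def powr_mult powr_powr)
  have pt: "maxfun g x \<le> maxfun ?h x + ennreal \<tau>" if x: "x \<in> ?B" for x
    unfolding maxfun_def[of g]
  proof (rule SUP_least)
    fix k
    let ?a = "?w * dy k ?n"
    show "ennreal (1 / ?a) * (ball_int g x (rad k)) \<le> maxfun ?h x + ennreal \<tau>"
    proof (cases "rad k \<le> \<rho>")
      case True
      have sub: "ball x (rad k) \<subseteq> ball x0 (2 * \<rho>)"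
          using x by (intro ball_subset_double[OF _ order_refl True]) auto
      have "(ball_int g x (rad k)) = (ball_int (\<lambda>y. ?h y) x (rad k))"
        using sub by (intro nn_integral_cong) (auto simp: indicator_def)
      then have "ennreal (1 / ?a) * (ball_int g x (rad k)) \<le> maxfun ?h x"
        unfolding maxfun_def by (intro SUP_upper2[of k]) auto
      then show ?thesis by (rule order_trans) simp
    next
      case False
      then have "ennreal (1 / ?a) * (ball_int g x (rad k)) \<le> ennreal \<tau>"
        unfolding \<tau>_def D_def using \<rho> by (intro avg_le_of_mb g r \<theta> K mb) auto
      then show ?thesis by (rule order_trans) simp
    qed
  qed
  have "(\<integral>\<^sup>+x\<in>?B. epow (maxfun g x) r \<partial>lborel)
    \<le> (\<integral>\<^sup>+x. ennreal (2 powr r) * (epow (maxfun ?h x) r + ennreal (2 powr r * D) * indicator ?B x) \<partial>lborel)"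
  proof (rule nn_integral_mono)
    fix x
    show "epow (maxfun g x) r * indicator ?B x
      \<le> ennreal (2 powr r) * (epow (maxfun ?h x) r + ennreal (2 powr r * D) * indicator ?B x)"
    proof (cases "x \<in> ?B")
      case True
      have "epow (maxfun g x) r \<le> epow (maxfun ?h x + ennreal \<tau>) r"
        using r by (intro epow_mono pt True) auto
      also have "\<dots> \<le> ennreal (2 powr r) * (epow (maxfun ?h x) r + epow (ennreal \<tau>) r)"
        using r by (intro epow_sum_le) auto
      finally show ?thesis using True \<tau> by simp
    qed simp
  qed
  also have "\<dots> = ennreal (2 powr r) * ((\<integral>\<^sup>+x. epow (maxfun ?h x) r \<partial>lborel) + ennreal (2 powr r * D) * vol ?B)"
    by (simp add: nn_integral_add nn_integral_cmult)
  also have "\<dots> \<le> ennreal (2 powr r) * (ennreal (max_const TYPE('a) r) * ennreal (K * (2 * \<rho>) powr (?n * (1 - \<theta>)))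
      + ennreal (2 powr r * D) * ennreal (?w * \<rho> powr ?n))"
  proof (intro mult_left_mono add_mono)
    have "(\<integral>\<^sup>+x. epow (maxfun ?h x) r \<partial>lborel) \<le> ennreal (max_const TYPE('a) r) * (\<integral>\<^sup>+x. epow (?h x) r \<partial>lborel)"
      by (rule maxfun_strong[OF _ r]) measurable
    also have "(\<integral>\<^sup>+x. epow (?h x) r \<partial>lborel) = (ball_int (\<lambda>x. epow (g x) r) x0 (2 * \<rho>))"
      by (intro nn_integral_cong) (auto simp: indicator_def)
    also have "\<dots> \<le> ennreal (K * (2 * \<rho>) powr (?n * (1 - \<theta>)))"
      using \<rho> by (intro mbD[OF mb]) auto
    finally show "(\<integral>\<^sup>+x. epow (maxfun ?h x) r \<partial>lborel) \<le> ennreal (max_const TYPE('a) r) * ennreal (K * (2 * \<rho>) powr (?n * (1 - \<theta>)))"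
      by (simp add: mult_left_mono)
    show "vol ?B \<le> ennreal (?w * \<rho> powr ?n)"
      using \<rho> by (simp add: emeasure_ball_powr)
  qed auto
  also have "\<dots> = ennreal (2 powr r * (max_const TYPE('a) r * (K * (2 * \<rho>) powr (?n * (1 - \<theta>))) + 2 powr r * D * (?w * \<rho> powr ?n)))"
    using max_const_pos[of r, where 'a='a] r K D
    by (simp add: ennreal_mult'[symmetric] ennreal_mult''[symmetric] ennreal_plus[symmetric] del: ennreal_plus)
  also have "2 powr r * (max_const TYPE('a) r * (K * (2 * \<rho>) powr (?n * (1 - \<theta>))) + 2 powr r * D * (?w * \<rho> powr ?n))
     = max_mb_const TYPE('a) r \<theta> * K * \<rho> powr (?n * (1 - \<theta>))"
  proof -
    have "\<rho> powr (- (?n * \<theta>)) * \<rho> powr ?n = \<rho> powr (?n * (1 - \<theta>))"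
      by (simp add: powr_add[symmetric] algebra_simps)
    then have "D * (?w * \<rho> powr ?n) = K * \<rho> powr (?n * (1 - \<theta>))"
      by (simp add: D_def)
    moreover have "(2 * \<rho>) powr (?n * (1 - \<theta>)) = 2 powr (?n * (1 - \<theta>)) * \<rho> powr (?n * (1 - \<theta>))"
      using \<rho> by (simp add: powr_mult)
    ultimately show ?thesis by (simp add: max_mb_const_def mult.assoc distrib_right distrib_left)
  qed
  finally show "(\<integral>\<^sup>+x\<in>?B. epow (maxfun g x) r \<partial>lborel)
    \<le> ennreal (max_mb_const TYPE('a) r \<theta> * K * \<rho> powr (?n * (1 - \<theta>)))" .
qed

subsection \<open>The discretized operator on superlevel sets, exponent greater than 1\<close>

lemma zsum_superlevel:
  assumes "\<gamma> \<noteq> 0"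
  shows "(\<Sum>z k. ennreal (dy k \<gamma>) * indicator {x. ennreal (dy k \<gamma>) < h x} x) \<le> ennreal (geo \<gamma>) * h x"
proof -
  have "(\<Sum>z k. ennreal (dy k \<gamma>) * indicator {x. ennreal (dy k \<gamma>) < h x} x)
     \<le> (\<Sum>z k. ennreal (dy k \<gamma>) * indicator {k. ennreal (dy k \<gamma>) \<le> h x} k)"
    by (intro nn_integral_mono) (auto simp: indicator_def)
  also have "\<dots> \<le> ennreal (geo \<gamma>) * h x"
    by (rule zsum_geometric[OF assms])
  finally show ?thesis .
qed

text \<open>The normalized volume of the superlevel set in a ball has two bounds: the trivial one,
  and Chebyshev with exponent b, which yields 2^(- k \<gamma> b) times the maximal function of the
  b-th power of h. Using the first where 2^(k \<gamma>) is at most H and the second elsewhere leaves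
  two geometric series; b > 1 makes the second one converge.\<close>

lemma Dop_superlevel_le:
  fixes h :: "'a::euclidean_space \<Rightarrow> ennreal"
  assumes h [measurable]: "h \<in> borel_measurable borel" and \<gamma>: "\<gamma> \<noteq> 0" and b: "b > 1"
  shows "Dop \<gamma> (\<lambda>k. {x. ennreal (dy k \<gamma>) < h x}) x
    \<le> ennreal (geo \<gamma>) * h x + ennreal (ubv TYPE('a) * (geo \<gamma> + geo (\<gamma> * (1 - b))))
        * epow (maxfun (\<lambda>y. epow (h y) b) x) (1 / b)"
proof -
  let ?n = "real DIM('a)" and ?w = "ubv TYPE('a)"
  let ?U = "\<lambda>k. {x. ennreal (dy k \<gamma>) < h x}"
  let ?M = "maxfun (\<lambda>y. epow (h y) b) x"
  let ?H = "epow ?M (1 / b)"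
  let ?V = "\<lambda>k. ennreal (dy k (- ?n)) * vol (ball x (rad k) \<inter> ?U k)"
  have g: "geo \<gamma> > 0" "geo (\<gamma> * (1 - b)) > 0" using \<gamma> b by (auto intro!: geo_pos)
  have V1: "?V k \<le> ennreal ?w" for k
  proof -
    have "?V k \<le> ennreal (dy k (- ?n)) * ennreal (?w * dy k ?n)"
      unfolding emeasure_ball_rad[where x=x, symmetric] by (intro mult_left_mono emeasure_mono) auto
    also have "\<dots> = ennreal ?w"
      by (subst ennreal_mult[symmetric]) (auto simp: powr_minus)
    finally show ?thesis .
  qed
  have V2: "?V k \<le> ennreal (?w * dy k (- \<gamma> * b)) * ?M" for k
  proof -
    have "ennreal (dy k (\<gamma> * b)) * vol (ball x (rad k) \<inter> ?U k)
        = (\<integral>\<^sup>+y. ennreal (dy k (\<gamma> * b)) * indicator (ball x (rad k) \<inter> ?U k) y \<partial>lborel)"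
      by (simp add: nn_integral_cmult)
    also have "\<dots> \<le> (ball_int (\<lambda>y. epow (h y) b) x (rad k))"
    proof (rule nn_integral_mono)
      fix y
      show "ennreal (dy k (\<gamma> * b)) * indicator (ball x (rad k) \<inter> ?U k) y \<le> epow (h y) b * indicator (ball x (rad k)) y"
      proof (cases "y \<in> ?U k")
        case True
        then have "epow (ennreal (dy k \<gamma>)) b \<le> epow (h y) b"
          using b by (intro epow_mono) auto
        then show ?thesis by (simp add: powr_powr indicator_def mult.assoc)
      qed (simp add: indicator_def)
    qed
    also have "\<dots> \<le> ennreal (?w * dy k ?n) * ?M"
      by (rule ball_nn_integral_le_maxfun)
    finally have "ennreal (dy k (- \<gamma> * b) * dy k (- ?n)) * (ennreal (dy k (\<gamma> * b)) * vol (ball x (rad k) \<inter> ?U k))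
      \<le> ennreal (dy k (- \<gamma> * b) * dy k (- ?n)) * (ennreal (?w * dy k ?n) * ?M)"
      by (intro mult_left_mono) auto
    also have "\<dots> = ennreal (dy k (- \<gamma> * b) * dy k (- ?n) * (?w * dy k ?n)) * ?M"
      by (subst ennreal_mult[of "dy k (- \<gamma> * b) * dy k (- ?n)" "?w * dy k ?n"]) (simp_all add: mult.assoc)
    also have "dy k (- \<gamma> * b) * dy k (- ?n) * (?w * dy k ?n) = ?w * dy k (- \<gamma> * b)"
      using dy_inverse[of k ?n] by (simp add: mult_ac)
    also have "ennreal (dy k (- \<gamma> * b) * dy k (- ?n)) * (ennreal (dy k (\<gamma> * b)) * vol (ball x (rad k) \<inter> ?U k)) = ?V k"
    proof -
      have "ennreal (dy k (- \<gamma> * b) * dy k (- ?n)) * ennreal (dy k (\<gamma> * b)) = ennreal (dy k (- ?n))"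
        using dy_inverse[of k "\<gamma> * b"] by (subst ennreal_mult[symmetric]) (auto simp: mult_ac)
      then show ?thesis by (simp only: mult.assoc[symmetric])
    qed
    finally show ?thesis .
  qed
  have main: "(\<Sum>z k. ennreal (dy k \<gamma>) * ?V k) \<le> ennreal (?w * (geo \<gamma> + geo (\<gamma> * (1 - b)))) * ?H"
  proof (cases ?H rule: ennreal_cases)
    case top
    with g show ?thesis by (simp add: ennreal_mult_top add_pos_pos)
  next
    case (real H)
    have MH: "?M = ennreal (H powr b)"
    proof -
      have "?M = epow ?H b" using b by (simp add: epow_epow)
      then show ?thesis using real by simp
    qed
    let ?near = "\<lambda>k. ennreal (dy k \<gamma>) * indicator {k. ennreal (dy k \<gamma>) \<le> ennreal H} k"
    \<comment> \<open>As 1 - b is negative, \<open>dy k \<gamma>\<close> above H means that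
      \<open>dy k (\<gamma> * (1 - b))\<close> is at most H powr (1 - b).\<close>
    let ?far = "\<lambda>k. ennreal (dy k (\<gamma> * (1 - b))) * indicator {k. ennreal (dy k (\<gamma> * (1 - b))) \<le> ennreal (H powr (1 - b))} k"
    have "(\<Sum>z k. ennreal (dy k \<gamma>) * ?V k) \<le> (\<Sum>z k. ennreal ?w * ?near k + ennreal (?w * H powr b) * ?far k)"
    proof (rule nn_integral_mono)
      fix k
      show "ennreal (dy k \<gamma>) * ?V k \<le> ennreal ?w * ?near k + ennreal (?w * H powr b) * ?far k"
      proof (cases "dy k \<gamma> \<le> H")
        case True
        have "ennreal (dy k \<gamma>) * ?V k \<le> ennreal (dy k \<gamma>) * ennreal ?w"
          by (intro mult_left_mono V1) auto
        also have "\<dots> = ennreal ?w * ?near k" using True by (simp add: mult.commute ennreal_leI)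
        finally show ?thesis by (rule order_trans) simp
      next
        case False
        have "ennreal (dy k \<gamma>) * ?V k \<le> ennreal (dy k \<gamma>) * (ennreal (?w * dy k (- \<gamma> * b)) * ?M)"
          by (intro mult_left_mono V2) auto
        also have "\<dots> = ennreal (dy k \<gamma> * (?w * dy k (- \<gamma> * b)) * H powr b)"
          unfolding MH by (simp add: ennreal_mult[symmetric] mult.assoc)
        also have "dy k \<gamma> * (?w * dy k (- \<gamma> * b)) * H powr b = (?w * H powr b) * dy k (\<gamma> * (1 - b))"
        proof -
          have "dy k (\<gamma> * (1 - b)) = dy k \<gamma> * dy k (- \<gamma> * b)"
            by (subst dy_add[symmetric]) (simp add: algebra_simps)
          then show ?thesis by (simp only: mult_ac)
        qed
        also have "ennreal \<dots> \<le> ennreal (?w * H powr b) * ?far k"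
        \<comment> \<open>If H = 0 the left side vanishes because \<open>0 powr b = 0\<close>; the
          antitone comparison of powers below needs H > 0.\<close>
        proof (cases "H = 0")
          case True
          then show ?thesis by simp
        next
          case H0: False
          have "dy k (\<gamma> * (1 - b)) = dy k \<gamma> powr (1 - b)"
            by (simp add: powr_powr mult.assoc)
          also have "\<dots> \<le> H powr (1 - b)"
            using False H0 real b by (intro powr_mono2') auto
          finally show ?thesis by (simp add: ennreal_mult ennreal_leI)
        qed
        finally show ?thesis by (rule order_trans) simp
      qed
    qed
    also have "\<dots> = ennreal ?w * (\<Sum>z k. ?near k) + ennreal (?w * H powr b) * (\<Sum>z k. ?far k)"
      by (simp add: nn_integral_add nn_integral_cmult)
    also have "\<dots> \<le> ennreal ?w * (ennreal (geo \<gamma>) * ennreal H)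
        + ennreal (?w * H powr b) * (ennreal (geo (\<gamma> * (1 - b))) * ennreal (H powr (1 - b)))"
      using \<gamma> b by (intro add_mono mult_left_mono zsum_geometric) auto
    also have "\<dots> = ennreal (?w * (geo \<gamma> * H) + (?w * H powr b) * (geo (\<gamma> * (1 - b)) * H powr (1 - b)))"
      using g real by (simp add: ennreal_mult[symmetric] ennreal_plus[symmetric] del: ennreal_plus)
    also have "?w * (geo \<gamma> * H) + (?w * H powr b) * (geo (\<gamma> * (1 - b)) * H powr (1 - b))
       = ?w * (geo \<gamma> + geo (\<gamma> * (1 - b))) * H"
    proof -
      have "H powr b * H powr (1 - b) = H"
        using real by (simp add: powr_add[symmetric])
      then have "(?w * H powr b) * (geo (\<gamma> * (1 - b)) * H powr (1 - b)) = ?w * geo (\<gamma> * (1 - b)) * H"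
        by (metis (no_types, lifting) mult.assoc mult.left_commute)
      then show ?thesis by (simp add: algebra_simps)
    qed
    also have "ennreal \<dots> = ennreal (?w * (geo \<gamma> + geo (\<gamma> * (1 - b)))) * ?H"
      using real g by (simp add: ennreal_mult[symmetric])
    finally show ?thesis .
  qed
  have "Dop \<gamma> ?U x = (\<Sum>z k. ennreal (dy k \<gamma>) * indicator (?U k) x + ennreal (dy k \<gamma>) * ?V k)"
    unfolding Dop_def by (simp only: distrib_left)
  also have "\<dots> = (\<Sum>z k. ennreal (dy k \<gamma>) * indicator (?U k) x) + (\<Sum>z k. ennreal (dy k \<gamma>) * ?V k)"
    by (rule nn_integral_add) auto
  also have "\<dots> \<le> ennreal (geo \<gamma>) * h x + ennreal (?w * (geo \<gamma> + geo (\<gamma> * (1 - b)))) * ?H"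
    by (intro add_mono zsum_superlevel[OF \<gamma>] main)
  finally show ?thesis .
qed

text \<open>The b-th power of h obeys the same Morrey bound with exponent r/b, so the maximal
  theorem applies if r/b > 1, while the pointwise bound asks for b > 1. Hence b is taken as the
  midpoint of 1 and r.\<close>

lemma mb_Dop_superlevel:
  assumes r: "r > 1" and \<gamma>: "\<gamma> \<noteq> 0" and \<theta>: "\<theta> > 0"
  obtains C where "C > 0" "\<And>K (h :: 'a::euclidean_space \<Rightarrow> ennreal). K > 0 \<Longrightarrow> h \<in> borel_measurable borel \<Longrightarrow> mb r \<theta> K h
    \<Longrightarrow> mb r \<theta> (C * K) (Dop \<gamma> (\<lambda>k. {x. ennreal (dy k \<gamma>) < h x}))"
proof
  define b where "b = (1 + r) / 2"
  have b: "b > 1" "r / b > 1" using r by (auto simp: b_def field_simps)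
  let ?w = "ubv TYPE('a)" and ?m = "max_mb_const TYPE('a) (r / b) \<theta>"
  let ?c2 = "?w * (geo \<gamma> + geo (\<gamma> * (1 - b)))"
  have g: "geo \<gamma> > 0" "geo (\<gamma> * (1 - b)) > 0" using \<gamma> b by (auto intro!: geo_pos)
  have m: "?m > 0" by (rule max_mb_const_pos[OF b(2)])
  have c2: "?c2 > 0" using g by (simp add: add_pos_pos)
  let ?C = "2 powr r * (geo \<gamma> powr r + ?c2 powr r * ?m)"
  show "?C > 0" using g m c2 by (simp add: add_pos_pos)
  fix K and h :: "'a \<Rightarrow> ennreal"
  assume K: "K > 0" and h [measurable]: "h \<in> borel_measurable borel" and mb: "mb r \<theta> K h"
  let ?M = "maxfun (\<lambda>y. epow (h y) b)"
  have "mb (r / b) \<theta> K (\<lambda>y. epow (h y) b)"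
    using mb b by (simp add: mb_def epow_epow)
  then have "mb (r / b) \<theta> (?m * K) ?M"
    using b \<theta> K by (intro mb_maxfun) auto
  then have M: "mb r \<theta> (?m * K) (\<lambda>x. epow (?M x) (1 / b))"
    using b by (simp add: mb_def epow_epow)
  have "mb r \<theta> (2 powr r * (geo \<gamma> powr r * K + ?c2 powr r * (?m * K)))
      (\<lambda>x. ennreal (geo \<gamma>) * h x + ennreal ?c2 * epow (?M x) (1 / b))"
    using g m c2 K r by (intro mb_add mb_cmult mb M) auto
  then show "mb r \<theta> (?C * K) (Dop \<gamma> (\<lambda>k. {x. ennreal (dy k \<gamma>) < h x}))"
    by (rule mb_mono) (use r \<gamma> b Dop_superlevel_le[OF h \<gamma> b(1)] in \<open>auto simp: algebra_simps\<close>)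
qed

subsection \<open>Dyadic intervals on the line\<close>

text \<open>Index of the half-open dyadic interval of length \<open>rad m\<close> that contains x.
  The line is an abstract one-dimensional type, so its coordinate is taken along the single basis
  vector e.\<close>

definition dyidx :: "'a::euclidean_space \<Rightarrow> int \<Rightarrow> 'a \<Rightarrow> int" where
  "dyidx e m x = \<lfloor>(x \<bullet> e) / rad m\<rfloor>"

lemma measurable_dyidx [measurable]: "dyidx e m \<in> borel \<rightarrow>\<^sub>M count_space UNIV"
  unfolding dyidx_def by measurable

lemma measurable_dyidx_set: "{x. dyidx e m x = j} \<in> sets lborel"
  by measurable

lemma dyidx_Suc: "dyidx e (m + 1) x = dyidx e m x div 2"
proof -
  have "(x \<bullet> e) / rad (m + 1) = ((x \<bullet> e) / rad m) / real_of_int 2"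
    by (simp add: powr_add)
  then show ?thesis unfolding dyidx_def
    by (metis floor_divide_real_eq_div zero_le_numeral)
qed

lemma dyidx_nested:
  assumes "i \<le> m" "dyidx e i x = dyidx e i y" shows "dyidx e m x = dyidx e m y"
  using assms(1) by (induction rule: int_ge_induct) (simp_all add: assms(2) dyidx_Suc)

lemma emeasure_dyadic_interval:
  fixes e :: "'a::euclidean_space"
  assumes e: "Basis = {e}"
  shows "vol {x. dyidx e m x = i} = ennreal (rad m)"
proof -
  let ?l = "(of_int i * rad m) *\<^sub>R e" and ?u = "((of_int i + 1) * rad m) *\<^sub>R e"
  have ee: "e \<bullet> e = 1" by (rule inner_same_Basis) (simp add: e)
  have lu: "?l \<bullet> b \<le> ?u \<bullet> b" if "b \<in> Basis" for b
  proof -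
    have "b = e" using that unfolding e by simp
    then show ?thesis using ee by (simp add: mult_right_mono)
  qed
  have iff: "dyidx e m x = i \<longleftrightarrow> of_int i * rad m \<le> x \<bullet> e \<and> x \<bullet> e < (of_int i + 1) * rad m" for x
    unfolding dyidx_def floor_eq_iff by (simp add: pos_le_divide_eq pos_divide_less_eq)
  have sub: "box ?l ?u \<subseteq> {x. dyidx e m x = i}" "{x. dyidx e m x = i} \<subseteq> cbox ?l ?u"
    unfolding subset_iff mem_box mem_Collect_eq iff e using ee by auto
  have "(\<Prod>b\<in>Basis. (?u - ?l) \<bullet> b) = rad m"
    unfolding e by (simp add: ee inner_diff_left algebra_simps)
  then have "vol (box ?l ?u) = ennreal (rad m)" "vol (cbox ?l ?u) = ennreal (rad m)"
    using emeasure_lborel_box[of ?l ?u, OF lu] emeasure_lborel_cbox[of ?l ?u, OF lu] by simp_all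
  with emeasure_mono[OF sub(1), of lborel] emeasure_mono[OF sub(2), of lborel] show ?thesis
    by (simp add: antisym)
qed

lemma dyadic_interval_split:
  assumes [measurable]: "u \<in> borel_measurable borel"
  shows "(\<integral>\<^sup>+x\<in>{x. dyidx e (m + 1) x = j}. u x \<partial>lborel)
    = (\<integral>\<^sup>+x\<in>{x. dyidx e m x = 2 * j}. u x \<partial>lborel) + (\<integral>\<^sup>+x\<in>{x. dyidx e m x = 2 * j + 1}. u x \<partial>lborel)"
proof -
  have "(i::int) div 2 = j \<longleftrightarrow> i = 2 * j \<or> i = 2 * j + 1" for i by presburger
  then have "(\<integral>\<^sup>+x\<in>{x. dyidx e (m + 1) x = j}. u x \<partial>lborel)
    = (\<integral>\<^sup>+x. u x * indicator {x. dyidx e m x = 2 * j} x + u x * indicator {x. dyidx e m x = 2 * j + 1} x \<partial>lborel)"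
    by (intro nn_integral_cong) (auto simp: dyidx_Suc indicator_def)
  then show ?thesis by (simp add: nn_integral_add)
qed

lemma nn_integral_dyadic_sum:
  assumes [measurable]: "u \<in> borel_measurable borel"
  shows "(\<integral>\<^sup>+x. u x \<partial>lborel) = (\<Sum>z j. \<integral>\<^sup>+x\<in>{x. dyidx e m x = j}. u x \<partial>lborel)"
proof -
  have "(\<Sum>z j. u x * indicator {x. dyidx e m x = j} x) = u x" for x
    by (subst nn_integral_count_space'[of "{dyidx e m x}"]) (auto simp: indicator_def)
  then have "(\<integral>\<^sup>+x. u x \<partial>lborel) = (\<integral>\<^sup>+x. (\<Sum>z j. u x * indicator {x. dyidx e m x = j} x) \<partial>lborel)"
    by simp
  also have "\<dots> = (\<Sum>z j. \<integral>\<^sup>+x\<in>{x. dyidx e m x = j}. u x \<partial>lborel)"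
    by (rule zsum_nn_integral) measurable
  finally show ?thesis .
qed

text \<open>The intervals of mass larger than \<open>\<Lambda>\<close> times the (negative) power \<open>1 + \<gamma>\<close> of their length form
  an upward closed family. The extra term on the left, which is present on intervals of this family,
  pays for their ancestors.\<close>

lemma dyadic_induction:
  fixes e :: "'a::euclidean_space" and g :: "'a \<Rightarrow> ennreal"
  assumes e: "Basis = {e}" and g [measurable]: "g \<in> borel_measurable borel"
    and \<Lambda>: "\<Lambda> > 0" and \<gamma>: "\<gamma> < -1"
  defines "mass \<equiv> \<lambda>m i. \<integral>\<^sup>+y\<in>{y. dyidx e m y = i}. g y \<partial>lborel"
  defines "S \<equiv> \<lambda>m. {x. mass m (dyidx e m x) > ennreal (\<Lambda> * dy m (1 + \<gamma>))}"
  defines "c \<equiv> 1 / (2 powr - (1 + \<gamma>) - 1)"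
  assumes "K \<le> m"
  shows "(\<integral>\<^sup>+x\<in>{x. dyidx e m x = j}. ((\<Sum>i\<in>{K..m}. ennreal (dy i \<gamma>) * indicator (S i) x)
      + ennreal (c * dy m \<gamma>) * indicator (S m) x) \<partial>lborel) \<le> ennreal ((1 + c) / \<Lambda>) * mass m j"
proof -
  have S [measurable]: "S m \<in> sets borel" for m
    unfolding S_def by measurable
  \<comment> \<open>This equation dictates c: the extra term on one heavy child then equals the term
    and the extra term of its parent, both integrated over their intervals. Since \<gamma> < -1, the
    factor 2 powr (1 + \<gamma>) is below 1 and a positive solution exists.\<close>
  have c: "c > 0" "(1 + c) * 2 powr (1 + \<gamma>) = c"
  proof -
    have "2 powr - (1 + \<gamma>) > (1::real)" using \<gamma> by simp
    then show "c > 0" by (simp add: c_def)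
    have "2 powr (1 + \<gamma>) * 2 powr - (1 + \<gamma>) = (1::real)" by (simp only: powr_add[symmetric]) simp
    moreover have "(1 + 1 / (X - 1)) * p = 1 / (X - 1)" if "p * X = 1" "X > 1" for p X :: real
    proof -
      have "p = 1 / X" using that by (simp add: field_simps)
      then show ?thesis using that by (simp add: field_simps)
    qed
    ultimately show "(1 + c) * 2 powr (1 + \<gamma>) = c"
      using \<open>2 powr - (1 + \<gamma>) > (1::real)\<close> unfolding c_def by blast
  qed
  let ?Q = "\<lambda>m j. {x. dyidx e m x = j}"
  have Q: "ennreal (a * dy m \<gamma>) * vol (?Q m j) = ennreal (a * dy m (1 + \<gamma>))" if "a \<ge> 0" for a m j
    using that unfolding emeasure_dyadic_interval[OF e] dy_add[of m 1 \<gamma>]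
    by (simp add: ennreal_mult[symmetric] mult_ac)
  have big: "ennreal (a * dy m (1 + \<gamma>)) \<le> ennreal (a / \<Lambda>) * mass m j"
    if "a \<ge> 0" "mass m j > ennreal (\<Lambda> * dy m (1 + \<gamma>))" for a m j
  proof -
    have "ennreal (a * dy m (1 + \<gamma>)) = ennreal (a / \<Lambda>) * ennreal (\<Lambda> * dy m (1 + \<gamma>))"
      using that \<Lambda> by (simp add: ennreal_mult[symmetric])
    also have "\<dots> \<le> ennreal (a / \<Lambda>) * mass m j"
      using that by (intro mult_left_mono) auto
    finally show ?thesis .
  qed
  from \<open>K \<le> m\<close> show ?thesis
  proof (induction arbitrary: j rule: int_ge_induct)
    case base
    show ?case
    proof (cases "mass K j > ennreal (\<Lambda> * dy K (1 + \<gamma>))")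
      case True
      have "(\<integral>\<^sup>+x\<in>?Q K j. ((\<Sum>i\<in>{K..K}. ennreal (dy i \<gamma>) * indicator (S i) x)
          + ennreal (c * dy K \<gamma>) * indicator (S K) x) \<partial>lborel)
        = (\<integral>\<^sup>+x. ennreal ((1 + c) * dy K \<gamma>) * indicator (?Q K j) x \<partial>lborel)"
        using True c by (intro nn_integral_cong)
          (auto simp: S_def indicator_def distrib_right)
      also have "\<dots> = ennreal ((1 + c) * dy K \<gamma>) * vol (?Q K j)"
        by (simp add: nn_integral_cmult)
      also have "\<dots> = ennreal ((1 + c) * dy K (1 + \<gamma>))"
        using c by (intro Q) auto
      also have "\<dots> \<le> ennreal ((1 + c) / \<Lambda>) * mass K j"
        using c by (intro big True) auto
      finally show ?thesis .
    next
      case False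
      then have "(\<integral>\<^sup>+x\<in>?Q K j. ((\<Sum>i\<in>{K..K}. ennreal (dy i \<gamma>) * indicator (S i) x)
          + ennreal (c * dy K \<gamma>) * indicator (S K) x) \<partial>lborel) = (\<integral>\<^sup>+x. 0 \<partial>(lborel :: 'a measure))"
        by (intro nn_integral_cong) (auto simp: S_def indicator_def)
      then show ?thesis by simp
    qed
  next
    case (step m)
    let ?I = "\<lambda>m x. \<Sum>i\<in>{K..m}. ennreal (dy i \<gamma>) * indicator (S i) x"
    have IH: "(\<integral>\<^sup>+x\<in>?Q (m + 1) j. (?I m x + ennreal (c * dy m \<gamma>) * indicator (S m) x) \<partial>lborel)
        \<le> ennreal ((1 + c) / \<Lambda>) * mass (m + 1) j"
    proof -
      have "(\<integral>\<^sup>+x\<in>?Q (m + 1) j. (?I m x + ennreal (c * dy m \<gamma>) * indicator (S m) x) \<partial>lborel)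
        = (\<integral>\<^sup>+x\<in>?Q m (2 * j). (?I m x + ennreal (c * dy m \<gamma>) * indicator (S m) x) \<partial>lborel)
        + (\<integral>\<^sup>+x\<in>?Q m (2 * j + 1). (?I m x + ennreal (c * dy m \<gamma>) * indicator (S m) x) \<partial>lborel)"
        by (rule dyadic_interval_split) measurable
      also have "\<dots> \<le> ennreal ((1 + c) / \<Lambda>) * mass m (2 * j) + ennreal ((1 + c) / \<Lambda>) * mass m (2 * j + 1)"
        by (rule add_mono[OF step.IH step.IH])
      also have "\<dots> = ennreal ((1 + c) / \<Lambda>) * mass (m + 1) j"
        unfolding mass_def dyadic_interval_split[OF g] by (rule distrib_left[symmetric])
      finally show ?thesis .
    qed
    have Suc: "?I (m + 1) x = ?I m x + ennreal (dy (m + 1) \<gamma>) * indicator (S (m + 1)) x" for x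
    proof -
      have "{K..m + 1} = insert (m + 1) {K..m}" using step.hyps by auto
      moreover have nin: "m + 1 \<notin> {K..m}" by simp
      ultimately show ?thesis
        by (simp only: sum.insert[OF finite_atLeastAtMost_int nin]) (rule add.commute)
    qed
    show ?case
    proof (cases "mass (m + 1) j > ennreal (\<Lambda> * dy (m + 1) (1 + \<gamma>))")
      case False
      have "(\<integral>\<^sup>+x\<in>?Q (m + 1) j. (?I (m + 1) x + ennreal (c * dy (m + 1) \<gamma>) * indicator (S (m + 1)) x) \<partial>lborel)
        \<le> (\<integral>\<^sup>+x\<in>?Q (m + 1) j. (?I m x + ennreal (c * dy m \<gamma>) * indicator (S m) x) \<partial>lborel)"
        using False unfolding Suc by (intro nn_integral_mono) (auto simp: S_def indicator_def)
      also note IH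
      finally show ?thesis .
    next
      case True
      have "(\<integral>\<^sup>+x\<in>?Q (m + 1) j. (?I (m + 1) x + ennreal (c * dy (m + 1) \<gamma>) * indicator (S (m + 1)) x) \<partial>lborel)
        = (\<integral>\<^sup>+x. ?I m x * indicator (?Q (m + 1) j) x + ennreal ((1 + c) * dy (m + 1) \<gamma>) * indicator (?Q (m + 1) j) x \<partial>lborel)"
        using True c unfolding Suc
        by (intro nn_integral_cong) (auto simp: S_def indicator_def distrib_right)
      also have "\<dots> = (\<integral>\<^sup>+x\<in>?Q (m + 1) j. ?I m x \<partial>lborel) + ennreal ((1 + c) * dy (m + 1) \<gamma>) * vol (?Q (m + 1) j)"
        by (subst nn_integral_add) (measurable, simp only: nn_integral_cmult_indicator measurable_dyidx_set)
      also have "ennreal ((1 + c) * dy (m + 1) \<gamma>) * vol (?Q (m + 1) j) = ennreal ((1 + c) * dy (m + 1) (1 + \<gamma>))"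
        using c by (intro Q) auto
      finally have eq: "(\<integral>\<^sup>+x\<in>?Q (m + 1) j. (?I (m + 1) x + ennreal (c * dy (m + 1) \<gamma>) * indicator (S (m + 1)) x) \<partial>lborel)
        = (\<integral>\<^sup>+x\<in>?Q (m + 1) j. ?I m x \<partial>lborel) + ennreal ((1 + c) * dy (m + 1) (1 + \<gamma>))" .
      show ?thesis
      \<comment> \<open>If a child is heavy, its extra term pays for the parent. If none is, nothing
        below is heavy either, and the parent is paid by its own mass.\<close>
      proof (cases "\<exists>x. dyidx e (m + 1) x = j \<and> x \<in> S m")
        case True
        then obtain x where x: "dyidx e (m + 1) x = j" "x \<in> S m" by blast
        have "ennreal ((1 + c) * dy (m + 1) (1 + \<gamma>)) = ennreal (c * dy m \<gamma>) * vol (?Q m (dyidx e m x))"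
        proof -
          have "dy (m + 1) (1 + \<gamma>) = 2 powr (1 + \<gamma>) * dy m (1 + \<gamma>)"
            by (simp only: powr_add[symmetric]) (simp add: algebra_simps)
          then have "(1 + c) * dy (m + 1) (1 + \<gamma>) = c * dy m (1 + \<gamma>)"
            using c(2) by (metis mult.assoc)
          then show ?thesis using c by (simp only: Q less_imp_le)
        qed
        also have "\<dots> = (\<integral>\<^sup>+y. ennreal (c * dy m \<gamma>) * indicator (?Q m (dyidx e m x)) y \<partial>lborel)"
          by (simp add: nn_integral_cmult)
        also have "\<dots> \<le> (\<integral>\<^sup>+y\<in>?Q (m + 1) j. (ennreal (c * dy m \<gamma>) * indicator (S m) y) \<partial>lborel)"
          using x by (intro nn_integral_mono) (auto simp: indicator_def dyidx_Suc S_def)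
        finally have "(\<integral>\<^sup>+x\<in>?Q (m + 1) j. ?I m x \<partial>lborel) + ennreal ((1 + c) * dy (m + 1) (1 + \<gamma>))
          \<le> (\<integral>\<^sup>+x\<in>?Q (m + 1) j. ?I m x \<partial>lborel) + (\<integral>\<^sup>+y\<in>?Q (m + 1) j. (ennreal (c * dy m \<gamma>) * indicator (S m) y) \<partial>lborel)"
          by (rule add_left_mono)
        also have "\<dots> = (\<integral>\<^sup>+x\<in>?Q (m + 1) j. (?I m x + ennreal (c * dy m \<gamma>) * indicator (S m) x) \<partial>lborel)"
          by (subst nn_integral_add[symmetric]) (measurable, simp add: distrib_right)
        also note IH
        finally show ?thesis unfolding eq .
      next
        case no: False
        \<comment> \<open>Passing to an ancestor increases the mass and, as 1 + \<gamma> < 0, lowers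
          the threshold; a heavy descendant would force a heavy child.\<close>
        have "?I m x = 0" if x: "dyidx e (m + 1) x = j" for x
        proof -
          have "x \<notin> S i" if i: "i \<in> {K..m}" for i
          proof
            assume "x \<in> S i"
            then have "ennreal (\<Lambda> * dy i (1 + \<gamma>)) < mass i (dyidx e i x)" by (simp add: S_def)
            moreover have "mass i (dyidx e i x) \<le> mass m (dyidx e m x)"
            proof -
              have A: "indicator (?Q i (dyidx e i x)) y \<le> (indicator (?Q m (dyidx e m x)) y :: ennreal)" for y
                using dyidx_nested[of i m e y x] i by (auto split: split_indicator)
              show ?thesis
                unfolding mass_def by (rule nn_integral_mono, rule mult_left_mono, rule A, simp)
            qed
            moreover have "ennreal (\<Lambda> * dy m (1 + \<gamma>)) \<le> ennreal (\<Lambda> * dy i (1 + \<gamma>))"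
              using i \<gamma> \<Lambda> by (intro ennreal_leI mult_left_mono) (auto intro!: mult_right_mono_neg)
            ultimately have "x \<in> S m" by (simp add: S_def)
            with no x show False by blast
          qed
          then show ?thesis by simp
        qed
        then have "(\<integral>\<^sup>+x\<in>?Q (m + 1) j. ?I m x \<partial>lborel) = (\<integral>\<^sup>+x. 0 \<partial>(lborel :: 'a measure))"
          by (intro nn_integral_cong) (auto simp: indicator_def)
        then have "(\<integral>\<^sup>+x\<in>?Q (m + 1) j. ?I m x \<partial>lborel) = 0" by simp
        then show ?thesis
          unfolding eq using big[OF _ True, of "1 + c"] c by simp
      qed
    qed
  qed
qed

lemma emeasure_lborel_translate:
  fixes a :: "'a::euclidean_space"
  assumes [measurable]: "S \<in> sets borel"
  shows "vol {x. a + x \<in> S} = vol S"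
proof -
  have "vol S = emeasure (distr lborel borel ((+) a)) S"
    by (simp add: lborel_distr_plus)
  also have "\<dots> = vol {x. a + x \<in> S}"
    by (subst emeasure_distr) (auto simp: vimage_def)
  finally show ?thesis ..
qed

text \<open>The factor 9 is 3 for the three dyadic neighbours that a ball can meet times 3 for
  lowering the threshold to \<Lambda>/3; the bracket is 1 + c from
  \<open>dyadic_induction\<close>.\<close>

definition neg_const :: "real \<Rightarrow> real" where
  "neg_const \<gamma> = 9 * (1 + 1 / (2 powr - (1 + \<gamma>) - 1))"

text \<open>A ball of radius 2^m meets only the dyadic interval of its centre and the two adjacent
  ones, so one of these carries more than a third of the threshold. Translation by a multiple of 2^m
  shifts the index, hence the set for balls is covered by three translates of the dyadic set
  \<open>S m\<close>.\<close>

lemma scale_sum_neg: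
  fixes g :: "'a::euclidean_space \<Rightarrow> ennreal"
  assumes dim: "DIM('a) = 1" and g [measurable]: "g \<in> borel_measurable borel"
    and \<Lambda>: "\<Lambda> > 0" and \<gamma>: "\<gamma> < -1"
  shows "(\<Sum>z m. ennreal (dy m \<gamma>) *
      vol {x. (ball_int g x (rad m)) > ennreal (\<Lambda> * dy m (real DIM('a) + \<gamma>))})
    \<le> ennreal (neg_const \<gamma> / \<Lambda>) * (\<integral>\<^sup>+y. g y \<partial>lborel)"
proof -
  from dim obtain e :: 'a where e: "Basis = {e}" by (auto simp: card_1_singleton_iff)
  have ee: "e \<bullet> e = 1" by (rule inner_same_Basis) (simp add: e)
  define mass where "mass = (\<lambda>m i. \<integral>\<^sup>+y\<in>{y. dyidx e m y = i}. g y \<partial>lborel)"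
  define S where "S = (\<lambda>m. {x. mass m (dyidx e m x) > ennreal (\<Lambda> / 3 * dy m (1 + \<gamma>))})"
  define c where "c = 1 / (2 powr - (1 + \<gamma>) - 1 :: real)"
  have S [measurable]: "S m \<in> sets borel" for m
    unfolding S_def by measurable
  have c: "c > 0" using \<gamma> by (simp add: c_def)
  have \<Lambda>3: "\<Lambda> / 3 > 0" using \<Lambda> by simp
  \<comment> \<open>The induction needs a lowest scale, so finite windows of scales are treated with
    a constant independent of the window.\<close>
  have main: "(\<Sum>z m. ennreal (dy m \<gamma>) * vol (S m)) \<le> ennreal ((1 + c) / (\<Lambda> / 3)) * (\<integral>\<^sup>+y. g y \<partial>lborel)"
    unfolding zsum_eq_SUP
  proof (rule SUP_least)
    fix k :: nat
    let ?I = "\<lambda>x. \<Sum>i\<in>{- int k..int k}. ennreal (dy i \<gamma>) * indicator (S i) x"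
    have "(\<Sum>i\<in>{- int k..int k}. ennreal (dy i \<gamma>) * vol (S i)) = (\<integral>\<^sup>+x. ?I x \<partial>lborel)"
      by (subst nn_integral_sum) (auto intro!: sum.cong simp: nn_integral_cmult_indicator S)
    also have "\<dots> = (\<Sum>z j. \<integral>\<^sup>+x\<in>{x. dyidx e (int k) x = j}. ?I x \<partial>lborel)"
      by (rule nn_integral_dyadic_sum) measurable
    also have "\<dots> \<le> (\<Sum>z j. ennreal ((1 + c) / (\<Lambda> / 3)) * mass (int k) j)"
    proof (rule nn_integral_mono)
      fix j
      have "(\<integral>\<^sup>+x\<in>{x. dyidx e (int k) x = j}. ?I x \<partial>lborel)
        \<le> (\<integral>\<^sup>+x\<in>{x. dyidx e (int k) x = j}. (?I x + ennreal (c * dy (int k) \<gamma>) * indicator (S (int k)) x) \<partial>lborel)"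
        by (intro nn_integral_mono mult_right_mono) auto
      also have "\<dots> \<le> ennreal ((1 + c) / (\<Lambda> / 3)) * mass (int k) j"
        unfolding S_def mass_def c_def by (rule dyadic_induction[OF e g \<Lambda>3 \<gamma>]) simp
      finally show "(\<integral>\<^sup>+x\<in>{x. dyidx e (int k) x = j}. ?I x \<partial>lborel) \<le> ennreal ((1 + c) / (\<Lambda> / 3)) * mass (int k) j" .
    qed
    also have "\<dots> = ennreal ((1 + c) / (\<Lambda> / 3)) * (\<Sum>z j. mass (int k) j)"
      by (rule nn_integral_cmult) simp
    also have "(\<Sum>z j. mass (int k) j) = (\<integral>\<^sup>+y. g y \<partial>lborel)"
      unfolding mass_def by (rule nn_integral_dyadic_sum[symmetric]) measurable
    finally show "(\<Sum>i\<in>{- int k..int k}. ennreal (dy i \<gamma>) * vol (S i))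
      \<le> ennreal ((1 + c) / (\<Lambda> / 3)) * (\<integral>\<^sup>+y. g y \<partial>lborel)" .
  qed
  have ball: "vol {x. (ball_int g x (rad m)) > ennreal (\<Lambda> * dy m (real DIM('a) + \<gamma>))}
     \<le> 3 * vol (S m)" for m
  proof -
    have shift: "dyidx e m ((of_int i * rad m) *\<^sub>R e + x) = dyidx e m x + i" for i x
      by (simp add: dyidx_def inner_add_left ee add_divide_distrib)
    have "{x. (ball_int g x (rad m)) > ennreal (\<Lambda> * dy m (real DIM('a) + \<gamma>))}
      \<subseteq> (\<Union>i\<in>{-1,0,1::int}. {x. (of_int i * rad m) *\<^sub>R e + x \<in> S m})"
    proof (rule subsetI, rule ccontr)
      fix x assume "x \<in> {x. (ball_int g x (rad m)) > ennreal (\<Lambda> * dy m (real DIM('a) + \<gamma>))}"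
        and *: "x \<notin> (\<Union>i\<in>{-1,0,1::int}. {x. (of_int i * rad m) *\<^sub>R e + x \<in> S m})"
      then have "ennreal (\<Lambda> * dy m (1 + \<gamma>)) < (ball_int g x (rad m))" by (simp add: dim)
      also have "\<dots> \<le> (\<integral>\<^sup>+y. g y * indicator {y. dyidx e m y = dyidx e m x - 1} y
          + g y * indicator {y. dyidx e m y = dyidx e m x} y + g y * indicator {y. dyidx e m y = dyidx e m x + 1} y \<partial>lborel)"
      proof (rule nn_integral_mono)
        fix y
        have "dyidx e m y \<in> {dyidx e m x - 1, dyidx e m x, dyidx e m x + 1}" if "y \<in> ball x (rad m)"
        proof -
          have "\<bar>(x - y) \<bullet> e\<bar> \<le> norm (x - y) * norm e" by (rule Cauchy_Schwarz_ineq2)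
          also have "\<dots> < rad m" using that ee by (simp add: dist_norm norm_eq_sqrt_inner)
          finally have "\<bar>x \<bullet> e / rad m - y \<bullet> e / rad m\<bar> < 1"
            by (simp add: inner_diff_left diff_divide_distrib[symmetric] abs_divide)
          then show ?thesis unfolding dyidx_def by (simp, linarith)
        qed
        then show "g y * indicator (ball x (rad m)) y \<le> g y * indicator {y. dyidx e m y = dyidx e m x - 1} y
          + g y * indicator {y. dyidx e m y = dyidx e m x} y + g y * indicator {y. dyidx e m y = dyidx e m x + 1} y"
          by (auto simp: indicator_def)
      qed
      also have "\<dots> = mass m (dyidx e m x - 1) + mass m (dyidx e m x) + mass m (dyidx e m x + 1)"
        unfolding mass_def by (simp add: nn_integral_add)
      also have "\<dots> \<le> ennreal (\<Lambda> / 3 * dy m (1 + \<gamma>)) + ennreal (\<Lambda> / 3 * dy m (1 + \<gamma>)) + ennreal (\<Lambda> / 3 * dy m (1 + \<gamma>))"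
      proof -
        have **: "mass m (dyidx e m x + i) \<le> ennreal (\<Lambda> / 3 * dy m (1 + \<gamma>))" if "i \<in> {-1,0,1}" for i
          using * that unfolding S_def by (simp only: shift mem_Collect_eq UN_iff) (blast intro: leI)
        from **[of "-1"] **[of 0] **[of 1] show ?thesis by (intro add_mono) auto
      qed
      also have "\<dots> = ennreal (\<Lambda> * dy m (1 + \<gamma>))"
        using \<Lambda> by (simp add: ennreal_plus[symmetric] del: ennreal_plus)
      finally show False by simp
    qed
    then have "vol {x. (ball_int g x (rad m)) > ennreal (\<Lambda> * dy m (real DIM('a) + \<gamma>))}
      \<le> vol (\<Union>i\<in>{-1,0,1::int}. {x. (of_int i * rad m) *\<^sub>R e + x \<in> S m})"
      by (rule emeasure_mono) measurable
    also have "\<dots> \<le> (\<Sum>i\<in>{-1,0,1::int}. vol {x. (of_int i * rad m) *\<^sub>R e + x \<in> S m})"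
      by (rule emeasure_subadditive_finite) auto
    also have "\<dots> = 3 * vol (S m)"
      by (simp add: emeasure_lborel_translate[OF S] emeasure_lborel_translate[OF S, of 0, simplified])
    finally show ?thesis .
  qed
  have "(\<Sum>z m. ennreal (dy m \<gamma>) *
      vol {x. (ball_int g x (rad m)) > ennreal (\<Lambda> * dy m (real DIM('a) + \<gamma>))})
    \<le> (\<Sum>z m. 3 * (ennreal (dy m \<gamma>) * vol (S m)))"
    using mult_left_mono[OF ball, of "ennreal (dy _ \<gamma>)"] by (intro nn_integral_mono) (simp add: mult.left_commute)
  also have "\<dots> = 3 * (\<Sum>z m. ennreal (dy m \<gamma>) * vol (S m))"
    by (rule nn_integral_cmult) simp
  also have "\<dots> \<le> 3 * (ennreal ((1 + c) / (\<Lambda> / 3)) * (\<integral>\<^sup>+y. g y \<partial>lborel))"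
    by (rule mult_left_mono[OF main]) simp
  also have "\<dots> = ennreal (3 * ((1 + c) / (\<Lambda> / 3))) * (\<integral>\<^sup>+y. g y \<partial>lborel)"
    using c \<Lambda> by (subst ennreal_mult) (auto simp: mult.assoc)
  also have "3 * ((1 + c) / (\<Lambda> / 3)) = neg_const \<gamma> / \<Lambda>"
    using \<Lambda> by (simp add: neg_const_def c_def)
  finally show ?thesis .
qed

lemma scale_sum:
  assumes "\<gamma> > 0 \<or> (\<gamma> < -1 \<and> DIM('a::euclidean_space) = 1)"
  obtains C where "C > 0" "\<And>\<Lambda> (g :: 'a \<Rightarrow> ennreal). \<Lambda> > 0 \<Longrightarrow> g \<in> borel_measurable borel \<Longrightarrow>
    (\<Sum>z m. ennreal (dy m \<gamma>) *
      vol {x. (ball_int g x (rad m)) > ennreal (\<Lambda> * dy m (real DIM('a) + \<gamma>))})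
    \<le> ennreal (C / \<Lambda>) * (\<integral>\<^sup>+y. g y \<partial>lborel)"
proof (cases "\<gamma> > 0")
  case True
  show ?thesis
    by (rule that[of "scale_const TYPE('a) \<gamma>"])
       (use True scale_sum_pos[where 'a='a] in \<open>auto simp: scale_const_def powr_less_one\<close>)
next
  case False
  with assms have \<gamma>: "\<gamma> < -1" "DIM('a) = 1" by auto
  show ?thesis
  proof (rule that[of "neg_const \<gamma>"])
    have "2 powr - (1 + \<gamma>) > (1::real)" using \<gamma> by simp
    then have "1 / (2 powr - (1 + \<gamma>) - 1) > (0::real)" by simp
    then show "neg_const \<gamma> > 0"
      unfolding neg_const_def by (rule mult_pos_pos[OF _ add_pos_pos, rotated 2]) simp_all
  qed (rule scale_sum_neg[OF \<gamma>(2) _ _ \<gamma>(1)])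
qed

subsection \<open>Differences and averages of the gradient\<close>

lemma nn_integral_ball_scale:
  fixes u :: "'a::euclidean_space \<Rightarrow> ennreal"
  assumes [measurable]: "u \<in> borel_measurable borel" and t: "t > 0"
  shows "(ball_int (\<lambda>y. u (x + t *\<^sub>R (y - x))) x R)
    = ennreal (t powr - real DIM('a)) * (ball_int u x (t * R))"
proof -
  let ?T = "\<lambda>y. (x - t *\<^sub>R x) + t *\<^sub>R y"
  have T: "?T y = x + t *\<^sub>R (y - x)" for y by (simp add: algebra_simps)
  have ball: "?T y \<in> ball x (t * R) \<longleftrightarrow> y \<in> ball x R" for y
  proof -
    have "dist x (?T y) = t * dist x y"
      unfolding T using t by (simp add: dist_norm norm_minus_commute)
    then show ?thesis using t by simp
  qed
  have "(ball_int u x (t * R))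
    = (\<integral>\<^sup>+z\<in>ball x (t * R). u z \<partial>(density (distr lborel borel ?T) (\<lambda>_. ennreal (\<bar>t\<bar> ^ DIM('a)))))"
    using lborel_affine[of t "x - t *\<^sub>R x"] t by simp
  also have "\<dots> = (\<integral>\<^sup>+y. ennreal (t ^ DIM('a)) * (u (?T y) * indicator (ball x (t * R)) (?T y)) \<partial>lborel)"
    using t by (subst nn_integral_density, simp, simp) (subst nn_integral_distr, auto)
  also have "\<dots> = (\<integral>\<^sup>+y. ennreal (t ^ DIM('a)) * (u (x + t *\<^sub>R (y - x)) * indicator (ball x R) y) \<partial>lborel)"
    using ball unfolding T by (intro nn_integral_cong) (simp add: indicator_def)
  also have "\<dots> = ennreal (t ^ DIM('a)) * (ball_int (\<lambda>y. u (x + t *\<^sub>R (y - x))) x R)"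
    by (rule nn_integral_cmult) measurable
  finally have "ennreal (t powr - real DIM('a)) * (ball_int u x (t * R))
    = ennreal (t powr - real DIM('a)) * ennreal (t ^ DIM('a)) * (ball_int (\<lambda>y. u (x + t *\<^sub>R (y - x))) x R)"
    by (simp add: mult.assoc)
  also have "ennreal (t powr - real DIM('a)) * ennreal (t ^ DIM('a)) = 1"
    using t by (subst ennreal_mult[symmetric]) (simp_all add: powr_minus powr_realpow)
  finally show ?thesis by simp
qed

lemma C1_diff_le_segment:
  fixes f :: "'a::euclidean_space \<Rightarrow> real"
  assumes "C1_grad_cc f g"
  shows "ennreal \<bar>f x - f u\<bar> \<le> (\<integral>\<^sup>+t\<in>{0..1}. ennreal (norm (g (x + t *\<^sub>R (u - x)))) \<partial>lborel) * ennreal (norm (u - x))"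
proof -
  have f: "(f has_derivative (\<lambda>h. g z \<bullet> h)) (at z)" for z
    using assms by (auto simp: C1_grad_cc_def)
  have g: "continuous_on UNIV g"
    using assms by (auto simp: C1_grad_cc_def)
  let ?\<phi> = "\<lambda>t. g (x + t *\<^sub>R (u - x))"
  have cont: "continuous_on {0..1} ?\<phi>"
    by (rule continuous_on_compose2[OF g]) (auto intro!: continuous_intros)
  have "((\<lambda>t. ?\<phi> t \<bullet> (u - x)) has_integral (f (x + 1 *\<^sub>R (u - x)) - f (x + 0 *\<^sub>R (u - x)))) {0..1}"
  proof (rule fundamental_theorem_of_calculus)
    fix t :: real
    have "((\<lambda>t. f (x + t *\<^sub>R (u - x))) has_derivative (\<lambda>s. ?\<phi> t \<bullet> (s *\<^sub>R (u - x)))) (at t within {0..1})"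
      by (rule has_derivative_compose[OF _ f]) (auto intro!: derivative_eq_intros)
    then show "((\<lambda>t. f (x + t *\<^sub>R (u - x))) has_vector_derivative ?\<phi> t \<bullet> (u - x)) (at t within {0..1})"
      by (simp add: has_vector_derivative_def)
  qed simp
  then have I: "((\<lambda>t. ?\<phi> t \<bullet> (u - x)) has_integral (f u - f x)) {0..1}" by simp
  have int: "(\<lambda>t. norm (?\<phi> t) * norm (u - x)) integrable_on {0..1}"
    by (intro integrable_continuous_real continuous_intros cont)
  have "\<bar>f x - f u\<bar> = norm (integral {0..1} (\<lambda>t. ?\<phi> t \<bullet> (u - x)))"
    using integral_unique[OF I] by simp
  also have "\<dots> \<le> integral {0..1} (\<lambda>t. norm (?\<phi> t) * norm (u - x))"
    using I int by (intro Henstock_Kurzweil_Integration.integral_norm_bound_integral)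
      (auto simp: Cauchy_Schwarz_ineq2 has_integral_integrable)
  finally have "ennreal \<bar>f x - f u\<bar> \<le> ennreal (integral {0..1} (\<lambda>t. norm (?\<phi> t) * norm (u - x)))"
    by (rule ennreal_leI)
  also have "\<dots> = (\<integral>\<^sup>+t\<in>{0..1}. ennreal (norm (?\<phi> t) * norm (u - x)) \<partial>lborel)"
    by (rule nn_integral_has_integral_lebesgue'[symmetric]) (simp, rule integrable_integral[OF int])
  also have "\<dots> = (\<integral>\<^sup>+t. ennreal (norm (?\<phi> t)) * indicator {0..1} t * ennreal (norm (u - x)) \<partial>lborel)"
    by (intro nn_integral_cong) (auto simp: ennreal_mult mult_ac)
  also have "\<dots> = (\<integral>\<^sup>+t\<in>{0..1}. ennreal (norm (?\<phi> t)) \<partial>lborel) * ennreal (norm (u - x))"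
  proof (rule nn_integral_multc)
    have [measurable]: "g \<in> borel_measurable borel"
      using g by (rule borel_measurable_continuous_onI)
    show "(\<lambda>t. ennreal (norm (?\<phi> t)) * indicator {0..1} t) \<in> borel_measurable lborel"
      by measurable
  qed
  finally show ?thesis .
qed

lemma nn_integral_diff_ball_le:
  fixes f :: "'a::euclidean_space \<Rightarrow> real"
  assumes C1: "C1_grad_cc f g" and R: "R > 0"
  shows "(ball_int (\<lambda>u. ennreal \<bar>f x - f u\<bar>) x R)
    \<le> ennreal R * (\<integral>\<^sup>+t\<in>{0..1}. (ball_int (\<lambda>u. ennreal (norm (g (x + t *\<^sub>R (u - x))))) x R) \<partial>lborel)"
proof -
  have [measurable]: "g \<in> borel_measurable borel"
    using C1 by (auto simp: C1_grad_cc_def intro: borel_measurable_continuous_onI)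
  let ?F = "\<lambda>t u. ennreal (norm (g (x + t *\<^sub>R (u - x)))) * indicator {0..1} t * indicator (ball x R) u"
  have "(ball_int (\<lambda>u. ennreal \<bar>f x - f u\<bar>) x R)
    \<le> (\<integral>\<^sup>+u. ennreal R * (\<integral>\<^sup>+t. ?F t u \<partial>lborel) \<partial>lborel)"
  proof (rule nn_integral_mono)
    fix u
    show "ennreal \<bar>f x - f u\<bar> * indicator (ball x R) u \<le> ennreal R * (\<integral>\<^sup>+t. ?F t u \<partial>lborel)"
    proof (cases "u \<in> ball x R")
      case True
      have "ennreal \<bar>f x - f u\<bar> \<le> (\<integral>\<^sup>+t\<in>{0..1}. ennreal (norm (g (x + t *\<^sub>R (u - x)))) \<partial>lborel) * ennreal (norm (u - x))"
        by (rule C1_diff_le_segment[OF C1])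
      also have "\<dots> \<le> (\<integral>\<^sup>+t\<in>{0..1}. ennreal (norm (g (x + t *\<^sub>R (u - x)))) \<partial>lborel) * ennreal R"
        using True by (intro mult_left_mono ennreal_leI) (auto simp: dist_norm norm_minus_commute)
      finally show ?thesis using True by (simp add: mult.commute[of _ "ennreal R"])
    qed simp
  qed
  also have "\<dots> = ennreal R * (\<integral>\<^sup>+u. (\<integral>\<^sup>+t. ?F t u \<partial>lborel) \<partial>lborel)"
    by (rule nn_integral_cmult) measurable
  also have "(\<integral>\<^sup>+u. (\<integral>\<^sup>+t. ?F t u \<partial>lborel) \<partial>lborel) = (\<integral>\<^sup>+t. (\<integral>\<^sup>+u. ?F t u \<partial>lborel) \<partial>lborel)"
    by (rule lborel_pair.Fubini') measurable
  also have "\<dots> = (\<integral>\<^sup>+t\<in>{0..1}. (ball_int (\<lambda>u. ennreal (norm (g (x + t *\<^sub>R (u - x))))) x R) \<partial>lborel)"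
    by (intro nn_integral_cong) (auto simp: indicator_def)
  finally show ?thesis .
qed

text \<open>The factor \<open>2\<^sup>j\<^sup>/\<^sup>2\<close> is what the averages at the smaller scales \<open>2\<^sup>k\<^sup>-\<^sup>j\<close> may lose,
  because \<open>t powr (-1/2)\<close> is integrable at \<open>0\<close>.\<close>

lemma nn_integral_diff_ball_le_scales:
  fixes f :: "'a::euclidean_space \<Rightarrow> real"
  assumes C1: "C1_grad_cc f g" and \<Lambda>: "\<Lambda> \<ge> 0"
    and A: "\<And>j::nat. (ball_int (\<lambda>y. ennreal (norm (g y))) x (rad (k - int j)))
       \<le> ennreal (\<Lambda> * 2 powr (real j / 2) * dy (k - int j) (real DIM('a)))"
  shows "(ball_int (\<lambda>u. ennreal \<bar>f x - f u\<bar>) x (rad k))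
    \<le> ennreal (2 ^ (DIM('a) + 1) * \<Lambda> * rad k * dy k (real DIM('a)))"
proof -
  let ?n = "real DIM('a)"
  have [measurable]: "g \<in> borel_measurable borel"
    using C1 by (auto simp: C1_grad_cc_def intro: borel_measurable_continuous_onI)
  \<comment> \<open>The factor 2^n is the loss in rounding t to powers of 2; the further factor 2 of
    the claim is the integral of t powr (-1/2) over the unit interval.\<close>
  define B where "B = 2 ^ DIM('a) * \<Lambda> * dy k ?n"
  have B: "B \<ge> 0" using \<Lambda> by (simp add: B_def)
  have pt: "(ball_int (\<lambda>u. ennreal (norm (g (x + t *\<^sub>R (u - x))))) x (rad k)) \<le> ennreal (B * t powr (- 1 / 2))"
    if t: "0 < t" "t < 1" for t
  proof -
    obtain i where i: "rad i \<le> t" "t < rad (i + 1)"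
      using scale_exists[OF t(1)] by (auto simp del: of_int_add)
    have "rad i < rad 0" using i t by simp
    then have "i < 0" by (simp add: powr_less_cancel_iff del: powr_zero_eq_one of_int_0)
    \<comment> \<open>Chosen so that \<open>rad (k - int j)\<close> is the dyadic radius just above
      t * \<open>rad k\<close>; t < 1 makes j a natural number.\<close>
    define j where "j = nat (- (i + 1))"
    have j: "int j = - (i + 1)" using \<open>i < 0\<close> by (simp add: j_def)
    have rj: "real j = - (of_int i + 1)" using j by linarith
    have "(ball_int (\<lambda>u. ennreal (norm (g (x + t *\<^sub>R (u - x))))) x (rad k))
      = ennreal (t powr - ?n) * (ball_int (\<lambda>z. ennreal (norm (g z))) x (t * rad k))"
      using t by (intro nn_integral_ball_scale) auto
    also have "\<dots> \<le> ennreal (t powr - ?n) * (ball_int (\<lambda>z. ennreal (norm (g z))) x (rad (k - int j)))"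
    proof -
      have "t * rad k \<le> rad (i + 1) * rad k" using i by simp
      also have "\<dots> = rad (k - int j)" by (simp add: j powr_add[symmetric] algebra_simps)
      finally have "ball x (t * rad k) \<subseteq> ball x (rad (k - int j))" by (rule subset_ball)
      then have "indicator (ball x (t * rad k)) z \<le> (indicator (ball x (rad (k - int j))) z :: ennreal)" for z
        by (auto split: split_indicator)
      then show ?thesis by (intro mult_left_mono nn_integral_mono) auto
    qed
    also have "\<dots> \<le> ennreal (t powr - ?n) * ennreal (\<Lambda> * 2 powr (real j / 2) * dy (k - int j) ?n)"
      by (intro mult_left_mono A) auto
    also have "\<dots> = ennreal (t powr - ?n * (\<Lambda> * 2 powr (real j / 2) * dy (k - int j) ?n))"
      using \<Lambda> by (simp add: ennreal_mult[symmetric])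
    also have "\<dots> \<le> ennreal (B * t powr (- 1 / 2))"
    proof (rule ennreal_leI)
      have "t powr - ?n \<le> rad i powr - ?n" using i by (intro powr_mono2') auto
      moreover have "2 powr (real j / 2) \<le> t powr (- 1 / 2)"
      proof -
        have "2 powr (real j / 2) = rad (i + 1) powr (- 1 / 2)"
          unfolding powr_powr rj by (rule arg_cong[where f="\<lambda>a. 2 powr a"]) (simp add: field_simps)
        also have "\<dots> \<le> t powr (- 1 / 2)" using i t by (intro powr_mono2') auto
        finally show ?thesis .
      qed
      ultimately have "t powr - ?n * (\<Lambda> * 2 powr (real j / 2) * dy (k - int j) ?n)
        \<le> rad i powr - ?n * (\<Lambda> * t powr (- 1 / 2) * dy (k - int j) ?n)"
        using \<Lambda> by (intro mult_mono mult_left_mono mult_right_mono) auto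
      also have "\<dots> = (rad i powr - ?n * dy (k - int j) ?n) * \<Lambda> * t powr (- 1 / 2)"
        by (simp only: mult_ac)
      also have "rad i powr - ?n * dy (k - int j) ?n = 2 ^ DIM('a) * dy k ?n"
      proof -
        have "rad i powr - ?n * dy (k - int j) ?n = 2 powr (?n + of_int k * ?n)"
          by (simp add: powr_powr powr_add[symmetric] j algebra_simps)
        then show ?thesis by (simp add: powr_add powr_realpow)
      qed
      finally show "t powr - ?n * (\<Lambda> * 2 powr (real j / 2) * dy (k - int j) ?n) \<le> B * t powr (- 1 / 2)"
        by (simp add: B_def mult_ac)
    qed
    finally show ?thesis .
  qed
  have "(ball_int (\<lambda>u. ennreal \<bar>f x - f u\<bar>) x (rad k))
    \<le> ennreal (rad k) * (\<integral>\<^sup>+t\<in>{0..1}. (ball_int (\<lambda>u. ennreal (norm (g (x + t *\<^sub>R (u - x))))) x (rad k)) \<partial>lborel)"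
    by (rule nn_integral_diff_ball_le[OF C1]) simp
  also have "\<dots> \<le> ennreal (rad k) * (\<integral>\<^sup>+t. ennreal B * (ennreal (t powr (- 1 / 2)) * indicator {0..1} t) \<partial>lborel)"
  proof (intro mult_left_mono nn_integral_mono_AE)
    show "AE t in lborel. (ball_int (\<lambda>u. ennreal (norm (g (x + t *\<^sub>R (u - x))))) x (rad k)) * indicator {0..1} t
        \<le> ennreal B * (ennreal (t powr (- 1 / 2)) * indicator {0..1} t)"
      \<comment> \<open>Two null points are removed: at t = 0 \<open>powr\<close> has the default
        value 0, and at t = 1 the number - (i + 1) would be negative.\<close>
      using AE_lborel_singleton[of "0::real"] AE_lborel_singleton[of "1::real"]
    proof eventually_elim
      case (elim t)
      show ?case
      proof (cases "t \<in> {0..1}")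
        case True
        with elim have "0 < t" "t < 1" by auto
        from pt[OF this] B True show ?thesis by (simp add: ennreal_mult)
      qed simp
    qed
  qed simp
  also have "\<dots> = ennreal (rad k) * (ennreal B * (\<integral>\<^sup>+t\<in>{0..1}. ennreal (t powr (- 1 / 2)) \<partial>lborel))"
    by (subst nn_integral_cmult) auto
  also have "(\<integral>\<^sup>+t\<in>{0..1}. ennreal (t powr (- 1 / 2)) \<partial>lborel) = ennreal 2"
    using has_integral_powr_from_0[of "- 1 / 2" 1]
    by (intro nn_integral_has_integral_lebesgue') auto
  also have "ennreal (rad k) * (ennreal B * ennreal 2) = ennreal (rad k * (B * 2))"
    using B by (simp add: ennreal_mult)
  also have "rad k * (B * 2) = 2 ^ (DIM('a) + 1) * \<Lambda> * rad k * dy k ?n"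
    by (simp add: B_def mult_ac)
  finally show ?thesis .
qed

text \<open>The power of 4 collects 2 for the two endpoints, 2^(n + 1) from
  \<open>nn_integral_diff_ball_le_scales\<close>, and 2^n because the common ball has half the
  radius.\<close>

definition grad_const :: "'a::euclidean_space itself \<Rightarrow> real" where
  "grad_const _ = 4 ^ (DIM('a) + 1) / ubv TYPE('a)"

lemma grad_const_pos: "grad_const TYPE('a::euclidean_space) > 0"
  by (simp add: grad_const_def)

text \<open>The ball around the midpoint with radius \<open>rad k / 2\<close> lies in both balls of
  radius \<open>rad k\<close>. Comparing f x and f y with f u and integrating over u in this common
  ball reduces the claim to the estimate at one point.\<close>

lemma C1_diff_le_scales:
  fixes f :: "'a::euclidean_space \<Rightarrow> real"
  assumes C1: "C1_grad_cc f g" and \<Lambda>: "\<Lambda> \<ge> 0" and xy: "dist x y \<le> rad k"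
    and Ax: "\<And>j::nat. (ball_int (\<lambda>z. ennreal (norm (g z))) x (rad (k - int j)))
       \<le> ennreal (\<Lambda> * 2 powr (real j / 2) * dy (k - int j) (real DIM('a)))"
    and Ay: "\<And>j::nat. (ball_int (\<lambda>z. ennreal (norm (g z))) y (rad (k - int j)))
       \<le> ennreal (\<Lambda> * 2 powr (real j / 2) * dy (k - int j) (real DIM('a)))"
  shows "\<bar>f x - f y\<bar> \<le> grad_const TYPE('a) * \<Lambda> * rad k"
proof -
  let ?n = "real DIM('a)" and ?w = "ubv TYPE('a)"
  let ?W = "ball (midpoint x y) (rad k / 2)"
  have "isCont f z" for z
    using C1 by (auto simp: C1_grad_cc_def intro: has_derivative_continuous)
  then have [measurable]: "f \<in> borel_measurable borel"
    by (intro borel_measurable_continuous_onI continuous_at_imp_continuous_on) auto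
  let ?c = "?w * (rad k / 2) powr ?n" and ?b = "2 ^ (DIM('a) + 1) * \<Lambda> * rad k * dy k ?n"
  have W: "?W \<subseteq> ball x (rad k)" "?W \<subseteq> ball y (rad k)"
  proof -
    have m: "dist x (midpoint x y) \<le> rad k / 2" "dist y (midpoint x y) \<le> rad k / 2"
      using xy by (simp_all add: dist_midpoint dist_commute)
    show "?W \<subseteq> ball x (rad k)" "?W \<subseteq> ball y (rad k)"
      using m by (simp_all add: ball_subset_ball_iff dist_commute)
  qed
  have "ennreal (\<bar>f x - f y\<bar> * ?c) = ennreal \<bar>f x - f y\<bar> * vol ?W"
    by (simp add: emeasure_ball_powr ennreal_mult)
  also have "\<dots> = (\<integral>\<^sup>+u\<in>?W. ennreal \<bar>f x - f y\<bar> \<partial>lborel)"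
    by (simp add: nn_integral_cmult)
  also have "\<dots> \<le> (\<integral>\<^sup>+u. ennreal \<bar>f x - f u\<bar> * indicator (ball x (rad k)) u + ennreal \<bar>f y - f u\<bar> * indicator (ball y (rad k)) u \<partial>lborel)"
  proof (rule nn_integral_mono)
    fix u
    have "ennreal \<bar>f x - f y\<bar> \<le> ennreal (\<bar>f x - f u\<bar> + \<bar>f y - f u\<bar>)" by (rule ennreal_leI) linarith
    then show "ennreal \<bar>f x - f y\<bar> * indicator ?W u
      \<le> ennreal \<bar>f x - f u\<bar> * indicator (ball x (rad k)) u + ennreal \<bar>f y - f u\<bar> * indicator (ball y (rad k)) u"
      using subsetD[OF W(1), of u] subsetD[OF W(2), of u]
      by (cases "u \<in> ?W") (simp_all add: ennreal_plus)
  qed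
  also have "\<dots> = (ball_int (\<lambda>u. ennreal \<bar>f x - f u\<bar>) x (rad k)) + (ball_int (\<lambda>u. ennreal \<bar>f y - f u\<bar>) y (rad k))"
    by (rule nn_integral_add) measurable
  also have "\<dots> \<le> ennreal ?b + ennreal ?b"
    by (intro add_mono nn_integral_diff_ball_le_scales[OF C1 \<Lambda>] Ax Ay)
  also have "\<dots> = ennreal (2 * ?b)"
    using \<Lambda> by (simp add: ennreal_plus[symmetric] del: ennreal_plus)
  finally have "\<bar>f x - f y\<bar> * ?c \<le> 2 * ?b"
    using \<Lambda> by (simp add: ennreal_le_iff)
  moreover have "?c = ?w / 2 ^ DIM('a) * dy k ?n"
    by (simp add: powr_divide powr_powr powr_realpow)
  ultimately have "\<bar>f x - f y\<bar> * (?w / 2 ^ DIM('a)) * dy k ?n \<le> 2 * (2 ^ (DIM('a) + 1) * \<Lambda> * rad k) * dy k ?n"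
    by (simp add: mult.assoc)
  then have "\<bar>f x - f y\<bar> * (?w / 2 ^ DIM('a)) \<le> 2 * (2 ^ (DIM('a) + 1) * \<Lambda> * rad k)"
    by (rule mult_right_le_imp_le) simp
  then have "\<bar>f x - f y\<bar> \<le> 2 * (2 ^ (DIM('a) + 1) * \<Lambda> * rad k) / (?w / 2 ^ DIM('a))"
    by (subst pos_le_divide_eq) simp_all
  also have "\<dots> = grad_const TYPE('a) * \<Lambda> * rad k"
  proof -
    have "(4::real) ^ DIM('a) = 2 ^ DIM('a) * 2 ^ DIM('a)"
      by (simp add: power_mult_distrib[symmetric])
    then show ?thesis by (simp add: grad_const_def)
  qed
  finally show ?thesis .
qed

subsection \<open>Bounds for the two endpoint level sets\<close>

lemma zsum_emeasure_Int:
  assumes [measurable]: "\<And>k. U k \<in> sets borel" "B \<in> sets borel"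
  shows "(\<Sum>z k. ennreal (dy k \<gamma>) * vol (U k \<inter> B))
    = (\<integral>\<^sup>+x\<in>B. (\<Sum>z k. ennreal (dy k \<gamma>) * indicator (U k) x) \<partial>lborel)"
proof -
  have "(\<Sum>z k. ennreal (dy k \<gamma>) * vol (U k \<inter> B))
      = (\<Sum>z k. \<integral>\<^sup>+x. ennreal (dy k \<gamma>) * indicator (U k) x * indicator B x \<partial>lborel)"
    by (intro nn_integral_cong) (simp add: mult.assoc nn_integral_cmult indicator_inter_arith[symmetric])
  also have "\<dots> = (\<integral>\<^sup>+x. (\<Sum>z k. ennreal (dy k \<gamma>) * indicator (U k) x * indicator B x) \<partial>lborel)"
    by (rule zsum_nn_integral[symmetric]) measurable
  also have "\<dots> = (\<integral>\<^sup>+x\<in>B. (\<Sum>z k. ennreal (dy k \<gamma>) * indicator (U k) x) \<partial>lborel)"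
    by (intro nn_integral_cong nn_integral_multc) simp
  finally show ?thesis .
qed

text \<open>For r = 1 no maximal function is available, but \<open>mb_1_Dop\<close> asks only for
  integrals of the weighted sum of indicators, which is pointwise at most a multiple of h.\<close>

lemma mb_Dop_superlevel_ge_1:
  assumes r: "r \<ge> 1" and \<gamma>: "\<gamma> \<noteq> 0" and \<theta>: "\<theta> > 0"
  obtains C where "C > 0" "\<And>K (h :: 'a::euclidean_space \<Rightarrow> ennreal). K > 0 \<Longrightarrow> h \<in> borel_measurable borel \<Longrightarrow> mb r \<theta> K h
    \<Longrightarrow> mb r \<theta> (C * K) (Dop \<gamma> (\<lambda>k. {x. ennreal (dy k \<gamma>) < h x}))"
proof (cases "r = 1")
  case False
  with r have "r > 1" by simp
  from mb_Dop_superlevel[OF this \<gamma> \<theta>, where 'a='a] that show ?thesis by blast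
next
  case True
  let ?c = "1 + ubv TYPE('a) * 2 powr (real DIM('a) * (1 - \<theta>)) * (1 + geo (real DIM('a) * \<theta>))"
  have g: "geo \<gamma> > 0" "geo (real DIM('a) * \<theta>) > 0" using \<gamma> \<theta> by (auto intro!: geo_pos)
  have c: "?c > 0" using g by (intro add_pos_pos mult_pos_pos) auto
  show ?thesis
  proof (rule that[of "?c * geo \<gamma>"])
    show "?c * geo \<gamma> > 0" using c g by simp
    fix K :: real and h :: "'a \<Rightarrow> ennreal"
    assume K: "K > 0" and h [measurable]: "h \<in> borel_measurable borel" and mb: "mb r \<theta> K h"
    have "mb 1 \<theta> (?c * (geo \<gamma> * K)) (Dop \<gamma> (\<lambda>k. {x. ennreal (dy k \<gamma>) < h x}))"
    proof (rule mb_1_Dop[OF _ \<theta>])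
      fix x :: 'a and \<rho> :: real assume \<rho>: "\<rho> > 0"
      have "(\<Sum>z k. ennreal (dy k \<gamma>) * vol ({x. ennreal (dy k \<gamma>) < h x} \<inter> ball x \<rho>))
        = (ball_int (\<lambda>y. (\<Sum>z k. ennreal (dy k \<gamma>) * indicator {x. ennreal (dy k \<gamma>) < h x} y)) x \<rho>)"
        by (rule zsum_emeasure_Int) measurable
      also have "\<dots> \<le> (\<integral>\<^sup>+y. ennreal (geo \<gamma>) * (h y * indicator (ball x \<rho>) y) \<partial>lborel)"
        unfolding mult.assoc[symmetric]
        by (rule nn_integral_mono, rule mult_right_mono[OF zsum_superlevel[OF \<gamma>]]) simp
      also have "\<dots> = ennreal (geo \<gamma>) * (ball_int h x \<rho>)"
        by (rule nn_integral_cmult) measurable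
      also have "\<dots> \<le> ennreal (geo \<gamma>) * ennreal (K * \<rho> powr (real DIM('a) * (1 - \<theta>)))"
        using mbD[OF mb \<rho>, of x] True by (intro mult_left_mono) auto
      also have "\<dots> = ennreal (geo \<gamma> * K * \<rho> powr (real DIM('a) * (1 - \<theta>)))"
        using g K by (simp add: ennreal_mult[symmetric] mult.assoc)
      finally show "(\<Sum>z k. ennreal (dy k \<gamma>) * vol ({x. ennreal (dy k \<gamma>) < h x} \<inter> ball x \<rho>))
        \<le> ennreal (geo \<gamma> * K * \<rho> powr (real DIM('a) * (1 - \<theta>)))" .
    qed (use g K in auto)
    then show "mb r \<theta> (?c * geo \<gamma> * K) (Dop \<gamma> (\<lambda>k. {x. ennreal (dy k \<gamma>) < h x}))"
      by (simp only: True mult.assoc)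
  qed
qed

lemma annulus_powr_le:
  assumes "rad (k - 1) \<le> d" "d < rad k"
  shows "2 powr - \<bar>b\<bar> * dy k b \<le> d powr b"
proof (cases "b \<ge> 0")
  case True
  have "2 powr - \<bar>b\<bar> * dy k b = rad (k - 1) powr b"
    using True by (simp add: powr_powr powr_add[symmetric] algebra_simps)
  also have "\<dots> \<le> d powr b" using assms True by (intro powr_mono2) auto
  finally show ?thesis .
next
  case False
  have d: "d > 0" using assms(1) by (rule less_le_trans[rotated]) simp
  have "2 powr - \<bar>b\<bar> * dy k b \<le> 1 * dy k b"
    using powr_mono[of "- \<bar>b\<bar>" 0 "2::real"] by (intro mult_right_mono) auto
  also have "\<dots> = rad k powr b" by (simp add: powr_powr)
  also have "\<dots> \<le> d powr b" using assms d False by (intro powr_mono2') auto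
  finally show ?thesis .
qed

lemma Dset_annulus:
  assumes "(x, y) \<in> Dset lam \<beta> \<sigma> f" "rad (k - 1) \<le> dist x y" "dist x y < rad k" "lam > 0"
  shows "lam * 2 powr - \<bar>\<sigma> + \<beta>\<bar> * dy k (\<sigma> + \<beta>) < \<bar>f x - f y\<bar>"
proof -
  have "lam * 2 powr - \<bar>\<sigma> + \<beta>\<bar> * dy k (\<sigma> + \<beta>) \<le> lam * dist x y powr (\<sigma> + \<beta>)"
    using annulus_powr_le[OF assms(2,3), of "\<sigma> + \<beta>"] assms(4) by (simp add: mult.assoc)
  also have "\<dots> < \<bar>f x - f y\<bar>"
    using assms(1) by (auto simp: Dset_def pos_less_divide_eq)
  finally show ?thesis .
qed

text \<open>If the difference of two numbers exceeds L in modulus, one of them exceeds L/2; so the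
  sets \<open>U k\<close> are superlevel sets of a multiple of the p-th power of f. A Borel majorant
  G is returned because adding the two endpoint bounds by \<open>mb_add\<close> takes measurable
  summands.\<close>

lemma level_set_bound_function:
  assumes r: "r \<ge> 1" and \<gamma>: "\<gamma> \<noteq> 0" and \<theta>: "\<theta> > 0" and p: "p \<ge> 1"
  obtains C where "C > 0" "\<And>K lam (f :: 'a::euclidean_space \<Rightarrow> real). K > 0 \<Longrightarrow> lam > 0 \<Longrightarrow> f \<in> borel_measurable borel
    \<Longrightarrow> mb r \<theta> K (\<lambda>x. epow (ennreal \<bar>f x\<bar>) p)
    \<Longrightarrow> \<exists>G\<in>borel_measurable borel. (\<forall>x. Dint lam (\<gamma> / p) 0 \<gamma> f x \<le> G x) \<and> mb r \<theta> (C * K / lam powr (p * r)) G"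
proof -
  from mb_Dop_superlevel_ge_1[OF r \<gamma> \<theta>, where 'a='a] obtain C where C: "C > 0" and
    bd: "\<And>K (h :: 'a \<Rightarrow> ennreal). K > 0 \<Longrightarrow> h \<in> borel_measurable borel \<Longrightarrow> mb r \<theta> K h
    \<Longrightarrow> mb r \<theta> (C * K) (Dop \<gamma> (\<lambda>k. {x. ennreal (dy k \<gamma>) < h x}))"
    by blast
  let ?a = "2 powr - \<bar>\<gamma> / p\<bar>" and ?d = "disc_const TYPE('a) \<gamma>"
  let ?e = "(2 / ?a) powr (p * r)"
  show ?thesis
  proof (rule that[of "?d powr r * (C * ?e)"])
    show "?d powr r * (C * ?e) > 0" using C disc_const_pos[where 'a='a, of \<gamma>] by simp
    fix K lam :: real and f :: "'a \<Rightarrow> real"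
    assume K: "K > 0" and lam: "lam > 0" and f [measurable]: "f \<in> borel_measurable borel"
      and mb: "mb r \<theta> K (\<lambda>x. epow (ennreal \<bar>f x\<bar>) p)"
    \<comment> \<open>Normalized so that \<open>dy k \<gamma> < h x\<close> says exactly that f x
      exceeds half of the annulus bound from \<open>Dset_annulus\<close> in modulus.\<close>
    define c where "c = (2 / (lam * ?a)) powr p"
    have c: "c > 0" using lam by (simp add: c_def)
    define h where "h = (\<lambda>x. ennreal c * epow (ennreal \<bar>f x\<bar>) p)"
    have h [measurable]: "h \<in> borel_measurable borel" unfolding h_def by measurable
    let ?U = "\<lambda>k. {x. ennreal (dy k \<gamma>) < h x}"
    have h_real: "h x = ennreal ((2 / (lam * ?a) * \<bar>f x\<bar>) powr p)" for x
    proof -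
      have "(2 / (lam * ?a) * \<bar>f x\<bar>) powr p = c * \<bar>f x\<bar> powr p"
        unfolding c_def by (rule powr_mult)
      then show ?thesis using c by (simp only: h_def epow_ennreal abs_ge_zero) (simp add: ennreal_mult)
    qed
    have notin: "\<bar>f x\<bar> \<le> lam * ?a * dy k (\<gamma> / p) / 2" if "x \<notin> ?U k" for x k
    proof -
      have "(2 / (lam * ?a) * \<bar>f x\<bar>) powr p \<le> dy k \<gamma>"
        using that by (simp add: h_real not_less ennreal_le_iff)
      then have "((2 / (lam * ?a) * \<bar>f x\<bar>) powr p) powr (1 / p) \<le> dy k \<gamma> powr (1 / p)"
        using p by (intro powr_mono2) auto
      then have "2 / (lam * ?a) * \<bar>f x\<bar> \<le> dy k (\<gamma> / p)"
        using p lam by (simp add: powr_powr)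
      then show ?thesis using lam by (simp add: field_simps)
    qed
    have D: "Dint lam (\<gamma> / p) 0 \<gamma> f x \<le> ennreal ?d * Dop \<gamma> ?U x" for x
    proof (rule Dint_le_Dop)
      fix x y k
      assume *: "(x, y) \<in> Dset lam (\<gamma> / p) 0 f" "rad (k - 1) \<le> dist x y" "dist x y < rad k"
      have "lam * ?a * dy k (\<gamma> / p) < \<bar>f x - f y\<bar>"
        using Dset_annulus[OF * lam] by simp
      then show "x \<in> ?U k \<or> y \<in> ?U k"
      proof (rule contrapos_pp)
        assume "\<not> (x \<in> ?U k \<or> y \<in> ?U k)"
        then have "\<bar>f x\<bar> \<le> lam * ?a * dy k (\<gamma> / p) / 2" "\<bar>f y\<bar> \<le> lam * ?a * dy k (\<gamma> / p) / 2"
          using notin by blast+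
        moreover have "\<not> L < \<bar>a - b\<bar>" if "\<bar>a\<bar> \<le> L / 2" "\<bar>b\<bar> \<le> L / 2" for a b L :: real
          using that by linarith
        ultimately show "\<not> lam * ?a * dy k (\<gamma> / p) < \<bar>f x - f y\<bar>" by blast
      qed
    qed measurable
    have ce: "c powr r = ?e / lam powr (p * r)"
      using lam by (simp add: c_def powr_powr powr_divide powr_mult mult.assoc)
    have "mb r \<theta> (c powr r * K) h"
      unfolding h_def using c by (intro mb_cmult mb) auto
    then have "mb r \<theta> (C * (c powr r * K)) (Dop \<gamma> ?U)"
      using c K by (intro bd h) auto
    then have "mb r \<theta> (?d powr r * (C * (c powr r * K))) (\<lambda>x. ennreal ?d * Dop \<gamma> ?U x)"
      using disc_const_pos[where 'a='a, of \<gamma>] by (intro mb_cmult) auto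
    moreover have "?d powr r * (C * (c powr r * K)) = ?d powr r * (C * ?e) * K / lam powr (p * r)"
      by (simp add: ce)
    ultimately show "\<exists>G\<in>borel_measurable borel. (\<forall>x. Dint lam (\<gamma> / p) 0 \<gamma> f x \<le> G x)
        \<and> mb r \<theta> (?d powr r * (C * ?e) * K / lam powr (p * r)) G"
      using D by (intro bexI[of _ "\<lambda>x. ennreal ?d * Dop \<gamma> ?U x"]) auto
  qed
qed

section \<open>Localized sums over scales and the gradient endpoint\<close>

text \<open>Scales up to \<rho> see only g on the doubled ball, to which the global bound applies.
  At a larger scale m the set is empty unless the Morrey bound permits \<Lambda> 2^(m \<gamma>) to
  be at most K 2^(- m n \<theta>), and these quantities are summable over large m.\<close>

lemma scale_sum_local:
  assumes \<gamma>: "\<gamma> > 0 \<or> (\<gamma> < -1 \<and> DIM('a::euclidean_space) = 1)" and \<theta>: "\<theta> > 0"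
  obtains C where "C > 0" "\<And>\<Lambda> K \<rho> x (g :: 'a \<Rightarrow> ennreal). \<Lambda> > 0 \<Longrightarrow> K > 0 \<Longrightarrow> \<rho> > 0 \<Longrightarrow> g \<in> borel_measurable borel
    \<Longrightarrow> mb 1 \<theta> K g \<Longrightarrow>
    (\<Sum>z m. ennreal (dy m \<gamma>) * vol
        ({x. (ball_int g x (rad m)) > ennreal (\<Lambda> * dy m (real DIM('a) + \<gamma>))} \<inter> ball x \<rho>))
    \<le> ennreal (C * K / \<Lambda> * \<rho> powr (real DIM('a) * (1 - \<theta>)))"
proof -
  from scale_sum[OF \<gamma>] obtain C0 where C0: "C0 > 0" and
    glob: "\<And>\<Lambda> (g :: 'a \<Rightarrow> ennreal). \<Lambda> > 0 \<Longrightarrow> g \<in> borel_measurable borel \<Longrightarrow>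
    (\<Sum>z m. ennreal (dy m \<gamma>) *
      vol {x. (ball_int g x (rad m)) > ennreal (\<Lambda> * dy m (real DIM('a) + \<gamma>))})
    \<le> ennreal (C0 / \<Lambda>) * (\<integral>\<^sup>+y. g y \<partial>lborel)"
    by blast
  let ?n = "real DIM('a)" and ?w = "ubv TYPE('a)"
  let ?e = "?n * (1 - \<theta>)"
  have g0: "geo (- (?n * \<theta>)) > 0" using \<theta> by (intro geo_pos) auto
  show ?thesis
  proof (rule that[of "C0 * 2 powr ?e + ?w * geo (- (?n * \<theta>))"])
    show "C0 * 2 powr ?e + ?w * geo (- (?n * \<theta>)) > 0" using C0 g0 by (simp add: add_pos_pos)
    fix \<Lambda> K \<rho> :: real and x0 :: 'a and g :: "'a \<Rightarrow> ennreal"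
    assume \<Lambda>: "\<Lambda> > 0" and K: "K > 0" and \<rho>: "\<rho> > 0" and g [measurable]: "g \<in> borel_measurable borel"
      and mb: "mb 1 \<theta> K g"
    let ?B = "ball x0 \<rho>"
    let ?g2 = "\<lambda>y. g y * indicator (ball x0 (2 * \<rho>)) y"
    let ?V = "\<lambda>(g :: 'a \<Rightarrow> ennreal) m. {x. (ball_int g x (rad m)) > ennreal (\<Lambda> * dy m (?n + \<gamma>))}"
    let ?H = "ennreal (\<rho> powr - (?n * \<theta>))"
    let ?far = "\<lambda>k. ennreal (dy k (- (?n * \<theta>))) * indicator {k. ennreal (dy k (- (?n * \<theta>))) \<le> ?H} k"
    let ?b = "K / \<Lambda> * (?w * \<rho> powr ?n)"
    have b: "?b \<ge> 0" using K \<Lambda> by simp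
    have scale: "ennreal (dy m \<gamma>) * vol (?V g m \<inter> ?B)
      \<le> ennreal (dy m \<gamma>) * vol (?V ?g2 m) + ennreal ?b * ?far m" for m
    proof (cases "rad m \<le> \<rho>")
      case True
      have "?V g m \<inter> ?B \<subseteq> ?V ?g2 m"
      proof (rule subsetI)
        fix x assume x: "x \<in> ?V g m \<inter> ?B"
        have sub: "ball x (rad m) \<subseteq> ball x0 (2 * \<rho>)"
          using x by (intro ball_subset_double[OF _ order_refl True]) auto
        have "(ball_int g x (rad m)) = (ball_int (\<lambda>y. ?g2 y) x (rad m))"
          using sub by (intro nn_integral_cong) (auto simp: indicator_def)
        then show "x \<in> ?V ?g2 m" using x by simp
      qed
      then have "vol (?V g m \<inter> ?B) \<le> vol (?V ?g2 m)"
        by (rule emeasure_mono) measurable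
      then have "ennreal (dy m \<gamma>) * vol (?V g m \<inter> ?B) \<le> ennreal (dy m \<gamma>) * vol (?V ?g2 m)"
        by (rule mult_left_mono) simp
      then show ?thesis by (rule order_trans) simp
    next
      case False
      then have m: "\<rho> < rad m" by simp
      have "ennreal (dy m \<gamma>) * vol (?V g m \<inter> ?B) \<le> ennreal ?b * ?far m"
      proof (cases "?V g m = {}")
        case True
        then show ?thesis by (simp only: True Int_empty_left emeasure_empty mult_zero_right zero_le)
      next
        case False
        then obtain x where "ennreal (\<Lambda> * dy m (?n + \<gamma>)) < (ball_int g x (rad m))" by blast
        also have "\<dots> \<le> ennreal (K * rad m powr ?e)"
          using mbD[OF mb, of "rad m" x] by simp
        finally have "\<Lambda> * dy m (?n + \<gamma>) \<le> K * rad m powr ?e"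
          by (simp add: ennreal_less_iff \<Lambda> less_imp_le)
        then have "\<Lambda> * dy m (?n + \<gamma>) * dy m (- ?n) \<le> K * rad m powr ?e * dy m (- ?n)"
          by (rule mult_right_mono) simp
        moreover have "dy m (?n + \<gamma>) * dy m (- ?n) = dy m \<gamma>"
          by (subst dy_add[symmetric]) simp
        moreover have "rad m powr ?e * dy m (- ?n) = dy m (- (?n * \<theta>))"
          by (simp add: powr_powr powr_add[symmetric] algebra_simps)
        ultimately have "\<Lambda> * dy m \<gamma> \<le> K * dy m (- (?n * \<theta>))"
          by (metis (no_types, lifting) mult.assoc)
        then have dm: "dy m \<gamma> \<le> K / \<Lambda> * dy m (- (?n * \<theta>))"
          using \<Lambda> by (simp add: field_simps)
        have "dy m (- (?n * \<theta>)) = rad m powr (- (?n * \<theta>))" by (simp add: powr_powr)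
        also have "\<dots> \<le> \<rho> powr (- (?n * \<theta>))" using m \<rho> \<theta> by (intro powr_mono2') auto
        finally have far: "?far m = ennreal (dy m (- (?n * \<theta>)))" by (simp add: ennreal_leI)
        have "ennreal (dy m \<gamma>) * vol (?V g m \<inter> ?B) \<le> ennreal (K / \<Lambda> * dy m (- (?n * \<theta>))) * ennreal (?w * \<rho> powr ?n)"
          unfolding emeasure_ball_powr[OF \<rho>, where x=x0, symmetric]
          by (intro mult_mono ennreal_leI dm emeasure_mono) auto
        also have "\<dots> = ennreal ?b * ?far m"
          unfolding far using K \<Lambda> by (simp add: ennreal_mult[symmetric] mult_ac)
        finally show ?thesis .
      qed
      then show ?thesis by (rule order_trans) simp
    qed
    have "(\<Sum>z m. ennreal (dy m \<gamma>) * vol (?V g m \<inter> ?B))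
      \<le> (\<Sum>z m. ennreal (dy m \<gamma>) * vol (?V ?g2 m) + ennreal ?b * ?far m)"
      by (rule nn_integral_mono) (rule scale)
    also have "\<dots> = (\<Sum>z m. ennreal (dy m \<gamma>) * vol (?V ?g2 m)) + ennreal ?b * (\<Sum>z m. ?far m)"
      by (subst nn_integral_add, simp, simp) (subst nn_integral_cmult, auto)
    also have "\<dots> \<le> ennreal (C0 / \<Lambda>) * ennreal (K * (2 * \<rho>) powr ?e) + ennreal ?b * (ennreal (geo (- (?n * \<theta>))) * ?H)"
    proof (rule add_mono)
      have "(\<Sum>z m. ennreal (dy m \<gamma>) * vol (?V ?g2 m)) \<le> ennreal (C0 / \<Lambda>) * (\<integral>\<^sup>+y. ?g2 y \<partial>lborel)"
        by (rule glob[OF \<Lambda>]) measurable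
      also have "\<dots> \<le> ennreal (C0 / \<Lambda>) * ennreal (K * (2 * \<rho>) powr ?e)"
        using mbD[OF mb, of "2 * \<rho>" x0] \<rho> by (intro mult_left_mono) auto
      finally show "(\<Sum>z m. ennreal (dy m \<gamma>) * vol (?V ?g2 m)) \<le> ennreal (C0 / \<Lambda>) * ennreal (K * (2 * \<rho>) powr ?e)" .
      show "ennreal ?b * (\<Sum>z m. ?far m) \<le> ennreal ?b * (ennreal (geo (- (?n * \<theta>))) * ?H)"
        using \<theta> by (intro mult_left_mono zsum_geometric) auto
    qed
    also have "\<dots> = ennreal (C0 / \<Lambda> * (K * (2 * \<rho>) powr ?e) + ?b * (geo (- (?n * \<theta>)) * \<rho> powr - (?n * \<theta>)))"
      using C0 \<Lambda> K b g0 by (simp add: ennreal_mult[symmetric] ennreal_plus[symmetric] del: ennreal_plus)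
    also have "C0 / \<Lambda> * (K * (2 * \<rho>) powr ?e) + ?b * (geo (- (?n * \<theta>)) * \<rho> powr - (?n * \<theta>))
      = (C0 * 2 powr ?e + ?w * geo (- (?n * \<theta>))) * K / \<Lambda> * \<rho> powr ?e"
    proof -
      have "\<rho> powr ?n * \<rho> powr - (?n * \<theta>) = \<rho> powr ?e"
        by (simp add: powr_add[symmetric] algebra_simps)
      then have "?b * (geo (- (?n * \<theta>)) * \<rho> powr - (?n * \<theta>)) = K / \<Lambda> * ?w * geo (- (?n * \<theta>)) * \<rho> powr ?e"
        by (simp add: mult_ac)
      moreover have "(2 * \<rho>) powr ?e = 2 powr ?e * \<rho> powr ?e" using \<rho> by (simp add: powr_mult)
      ultimately show ?thesis using \<Lambda> by (simp add: field_simps)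
    qed
    finally show "(\<Sum>z m. ennreal (dy m \<gamma>) * vol (?V g m \<inter> ?B))
      \<le> ennreal ((C0 * 2 powr ?e + ?w * geo (- (?n * \<theta>))) * K / \<Lambda> * \<rho> powr ?e)" .
  qed
qed

text \<open>Compensates the distortion of the power 1 + \<gamma> of the distance over an annulus and
  the constant of the difference estimate, so that the two sides match exactly in
  \<open>Dset_gradient_scales\<close>.\<close>

definition grad_level :: "'a::euclidean_space itself \<Rightarrow> real \<Rightarrow> real" where
  "grad_level T \<gamma> = 2 powr - \<bar>1 + \<gamma>\<bar> / grad_const T"

lemma grad_level_pos: "grad_level TYPE('a::euclidean_space) \<gamma> > 0"
  by (simp add: grad_level_def grad_const_pos)

text \<open>The contrapositive of \<open>C1_diff_le_scales\<close>: were all averages around both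
  points small, the difference could not exceed its lower bound on the annulus.\<close>

lemma Dset_gradient_scales:
  fixes f :: "'a::euclidean_space \<Rightarrow> real"
  assumes C1: "C1_grad_cc f g" and lam: "lam > 0"
    and D: "(x, y) \<in> Dset lam \<gamma> 1 f" "rad (k - 1) \<le> dist x y" "dist x y < rad k"
  shows "\<exists>z\<in>{x, y}. \<exists>j::nat. ennreal (lam * grad_level TYPE('a) \<gamma> * dy k \<gamma> * 2 powr (real j / 2) * dy (k - int j) (real DIM('a)))
     < (ball_int (\<lambda>u. ennreal (norm (g u))) z (rad (k - int j)))"
proof (rule ccontr)
  assume no: "\<not> ?thesis"
  let ?\<Lambda> = "lam * grad_level TYPE('a) \<gamma> * dy k \<gamma>"
  have "\<bar>f x - f y\<bar> \<le> grad_const TYPE('a) * ?\<Lambda> * rad k"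
    using no D(3) lam grad_level_pos[where 'a='a, of \<gamma>]
    by (intro C1_diff_le_scales[OF C1]) (auto simp: not_less)
  also have "\<dots> = lam * 2 powr - \<bar>1 + \<gamma>\<bar> * dy k (1 + \<gamma>)"
    using grad_const_pos[where 'a='a] by (simp add: grad_level_def dy_add[of k 1 \<gamma>])
  also have "\<dots> < \<bar>f x - f y\<bar>" by (rule Dset_annulus[OF D lam])
  finally show False by simp
qed

text \<open>For r > 1 the averages at all scales are dominated by the maximal function, so
  \<open>U k\<close> is one of its superlevel sets. For r = 1 the set \<open>U k\<close> is a union
  over j of sets at scale k - j, and the slack 2^(j/2) makes the sum over j converge.\<close>

lemma level_set_bound_gradient:
  assumes r: "r \<ge> 1" and \<gamma>: "\<gamma> \<noteq> 0" and \<theta>: "\<theta> > 0"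
    and r1: "r = 1 \<Longrightarrow> \<gamma> < 0 \<Longrightarrow> \<gamma> < -1 \<and> DIM('a::euclidean_space) = 1"
  obtains C where "C > 0" "\<And>K lam (f :: 'a \<Rightarrow> real) g. K > 0 \<Longrightarrow> lam > 0 \<Longrightarrow> C1_grad_cc f g
    \<Longrightarrow> mb r \<theta> K (\<lambda>x. ennreal (norm (g x)))
    \<Longrightarrow> \<exists>G\<in>borel_measurable borel. (\<forall>x. Dint lam \<gamma> 1 \<gamma> f x \<le> G x) \<and> mb r \<theta> (C * K / lam powr r) G"
proof (cases "r = 1")
  case False
  with r have r: "r > 1" by simp
  from mb_Dop_superlevel[OF r \<gamma> \<theta>, where 'a='a] obtain C where C: "C > 0" and
    bd: "\<And>K (h :: 'a \<Rightarrow> ennreal). K > 0 \<Longrightarrow> h \<in> borel_measurable borel \<Longrightarrow> mb r \<theta> K h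
    \<Longrightarrow> mb r \<theta> (C * K) (Dop \<gamma> (\<lambda>k. {x. ennreal (dy k \<gamma>) < h x}))"
    by blast
  let ?n = "real DIM('a)" and ?w = "ubv TYPE('a)" and ?a = "grad_level TYPE('a) \<gamma>"
  let ?d = "disc_const TYPE('a) \<gamma>" and ?m = "max_mb_const TYPE('a) r \<theta>"
  let ?e = "(?w / ?a) powr r"
  have pos: "?a > 0" "?d > 0" "?m > 0"
    using grad_level_pos disc_const_pos max_mb_const_pos[OF r] by blast+
  show ?thesis
  proof (rule that[of "?d powr r * (C * (?e * ?m))"])
    show "?d powr r * (C * (?e * ?m)) > 0" using C pos by simp
    fix K lam :: real and f :: "'a \<Rightarrow> real" and g
    assume K: "K > 0" and lam: "lam > 0" and C1: "C1_grad_cc f g"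
      and mb: "mb r \<theta> K (\<lambda>x. ennreal (norm (g x)))"
    have [measurable]: "g \<in> borel_measurable borel"
      using C1 by (auto simp: C1_grad_cc_def intro: borel_measurable_continuous_onI)
    let ?M = "maxfun (\<lambda>x. ennreal (norm (g x)))"
    define c where "c = ?w / (lam * ?a)"
    have c: "c > 0" using lam pos by (simp add: c_def)
    define h where "h = (\<lambda>x. ennreal c * ?M x)"
    have h [measurable]: "h \<in> borel_measurable borel" unfolding h_def by measurable
    let ?U = "\<lambda>k. {x. ennreal (dy k \<gamma>) < h x}"
    have notin: "(ball_int (\<lambda>u. ennreal (norm (g u))) x (rad (k - int j)))
      \<le> ennreal (lam * ?a * dy k \<gamma> * 2 powr (real j / 2) * dy (k - int j) ?n)" if "x \<notin> ?U k" for x k j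
    proof -
      have "ennreal c * ?M x \<le> ennreal (dy k \<gamma>)" using that by (simp add: h_def not_less)
      then have "ennreal (1 / c) * (ennreal c * ?M x) \<le> ennreal (1 / c) * ennreal (dy k \<gamma>)"
        by (rule mult_left_mono) simp
      moreover have "ennreal (1 / c) * ennreal c = 1"
        using c by (subst ennreal_mult[symmetric]) auto
      moreover have "ennreal (1 / c) * ennreal (dy k \<gamma>) = ennreal (1 / c * dy k \<gamma>)"
        using c by (intro ennreal_mult[symmetric]) auto
      ultimately have M: "?M x \<le> ennreal (1 / c * dy k \<gamma>)"
        by (simp only: mult.assoc[symmetric] mult_1_left)
      have "(ball_int (\<lambda>u. ennreal (norm (g u))) x (rad (k - int j))) \<le> ennreal (?w * dy (k - int j) ?n) * ?M x"
        by (rule ball_nn_integral_le_maxfun)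
      also have "\<dots> \<le> ennreal (?w * dy (k - int j) ?n) * ennreal (1 / c * dy k \<gamma>)"
        by (intro mult_left_mono M) auto
      also have "\<dots> = ennreal (lam * ?a * dy k \<gamma> * 1 * dy (k - int j) ?n)"
        using c lam pos by (subst ennreal_mult[symmetric]) (auto simp: c_def field_simps)
      \<comment> \<open>The slack in j is not exploited here: the maximal function controls all the
        smaller scales at once.\<close>
      also have "\<dots> \<le> ennreal (lam * ?a * dy k \<gamma> * 2 powr (real j / 2) * dy (k - int j) ?n)"
        using lam pos by (intro ennreal_leI mult_right_mono mult_left_mono) (auto simp: ge_one_powr_ge_zero)
      finally show ?thesis .
    qed
    have D: "Dint lam \<gamma> 1 \<gamma> f x \<le> ennreal ?d * Dop \<gamma> ?U x" for x
    proof (rule Dint_le_Dop)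
      fix x y k
      assume *: "(x, y) \<in> Dset lam \<gamma> 1 f" "rad (k - 1) \<le> dist x y" "dist x y < rad k"
      from Dset_gradient_scales[OF C1 lam *] obtain z j where "z \<in> {x, y}"
        "\<not> (ball_int (\<lambda>u. ennreal (norm (g u))) z (rad (k - int j)))
          \<le> ennreal (lam * ?a * dy k \<gamma> * 2 powr (real j / 2) * dy (k - int j) ?n)"
        by (auto simp only: not_le)
      with notin[of z k j] show "x \<in> ?U k \<or> y \<in> ?U k" by blast
    qed measurable
    have ce: "c powr r = ?e / lam powr r"
      using lam pos by (simp add: c_def powr_divide powr_mult)
    have "mb r \<theta> (?m * K) ?M"
      by (rule mb_maxfun[OF _ r \<theta> K mb]) measurable
    then have "mb r \<theta> (c powr r * (?m * K)) h"
      unfolding h_def using c by (intro mb_cmult) auto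
    then have "mb r \<theta> (C * (c powr r * (?m * K))) (Dop \<gamma> ?U)"
      using c K pos by (intro bd h) auto
    then have "mb r \<theta> (?d powr r * (C * (c powr r * (?m * K)))) (\<lambda>x. ennreal ?d * Dop \<gamma> ?U x)"
      using pos by (intro mb_cmult) auto
    moreover have "?d powr r * (C * (c powr r * (?m * K))) = ?d powr r * (C * (?e * ?m)) * K / lam powr r"
      by (simp add: ce)
    ultimately show "\<exists>G\<in>borel_measurable borel. (\<forall>x. Dint lam \<gamma> 1 \<gamma> f x \<le> G x)
        \<and> mb r \<theta> (?d powr r * (C * (?e * ?m)) * K / lam powr r) G"
      using D by (intro bexI[of _ "\<lambda>x. ennreal ?d * Dop \<gamma> ?U x"]) auto
  qed
next
  case True
  with r1 \<gamma> have \<gamma>': "\<gamma> > 0 \<or> (\<gamma> < -1 \<and> DIM('a) = 1)" by fastforce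
  let ?n = "real DIM('a)" and ?w = "ubv TYPE('a)" and ?a = "grad_level TYPE('a) \<gamma>"
  let ?d = "disc_const TYPE('a) \<gamma>"
  let ?e = "?n * (1 - \<theta>)"
  from scale_sum_local[OF \<gamma>' \<theta>] obtain C where C: "C > 0" and
    loc: "\<And>\<Lambda> K \<rho> x (g :: 'a \<Rightarrow> ennreal). \<Lambda> > 0 \<Longrightarrow> K > 0 \<Longrightarrow> \<rho> > 0 \<Longrightarrow> g \<in> borel_measurable borel
    \<Longrightarrow> mb 1 \<theta> K g \<Longrightarrow>
    (\<Sum>z m. ennreal (dy m \<gamma>) * vol
        ({x. (ball_int g x (rad m)) > ennreal (\<Lambda> * dy m (?n + \<gamma>))} \<inter> ball x \<rho>))
    \<le> ennreal (C * K / \<Lambda> * \<rho> powr ?e)"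
    by blast
  let ?c = "1 + ?w * 2 powr ?e * (1 + geo (?n * \<theta>))"
  let ?s = "1 / (1 - 2 powr (- 1 / 2)) :: real"
  have s: "?s > 0" by (simp add: powr_less_one)
  have g0: "geo (?n * \<theta>) > 0" using \<theta> by (intro geo_pos) auto
  have pos: "?a > 0" "?d > 0" using grad_level_pos disc_const_pos by blast+
  have c: "?c > 0" using g0 by (intro add_pos_pos mult_pos_pos) auto
  show ?thesis
  proof (rule that[of "?d * (?c * (C / ?a * ?s))"])
    show "?d * (?c * (C / ?a * ?s)) > 0" using C pos c s by simp
    fix K lam :: real and f :: "'a \<Rightarrow> real" and g
    assume K: "K > 0" and lam: "lam > 0" and C1: "C1_grad_cc f g"
      and mb: "mb r \<theta> K (\<lambda>x. ennreal (norm (g x)))"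
    have [measurable]: "g \<in> borel_measurable borel"
      using C1 by (auto simp: C1_grad_cc_def intro: borel_measurable_continuous_onI)
    \<comment> \<open>The threshold of \<open>Dset_gradient_scales\<close> rewritten at scale m = k
      - j: moving 2^(k \<gamma>) to scale m adds 2^(j \<gamma>) to the slack 2^(j/2).\<close>
    define \<Lambda> where "\<Lambda> = (\<lambda>j::nat. lam * ?a * 2 powr (real j * (1 / 2 + \<gamma>)))"
    have \<Lambda>: "\<Lambda> j > 0" for j using lam pos by (simp add: \<Lambda>_def)
    define V where "V = (\<lambda>j m. {x. (ball_int (\<lambda>y. ennreal (norm (g y))) x (rad m)) > ennreal (\<Lambda> j * dy m (?n + \<gamma>))})"
    have V [measurable]: "V j m \<in> sets borel" for j m
      unfolding V_def by measurable
    let ?U = "\<lambda>k. \<Union>j. V j (k - int j)"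
    have D: "Dint lam \<gamma> 1 \<gamma> f x \<le> ennreal ?d * Dop \<gamma> ?U x" for x
    proof (rule Dint_le_Dop)
      fix x y k
      assume *: "(x, y) \<in> Dset lam \<gamma> 1 f" "rad (k - 1) \<le> dist x y" "dist x y < rad k"
      from Dset_gradient_scales[OF C1 lam *] obtain z j where z: "z \<in> {x, y}" and
        "ennreal (lam * ?a * dy k \<gamma> * 2 powr (real j / 2) * dy (k - int j) ?n)
          < (ball_int (\<lambda>u. ennreal (norm (g u))) z (rad (k - int j)))"
        by blast
      moreover have "lam * ?a * dy k \<gamma> * 2 powr (real j / 2) * dy (k - int j) ?n = \<Lambda> j * dy (k - int j) (?n + \<gamma>)"
      proof -
        have "dy k \<gamma> * 2 powr (real j / 2) = 2 powr (real j * (1 / 2 + \<gamma>)) * dy (k - int j) \<gamma>"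
          by (simp only: powr_add[symmetric]) (simp add: algebra_simps)
        then have "lam * ?a * (dy k \<gamma> * 2 powr (real j / 2)) * dy (k - int j) ?n
          = lam * ?a * (2 powr (real j * (1 / 2 + \<gamma>)) * dy (k - int j) \<gamma>) * dy (k - int j) ?n"
          by (simp only:)
        then show ?thesis unfolding \<Lambda>_def dy_add[of "k - int j" ?n \<gamma>] by (simp only: mult_ac)
      qed
      ultimately have "z \<in> V j (k - int j)" by (simp add: V_def)
      with z show "x \<in> ?U k \<or> y \<in> ?U k" by blast
    qed measurable
    have "mb 1 \<theta> (?c * (C / ?a * ?s * K / lam)) (Dop \<gamma> ?U)"
    proof (rule mb_1_Dop[OF _ \<theta>])
      fix x :: 'a and \<rho> :: real assume \<rho>: "\<rho> > 0"
      let ?B = "ball x \<rho>" and ?L = "C * K / (lam * ?a) * \<rho> powr ?e"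
      have L: "?L \<ge> 0" using C K lam pos by simp
      have "(\<Sum>z k. ennreal (dy k \<gamma>) * vol (?U k \<inter> ?B))
        \<le> (\<Sum>z k. \<integral>\<^sup>+j. ennreal (dy k \<gamma>) * vol (V j (k - int j) \<inter> ?B) \<partial>count_space UNIV)"
      proof (rule nn_integral_mono)
        fix k
        have "vol (?U k \<inter> ?B) = vol (\<Union>j. V j (k - int j) \<inter> ?B)"
          by (rule arg_cong[where f=vol]) blast
        also have "\<dots> \<le> (\<Sum>j. vol (V j (k - int j) \<inter> ?B))"
          by (rule emeasure_subadditive_countably) auto
        also have "\<dots> = (\<integral>\<^sup>+j. vol (V j (k - int j) \<inter> ?B) \<partial>count_space UNIV)"
          by (rule nn_integral_count_space_nat[symmetric])
        finally have "ennreal (dy k \<gamma>) * vol (?U k \<inter> ?B)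
          \<le> ennreal (dy k \<gamma>) * (\<integral>\<^sup>+j. vol (V j (k - int j) \<inter> ?B) \<partial>count_space UNIV)"
          by (rule mult_left_mono) simp
        also have "\<dots> = (\<integral>\<^sup>+j. ennreal (dy k \<gamma>) * vol (V j (k - int j) \<inter> ?B) \<partial>count_space UNIV)"
          by (rule nn_integral_cmult[symmetric]) simp
        finally show "ennreal (dy k \<gamma>) * vol (?U k \<inter> ?B)
          \<le> (\<integral>\<^sup>+j. ennreal (dy k \<gamma>) * vol (V j (k - int j) \<inter> ?B) \<partial>count_space UNIV)" .
      qed
      also have "\<dots> = (\<integral>\<^sup>+j. (\<Sum>z k. ennreal (dy k \<gamma>) * vol (V j (k - int j) \<inter> ?B)) \<partial>count_space UNIV)"
        by (rule nn_integral_count_space_nn_integral[symmetric]) auto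
      \<comment> \<open>The weight contributes 2^(j \<gamma>) and the threshold \<Lambda> j divides
        by 2^(j/2 + j \<gamma>), which leaves 2^(-j/2) for either sign of \<gamma>.\<close>
      also have "\<dots> \<le> (\<integral>\<^sup>+j. ennreal (?L * (2 powr (- 1 / 2)) ^ j) \<partial>count_space UNIV)"
      proof (rule nn_integral_mono)
        fix j :: nat
        have split: "dy k \<gamma> = 2 powr (real j * \<gamma>) * dy (k - int j) \<gamma>" for k
          by (simp only: powr_add[symmetric]) (simp add: algebra_simps)
        have "(\<Sum>z k. ennreal (dy k \<gamma>) * vol (V j (k - int j) \<inter> ?B))
          = (\<Sum>z k. ennreal (2 powr (real j * \<gamma>)) * (ennreal (dy (k - int j) \<gamma>) * vol (V j (k - int j) \<inter> ?B)))"
          by (subst split) (simp add: ennreal_mult mult.assoc)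
        also have "\<dots> = ennreal (2 powr (real j * \<gamma>)) * (\<Sum>z k. ennreal (dy (k - int j) \<gamma>) * vol (V j (k - int j) \<inter> ?B))"
          by (rule nn_integral_cmult) simp
        also have "(\<Sum>z k. ennreal (dy (k - int j) \<gamma>) * vol (V j (k - int j) \<inter> ?B))
          = (\<Sum>z m. ennreal (dy m \<gamma>) * vol (V j m \<inter> ?B))"
          by (rule zsum_shift)
        also have "\<dots> \<le> ennreal (C * K / \<Lambda> j * \<rho> powr ?e)"
          unfolding V_def using mb True by (intro loc \<Lambda> K \<rho>) auto
        also have "ennreal (2 powr (real j * \<gamma>)) * ennreal (C * K / \<Lambda> j * \<rho> powr ?e)
          = ennreal (?L * (2 powr (- 1 / 2)) ^ j)"
        proof -
          have q: "(2 powr (- 1 / 2)) ^ j = (2 powr (- (real j / 2)) :: real)"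
            by (simp add: powr_realpow[symmetric] powr_powr)
          have "2 powr (real j * \<gamma>) / 2 powr (real j * (1 / 2 + \<gamma>)) = (2 powr (- (real j / 2)) :: real)"
            by (simp only: powr_diff[symmetric]) (simp add: algebra_simps)
          then have "2 powr (real j * \<gamma>) * (C * K / \<Lambda> j * \<rho> powr ?e) = ?L * (2 powr (- 1 / 2)) ^ j"
            unfolding q \<Lambda>_def using lam pos by (simp add: field_simps)
          then show ?thesis
            using C K \<Lambda>[of j] by (simp add: ennreal_mult[symmetric] less_imp_le)
        qed
        finally show "(\<Sum>z k. ennreal (dy k \<gamma>) * vol (V j (k - int j) \<inter> ?B)) \<le> ennreal (?L * (2 powr (- 1 / 2)) ^ j)"
          by (simp add: mult_left_mono)
      qed
      also have "\<dots> = (\<Sum>j. ennreal (?L * (2 powr (- 1 / 2)) ^ j))"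
        by (rule nn_integral_count_space_nat)
      also have "\<dots> = ennreal (?L * ?s)"
      proof (rule suminf_ennreal_eq)
        show "(\<lambda>j. ?L * (2 powr (- 1 / 2)) ^ j) sums (?L * ?s)"
          by (intro sums_mult geometric_sums) (simp add: powr_less_one)
      qed (rule mult_nonneg_nonneg[OF L], simp)
      also have "?L * ?s = C / ?a * ?s * K / lam * \<rho> powr ?e"
        using lam pos by (simp add: field_simps)
      finally show "(\<Sum>z k. ennreal (dy k \<gamma>) * vol (?U k \<inter> ?B)) \<le> ennreal (C / ?a * ?s * K / lam * \<rho> powr ?e)" .
    qed (use C K lam pos s in auto)
    then have "mb 1 \<theta> (?d powr 1 * (?c * (C / ?a * ?s * K / lam))) (\<lambda>x. ennreal ?d * Dop \<gamma> ?U x)"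
      using pos by (intro mb_cmult) auto
    moreover have "?d powr 1 * (?c * (C / ?a * ?s * K / lam)) = ?d * (?c * (C / ?a * ?s)) * K / lam powr r"
      using pos lam True by simp
    ultimately show "\<exists>G\<in>borel_measurable borel. (\<forall>x. Dint lam \<gamma> 1 \<gamma> f x \<le> G x)
        \<and> mb r \<theta> (?d * (?c * (C / ?a * ?s)) * K / lam powr r) G"
      using D True by (intro bexI[of _ "\<lambda>x. ennreal ?d * Dop \<gamma> ?U x"]) auto
  qed
qed

subsection \<open>Morrey norms\<close>

lemma measure_lebesgue_ball:
  fixes x :: "'a::euclidean_space"
  assumes "\<rho> > 0"
  shows "measure lebesgue (ball x \<rho>) = ubv TYPE('a) * \<rho> powr real DIM('a)"
  using assms by (simp add: content_ball powr_realpow)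

text \<open>Taking r-th powers turns the volume factor into the power - (1 - r/\<alpha>) of the
  volume of the ball, which moves to the other side. Lebesgue integrals equal the
  \<open>lborel\<close> integrals of \<open>mb\<close> by
  \<open>nn_integral_completion\<close>.\<close>

lemma morrey_norm_le_iff:
  fixes F :: "'a::euclidean_space \<Rightarrow> ennreal"
  assumes r: "r > 0" and \<nu>: "\<nu> \<ge> 0"
  shows "morrey_norm \<alpha> r F \<le> ennreal \<nu> \<longleftrightarrow> mb r (r / \<alpha>) (\<nu> powr r * ubv TYPE('a) powr (1 - r / \<alpha>)) F"
proof -
  let ?n = "real DIM('a)" and ?w = "ubv TYPE('a)"
  have "ennreal (measure lebesgue (ball x \<rho>) powr (1/\<alpha> - 1/r)) * epow I (1/r) \<le> ennreal \<nu>
     \<longleftrightarrow> I \<le> ennreal (\<nu> powr r * ?w powr (1 - r / \<alpha>) * \<rho> powr (?n * (1 - r / \<alpha>)))"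
    if \<rho>: "\<rho> > 0" for x :: 'a and \<rho> I
  proof -
    define V where "V = measure lebesgue (ball x \<rho>)"
    have V: "V > 0" "V powr (1 - r / \<alpha>) = ?w powr (1 - r / \<alpha>) * \<rho> powr (?n * (1 - r / \<alpha>))"
      unfolding V_def measure_lebesgue_ball[OF \<rho>] using \<rho> by (simp_all add: powr_mult powr_powr)
    have e: "(1/\<alpha> - 1/r) * r = - (1 - r / \<alpha>)" using r by (simp add: field_simps)
    have "ennreal (V powr (1/\<alpha> - 1/r)) * epow I (1/r) \<le> ennreal \<nu>
      \<longleftrightarrow> epow (ennreal (V powr (1/\<alpha> - 1/r)) * epow I (1/r)) r \<le> epow (ennreal \<nu>) r"
      by (rule epow_le_iff[OF r, symmetric])
    also have "\<dots> \<longleftrightarrow> ennreal (V powr - (1 - r / \<alpha>)) * I \<le> ennreal (\<nu> powr r)"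
      using r \<nu> by (simp only: epow_mult epow_epow epow_ennreal powr_ge_zero powr_powr e) simp
    also have "\<dots> \<longleftrightarrow> I \<le> ennreal (\<nu> powr r * V powr (1 - r / \<alpha>))"
    proof (cases I rule: ennreal_cases)
      case (real i)
      have "V powr - (1 - r / \<alpha>) * i \<le> \<nu> powr r \<longleftrightarrow> i \<le> \<nu> powr r * V powr (1 - r / \<alpha>)"
        unfolding powr_minus using V(1) by (simp add: field_simps)
      then show ?thesis using real by (simp add: ennreal_mult[symmetric] ennreal_le_iff)
    next
      case top
      have "ennreal (V powr - (1 - r / \<alpha>)) * top = top" using V(1) by (simp add: ennreal_mult_top)
      then show ?thesis using top by (simp add: top_unique)
    qed
    finally show ?thesis unfolding V_def[symmetric] V(2) by (simp add: mult.assoc)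
  qed
  then show ?thesis
    unfolding morrey_norm_def mb_def SUP_le_iff nn_integral_completion by auto
qed

lemma morrey_norm_0_imp:
  fixes u :: "'a::euclidean_space \<Rightarrow> real"
  assumes r: "r > 0" and u: "continuous_on UNIV u" and u0: "\<And>x. u x \<ge> 0"
    and 0: "morrey_norm \<alpha> r (\<lambda>x. ennreal (u x)) = 0"
  shows "u x = 0"
proof (rule ccontr)
  assume "u x \<noteq> 0"
  with u0[of x] have ux: "u x > 0" by simp
  have "isCont u x" using u by (simp add: continuous_on_eq_continuous_at)
  then obtain d where d: "d > 0" "\<And>y. dist y x < d \<Longrightarrow> dist (u y) (u x) < u x / 2"
    using ux unfolding continuous_at_eps_delta by (metis half_gt_zero)
  have I: "(ball_int (\<lambda>y. epow (ennreal (u y)) r) x d) = 0"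
  proof -
    have "mb r (r / \<alpha>) (0 powr r * ubv TYPE('a) powr (1 - r / \<alpha>)) (\<lambda>x. ennreal (u x))"
      using 0 r by (subst morrey_norm_le_iff[symmetric]) auto
    from mbD[OF this d(1), of x] show ?thesis by simp
  qed
  have "ennreal ((u x / 2) powr r) * vol (ball x d)
    = (\<integral>\<^sup>+y. ennreal ((u x / 2) powr r) * indicator (ball x d) y \<partial>lborel)"
    by (simp add: nn_integral_cmult)
  also have "\<dots> \<le> (ball_int (\<lambda>y. epow (ennreal (u y)) r) x d)"
  proof (rule nn_integral_mono)
    fix y
    show "ennreal ((u x / 2) powr r) * indicator (ball x d) y \<le> epow (ennreal (u y)) r * indicator (ball x d) y"
    proof (cases "y \<in> ball x d")
      case True
      then have "u x / 2 \<le> u y" using d(2)[of y] by (auto simp: dist_commute dist_real_def abs_if split: if_splits)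
      then have "(u x / 2) powr r \<le> u y powr r" using ux r by (intro powr_mono2) auto
      then show ?thesis using True u0[of y] by (simp add: ennreal_leI)
    qed simp
  qed
  finally have "ennreal ((u x / 2) powr r) * vol (ball x d) = 0" unfolding I by simp
  moreover have "ubv TYPE('a) * d powr real DIM('a) > 0" using d(1) by simp
  ultimately show False using ux d(1) by (auto simp: emeasure_ball_powr ennreal_eq_0_iff)
qed

lemma LHS_eq:
  assumes "q > 0"
  shows "LHS \<alpha> r \<gamma> s q f = (SUP lam\<in>{0<..}. ennreal lam * epow (morrey_norm \<alpha> r (Dint lam (\<gamma>/q) s \<gamma> f)) (1/q))"
  using assms by (simp add: LHS_def morrey_pow_norm_def epow_epow)

text \<open>Settles the degenerate case in which a norm on the right vanishes: f is then constant,
  and the optimal heights would not be positive numbers.\<close>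

lemma LHS_const:
  fixes f :: "'a::euclidean_space \<Rightarrow> real"
  assumes "q > 0" "\<And>x y. f x = f y"
  shows "LHS \<alpha> r \<gamma> s q f = 0"
proof -
  have D: "Dint lam (\<gamma>/q) s \<gamma> f = (\<lambda>x. 0)" if "lam > 0" for lam
  proof
    fix x
    have "Dset lam (\<gamma>/q) s f = {}"
      using assms(2) that by (auto simp: Dset_def) (metis abs_zero diff_self divide_eq_0_iff less_asym)
    then show "Dint lam (\<gamma>/q) s \<gamma> f x = 0" by (simp add: Dint_def)
  qed
  have "morrey_norm \<alpha> r (\<lambda>x::'a. 0) \<le> 0"
    unfolding morrey_norm_def by (intro SUP_least) simp
  then have "LHS \<alpha> r \<gamma> s q f \<le> 0"
    unfolding LHS_eq[OF assms(1)] by (intro SUP_least) (simp add: D)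
  then show ?thesis by simp
qed

lemma gradient_0_imp_const:
  assumes "C1_grad_cc f g" "\<And>x. g x = 0"
  shows "f x = f y"
proof -
  have "(f has_derivative (\<lambda>h. 0)) (at z within UNIV)" for z
    using assms by (auto simp: C1_grad_cc_def)
  then obtain c where "\<And>z. f z = c"
    using has_derivative_zero_constant[of UNIV f] by auto
  then show ?thesis by simp
qed

lemma C1_grad_cc_continuous:
  assumes "C1_grad_cc f g" shows "continuous_on UNIV f" "continuous_on UNIV g"
  using assms unfolding C1_grad_cc_def
  by (auto intro!: continuous_at_imp_continuous_on has_derivative_continuous)

section \<open>Inclusions between level sets\<close>

lemma Dint_le_add:
  fixes f :: "'a::euclidean_space \<Rightarrow> real"
  assumes [measurable]: "f \<in> borel_measurable borel"
    and sub: "Dset l \<beta> \<sigma> f \<subseteq> Dset l1 \<beta>1 \<sigma>1 f \<union> Dset l2 \<beta>2 \<sigma>2 f"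
  shows "Dint l \<beta> \<sigma> \<gamma> f x \<le> Dint l1 \<beta>1 \<sigma>1 \<gamma> f x + Dint l2 \<beta>2 \<sigma>2 \<gamma> f x"
proof -
  have [measurable]: "{y. (x, y) \<in> Dset l \<beta> \<sigma> f} \<in> sets borel" for l \<beta> \<sigma>
    unfolding Dset_def by simp
  have ind: "indicator (Dset l \<beta> \<sigma> f) (x, y) = (indicator {y. (x, y) \<in> Dset l \<beta> \<sigma> f} y :: ennreal)" for l \<beta> \<sigma> y
    by (simp add: indicator_def)
  let ?k = "\<lambda>y. ennreal (dist x y powr (\<gamma> - real DIM('a)))"
  have "Dint l \<beta> \<sigma> \<gamma> f x \<le> (\<integral>\<^sup>+y. indicator (Dset l1 \<beta>1 \<sigma>1 f) (x, y) * ?k y + indicator (Dset l2 \<beta>2 \<sigma>2 f) (x, y) * ?k y \<partial>lborel)"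
    unfolding Dint_def nn_integral_completion using sub
    by (intro nn_integral_mono) (auto simp: indicator_def)
  also have "\<dots> = Dint l1 \<beta>1 \<sigma>1 \<gamma> f x + Dint l2 \<beta>2 \<sigma>2 \<gamma> f x"
    unfolding Dint_def nn_integral_completion ind by (rule nn_integral_add) measurable
  finally show ?thesis .
qed

text \<open>Outside both sets the difference has two upper bounds; their geometric mean with weights
  s and 1 - s has the power (1 + \<gamma>) s + (\<gamma>/p)(1 - s) = s + \<gamma>/q of the distance,
  by the relation for q.\<close>

lemma Dset_interpolate:
  assumes A: "A > 0" and B: "B > 0" and s: "0 < s" "s < 1" and q: "1 / q = (1 - s) / p + s"
  shows "Dset (A powr s * B powr (1 - s)) (\<gamma> / q) s f \<subseteq> Dset A \<gamma> 1 f \<union> Dset B (\<gamma> / p) 0 f"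
proof (clarify, rule ccontr)
  fix x y
  assume D: "(x, y) \<in> Dset (A powr s * B powr (1 - s)) (\<gamma> / q) s f" and no: "(x, y) \<notin> Dset B (\<gamma> / p) 0 f"
    and no': "(x, y) \<notin> Dset A \<gamma> 1 f"
  let ?d = "dist x y" and ?\<Delta> = "\<bar>f x - f y\<bar>"
  have d: "?d > 0" using D by (auto simp: Dset_def)
  have 1: "?\<Delta> \<le> A * ?d powr (1 + \<gamma>)" "?\<Delta> \<le> B * ?d powr (\<gamma> / p)"
    using no no' d by (auto simp: Dset_def not_less pos_divide_le_eq)
  have "?\<Delta> = ?\<Delta> powr s * ?\<Delta> powr (1 - s)"
    using s by (simp add: powr_add[symmetric])
  also have "\<dots> \<le> (A * ?d powr (1 + \<gamma>)) powr s * (B * ?d powr (\<gamma> / p)) powr (1 - s)"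
    using 1 s by (intro mult_mono powr_mono2) auto
  also have "\<dots> = A powr s * B powr (1 - s) * (?d powr ((1 + \<gamma>) * s) * ?d powr (\<gamma> / p * (1 - s)))"
    by (simp add: powr_mult powr_powr mult_ac)
  also have "?d powr ((1 + \<gamma>) * s) * ?d powr (\<gamma> / p * (1 - s)) = ?d powr (s + \<gamma> / q)"
  proof -
    have "\<gamma> / q = \<gamma> * ((1 - s) / p + s)" unfolding q[symmetric] by simp
    then have "(1 + \<gamma>) * s + \<gamma> / p * (1 - s) = s + \<gamma> / q" by (simp add: algebra_simps)
    then show ?thesis by (simp only: powr_add[symmetric])
  qed
  finally have "?\<Delta> \<le> A powr s * B powr (1 - s) * ?d powr (s + \<gamma> / q)" .
  moreover have "A powr s * B powr (1 - s) * ?d powr (s + \<gamma> / q) < ?\<Delta>"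
    using D d by (auto simp: Dset_def pos_less_divide_eq)
  ultimately show False by simp
qed

text \<open>The same geometric mean for infinite p, where the second bound is the trivial 2 L and no
  second level set arises.\<close>

lemma Dset_bounded_function:
  assumes A: "A > 0" and L: "L > 0" and s: "0 < s" "s < 1" and f: "\<And>x. \<bar>f x\<bar> \<le> L"
  shows "Dset (A powr s * (2 * L) powr (1 - s)) (\<gamma> * s) s f \<subseteq> Dset A \<gamma> 1 f"
proof (rule subsetI, rule ccontr, clarify)
  fix x y
  assume D: "(x, y) \<in> Dset (A powr s * (2 * L) powr (1 - s)) (\<gamma> * s) s f" and no: "(x, y) \<notin> Dset A \<gamma> 1 f"
  let ?d = "dist x y" and ?\<Delta> = "\<bar>f x - f y\<bar>"
  have d: "?d > 0" using D by (auto simp: Dset_def)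
  have 1: "?\<Delta> \<le> A * ?d powr (1 + \<gamma>)"
    using no d by (auto simp: Dset_def not_less pos_divide_le_eq)
  have 2: "?\<Delta> \<le> 2 * L" using f[of x] f[of y] by linarith
  have "?\<Delta> = ?\<Delta> powr s * ?\<Delta> powr (1 - s)"
    using s by (simp add: powr_add[symmetric])
  also have "\<dots> \<le> (A * ?d powr (1 + \<gamma>)) powr s * (2 * L) powr (1 - s)"
    using 1 2 s by (intro mult_mono powr_mono2) auto
  also have "\<dots> = A powr s * (2 * L) powr (1 - s) * ?d powr (s + \<gamma> * s)"
    by (simp add: powr_mult powr_powr mult_ac distrib_left)
  finally have "?\<Delta> \<le> A powr s * (2 * L) powr (1 - s) * ?d powr (s + \<gamma> * s)" .
  moreover have "A powr s * (2 * L) powr (1 - s) * ?d powr (s + \<gamma> * s) < ?\<Delta>"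
    using D d by (auto simp: Dset_def pos_less_divide_eq)
  ultimately show False by simp
qed

subsection \<open>Interpolation between the endpoints\<close>

lemma Gagliardo_Nirenberg_finite_p:
  fixes \<alpha> r \<gamma> s p q :: real
  assumes r: "1 \<le> r" "r \<le> \<alpha>" and \<gamma>: "\<gamma> \<noteq> 0" and s: "0 < s" "s < 1"
    and dim: "r = 1 \<and> \<gamma> < 0 \<Longrightarrow> \<gamma> < -1 \<and> DIM('a::euclidean_space) = 1"
    and p: "1 \<le> p" and q: "1 \<le> q" "1 / q = (1 - s) / p + s"
  shows "\<exists>C>0. \<forall>(f::'a \<Rightarrow> real) g. C1_grad_cc f g \<longrightarrow>
              LHS \<alpha> r \<gamma> s q f \<le>
                ennreal C * epow (morrey_pow_norm \<alpha> r p (\<lambda>x. ennreal \<bar>f x\<bar>)) (1 - s)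
                  * epow (morrey_norm \<alpha> r (\<lambda>x. ennreal (norm (g x)))) s"
proof -
  define \<theta> where "\<theta> = r / \<alpha>"
  have \<theta>: "\<theta> > 0" using r by (simp add: \<theta>_def)
  have dim': "r = 1 \<Longrightarrow> \<gamma> < 0 \<Longrightarrow> \<gamma> < -1 \<and> DIM('a) = 1" using dim by blast
  let ?w = "ubv TYPE('a) powr (1 - r / \<alpha>)"
  have w: "?w > 0" by simp
  obtain CA where CA: "CA > 0" and gradb: "\<And>K lam (f :: 'a \<Rightarrow> real) g. K > 0 \<Longrightarrow> lam > 0 \<Longrightarrow> C1_grad_cc f g
    \<Longrightarrow> mb r \<theta> K (\<lambda>x. ennreal (norm (g x)))
    \<Longrightarrow> \<exists>G\<in>borel_measurable borel. (\<forall>x. Dint lam \<gamma> 1 \<gamma> f x \<le> G x) \<and> mb r \<theta> (CA * K / lam powr r) G"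
    using level_set_bound_gradient[OF r(1) \<gamma> \<theta> dim'] by blast
  obtain CB where CB: "CB > 0" and funb: "\<And>K lam (f :: 'a \<Rightarrow> real). K > 0 \<Longrightarrow> lam > 0 \<Longrightarrow> f \<in> borel_measurable borel
    \<Longrightarrow> mb r \<theta> K (\<lambda>x. epow (ennreal \<bar>f x\<bar>) p)
    \<Longrightarrow> \<exists>G\<in>borel_measurable borel. (\<forall>x. Dint lam (\<gamma> / p) 0 \<gamma> f x \<le> G x) \<and> mb r \<theta> (CB * K / lam powr (p * r)) G"
    using level_set_bound_function[OF r(1) \<gamma> \<theta> p, where 'a='a] by blast
  define C0 where "C0 = (2 powr r * (CA + CB)) powr (1 / r)"
  have C0: "C0 > 0" "C0 powr r = 2 powr r * (CA + CB)"
    using CA CB r by (simp_all add: C0_def powr_powr)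
  have "LHS \<alpha> r \<gamma> s q f \<le> ennreal (C0 powr (1 / q)) * epow (morrey_pow_norm \<alpha> r p (\<lambda>x. ennreal \<bar>f x\<bar>)) (1 - s)
                  * epow (morrey_norm \<alpha> r (\<lambda>x. ennreal (norm (g x)))) s" if C1: "C1_grad_cc f g" for f :: "'a \<Rightarrow> real" and g
  proof -
    define Nf where "Nf = morrey_norm \<alpha> r (\<lambda>x. epow (ennreal \<bar>f x\<bar>) p)"
    define Ng where "Ng = morrey_norm \<alpha> r (\<lambda>x. ennreal (norm (g x)))"
    have Mf: "epow (morrey_pow_norm \<alpha> r p (\<lambda>x. ennreal \<bar>f x\<bar>)) (1 - s) = epow Nf ((1 - s) / p)"
      by (simp add: morrey_pow_norm_def Nf_def epow_epow)
    note cont = C1_grad_cc_continuous[OF C1]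
    have f [measurable]: "f \<in> borel_measurable borel"
      by (rule borel_measurable_continuous_onI[OF cont(1)])
    have const: "LHS \<alpha> r \<gamma> s q f = 0" if "Nf = 0 \<or> Ng = 0"
    proof (rule LHS_const)
      show "q > 0" using q by simp
      fix x y
      from that show "f x = f y"
      proof
        assume "Nf = 0"
        then have "morrey_norm \<alpha> r (\<lambda>x. ennreal (\<bar>f x\<bar> powr p)) = 0" by (simp add: Nf_def)
        moreover have "continuous_on UNIV (\<lambda>x. \<bar>f x\<bar> powr p)"
          using p by (intro continuous_on_powr' continuous_intros cont) auto
        ultimately have "\<bar>f z\<bar> powr p = 0" for z
          using r by (intro morrey_norm_0_imp[of r "\<lambda>x. \<bar>f x\<bar> powr p"]) auto
        then show ?thesis by simp
      next
        assume "Ng = 0"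
        moreover have "continuous_on UNIV (\<lambda>x. norm (g x))" by (intro continuous_intros cont)
        ultimately have "norm (g z) = 0" for z
          using r by (intro morrey_norm_0_imp[of r "\<lambda>x. norm (g x)"]) (auto simp: Ng_def)
        then show ?thesis by (intro gradient_0_imp_const[OF C1]) simp
      qed
    qed
    show ?thesis
    proof (cases "Nf = 0 \<or> Ng = 0")
      case True
      then show ?thesis by (simp add: const)
    next
      case pos: False
      show ?thesis
      \<comment> \<open>Both norms are nonzero here, so an infinite one makes the right-hand side
        infinite.\<close>
      proof (cases "Nf = top \<or> Ng = top")
        case True
        with pos C0 show ?thesis unfolding Mf Ng_def[symmetric]
          by (auto simp: ennreal_mult_top ennreal_top_mult ennreal_mult_eq_top_iff)
      next
        case False
        then obtain a b where a: "Nf = ennreal a" "a > 0" and b: "Ng = ennreal b" "b > 0"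
          using pos by (cases Nf rule: ennreal_cases; cases Ng rule: ennreal_cases) (auto simp: order_less_le)
        show ?thesis
          unfolding LHS_eq[OF less_le_trans[OF zero_less_one q(1)]]
        proof (rule SUP_least)
          fix lam :: real assume "lam \<in> {0<..}"
          then have lam: "lam > 0" by simp
          \<comment> \<open>The endpoint bounds scale like the r-th powers of b / A and a / B^p.
            Both quotients are set equal to one number K, and A^s B^(1 - s) = lam then determines
            K.\<close>
          define K where "K = (b powr s * a powr ((1 - s) / p) / lam) powr q"
          define A where "A = b / K"
          define B where "B = (a / K) powr (1 / p)"
          have K: "K > 0" using a b lam by (simp add: K_def)
          have K1: "K powr (1 / q) = b powr s * a powr ((1 - s) / p) / lam"
            using a b lam q(1) by (simp add: K_def powr_powr)
          have AB: "A > 0" "B > 0" using a b K by (simp_all add: A_def B_def)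
          have "A powr s * B powr (1 - s) = b powr s * a powr ((1 - s) / p) / (K powr s * K powr ((1 - s) / p))"
            by (simp add: A_def B_def powr_divide powr_powr)
          also have "K powr s * K powr ((1 - s) / p) = K powr (1 / q)"
            unfolding q(2) by (simp add: powr_add[symmetric] add.commute)
          finally have lamAB: "A powr s * B powr (1 - s) = lam"
            using K1 a b lam by simp
          have mg: "mb r \<theta> (b powr r * ?w) (\<lambda>x. ennreal (norm (g x)))"
            unfolding \<theta>_def using r b by (subst morrey_norm_le_iff[symmetric]) (auto simp: Ng_def)
          have mf: "mb r \<theta> (a powr r * ?w) (\<lambda>x. epow (ennreal \<bar>f x\<bar>) p)"
            unfolding \<theta>_def using r a by (subst morrey_norm_le_iff[symmetric]) (auto simp: Nf_def)
          obtain GA where GA [measurable]: "GA \<in> borel_measurable borel" and DA: "\<And>x. Dint A \<gamma> 1 \<gamma> f x \<le> GA x"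
            and mA: "mb r \<theta> (CA * (b powr r * ?w) / A powr r) GA"
            using gradb[OF _ AB(1) C1 mg] b w by auto
          obtain GB where GB [measurable]: "GB \<in> borel_measurable borel" and DB: "\<And>x. Dint B (\<gamma> / p) 0 \<gamma> f x \<le> GB x"
            and mB: "mb r \<theta> (CB * (a powr r * ?w) / B powr (p * r)) GB"
            using funb[OF _ AB(2) f mf] a w by auto
          have eA: "CA * (b powr r * ?w) / A powr r = CA * (K powr r * ?w)"
            using b K by (simp add: A_def powr_divide)
          have eB: "CB * (a powr r * ?w) / B powr (p * r) = CB * (K powr r * ?w)"
          proof -
            have "B powr (p * r) = (a / K) powr r" using p by (simp add: B_def powr_powr)
            then show ?thesis using a K by (simp add: powr_divide)
          qed
          have "mb r \<theta> (2 powr r * (CA * (K powr r * ?w) + CB * (K powr r * ?w))) (\<lambda>x. GA x + GB x)"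
            using mA mB r CA CB unfolding eA eB by (intro mb_add) auto
          then have "mb r \<theta> ((C0 * K) powr r * ?w) (Dint lam (\<gamma> / q) s \<gamma> f)"
          proof (rule mb_mono)
            show "Dint lam (\<gamma> / q) s \<gamma> f x \<le> GA x + GB x" for x
              using Dset_interpolate[OF AB s q(2), of \<gamma> f] DA[of x] DB[of x] unfolding lamAB
              by (intro order_trans[OF Dint_le_add[OF f] add_mono]) auto
            show "2 powr r * (CA * (K powr r * ?w) + CB * (K powr r * ?w)) \<le> (C0 * K) powr r * ?w"
              by (simp add: powr_mult C0 algebra_simps)
          qed (use r in auto)
          then have "morrey_norm \<alpha> r (Dint lam (\<gamma> / q) s \<gamma> f) \<le> ennreal (C0 * K)"
            unfolding \<theta>_def using r C0 K by (subst morrey_norm_le_iff) auto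
          then have "epow (morrey_norm \<alpha> r (Dint lam (\<gamma> / q) s \<gamma> f)) (1 / q) \<le> epow (ennreal (C0 * K)) (1 / q)"
            using q(1) by (intro epow_mono) auto
          then have "ennreal lam * epow (morrey_norm \<alpha> r (Dint lam (\<gamma> / q) s \<gamma> f)) (1 / q) \<le> ennreal lam * epow (ennreal (C0 * K)) (1 / q)"
            by (rule mult_left_mono) simp
          also have "\<dots> = ennreal (lam * (C0 * K) powr (1 / q))"
            using lam C0(1) K by (subst epow_ennreal, simp, intro ennreal_mult[symmetric]) auto
          also have "lam * (C0 * K) powr (1 / q) = C0 powr (1 / q) * a powr ((1 - s) / p) * b powr s"
            using lam by (simp add: powr_mult K1)
          also have "ennreal \<dots> = ennreal (C0 powr (1 / q)) * epow Nf ((1 - s) / p) * epow Ng s"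
            using a b by (simp add: ennreal_mult)
          finally show "ennreal lam * epow (morrey_norm \<alpha> r (Dint lam (\<gamma> / q) s \<gamma> f)) (1 / q)
            \<le> ennreal (C0 powr (1 / q)) * epow (morrey_pow_norm \<alpha> r p (\<lambda>x. ennreal \<bar>f x\<bar>)) (1 - s)
                  * epow (morrey_norm \<alpha> r (\<lambda>x. ennreal (norm (g x)))) s"
            unfolding Mf Ng_def .
        qed
      qed
    qed
  qed
  then show ?thesis using C0 by (intro exI[of _ "C0 powr (1 / q)"]) auto
qed

text \<open>As f is continuous, the \<open>SUP\<close> is its norm in L^infinity. Only the gradient
  endpoint enters; the factor \<open>2 powr (1 - s)\<close> of the constant stems from the
  oscillation bound 2 L.\<close>

lemma Gagliardo_Nirenberg_infinite_p:
  fixes \<alpha> r \<gamma> s q :: real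
  assumes r: "1 \<le> r" "r \<le> \<alpha>" and \<gamma>: "\<gamma> \<noteq> 0" and s: "0 < s" "s < 1"
    and dim: "r = 1 \<and> \<gamma> < 0 \<Longrightarrow> \<gamma> < -1 \<and> DIM('a::euclidean_space) = 1"
    and q: "1 \<le> q" "1 / q = s"
  shows "\<exists>C>0. \<forall>(f::'a \<Rightarrow> real) g. C1_grad_cc f g \<longrightarrow>
              LHS \<alpha> r \<gamma> s q f \<le>
                ennreal C * epow (SUP x. ennreal \<bar>f x\<bar>) (1 - s)
                  * epow (morrey_norm \<alpha> r (\<lambda>x. ennreal (norm (g x)))) s"
proof -
  define \<theta> where "\<theta> = r / \<alpha>"
  have \<theta>: "\<theta> > 0" using r by (simp add: \<theta>_def)
  have dim': "r = 1 \<Longrightarrow> \<gamma> < 0 \<Longrightarrow> \<gamma> < -1 \<and> DIM('a) = 1" using dim by blast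
  let ?w = "ubv TYPE('a) powr (1 - r / \<alpha>)"
  have w: "?w > 0" by simp
  have \<gamma>q: "\<gamma> / q = \<gamma> * s" unfolding q(2)[symmetric] by simp
  obtain CA where CA: "CA > 0" and gradb: "\<And>K lam (f :: 'a \<Rightarrow> real) g. K > 0 \<Longrightarrow> lam > 0 \<Longrightarrow> C1_grad_cc f g
    \<Longrightarrow> mb r \<theta> K (\<lambda>x. ennreal (norm (g x)))
    \<Longrightarrow> \<exists>G\<in>borel_measurable borel. (\<forall>x. Dint lam \<gamma> 1 \<gamma> f x \<le> G x) \<and> mb r \<theta> (CA * K / lam powr r) G"
    using level_set_bound_gradient[OF r(1) \<gamma> \<theta> dim'] by blast
  define C0 where "C0 = CA powr (1 / r)"
  have C0: "C0 > 0" "C0 powr r = CA"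
    using CA r by (simp_all add: C0_def powr_powr)
  let ?C = "C0 powr s * 2 powr (1 - s)"
  have "LHS \<alpha> r \<gamma> s q f \<le> ennreal ?C * epow (SUP x. ennreal \<bar>f x\<bar>) (1 - s)
                  * epow (morrey_norm \<alpha> r (\<lambda>x. ennreal (norm (g x)))) s" if C1: "C1_grad_cc f g" for f :: "'a \<Rightarrow> real" and g
  proof -
    define Nf where "Nf = (SUP x. ennreal \<bar>f x\<bar>)"
    define Ng where "Ng = morrey_norm \<alpha> r (\<lambda>x. ennreal (norm (g x)))"
    note cont = C1_grad_cc_continuous[OF C1]
    have Nf: "ennreal \<bar>f x\<bar> \<le> Nf" for x unfolding Nf_def by (rule SUP_upper) simp
    have const: "LHS \<alpha> r \<gamma> s q f = 0" if "Nf = 0 \<or> Ng = 0"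
    proof (rule LHS_const)
      show "q > 0" using q by simp
      fix x y
      from that show "f x = f y"
      proof
        assume "Nf = 0"
        then show ?thesis using Nf[of x] Nf[of y] by (simp add: ennreal_eq_0_iff)
      next
        assume "Ng = 0"
        moreover have "continuous_on UNIV (\<lambda>x. norm (g x))" by (intro continuous_intros cont)
        ultimately have "norm (g z) = 0" for z
          using r by (intro morrey_norm_0_imp[of r "\<lambda>x. norm (g x)"]) (auto simp: Ng_def)
        then show ?thesis by (intro gradient_0_imp_const[OF C1]) simp
      qed
    qed
    show ?thesis
    proof (cases "Nf = 0 \<or> Ng = 0")
      case True
      then show ?thesis by (simp add: const)
    next
      case pos: False
      show ?thesis
      proof (cases "Nf = top \<or> Ng = top")
        case True
        with pos C0 show ?thesis unfolding Nf_def[symmetric] Ng_def[symmetric]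
          by (auto simp: ennreal_mult_top ennreal_top_mult ennreal_mult_eq_top_iff)
      next
        case False
        then obtain L b where L: "Nf = ennreal L" "L > 0" and b: "Ng = ennreal b" "b > 0"
          using pos by (cases Nf rule: ennreal_cases; cases Ng rule: ennreal_cases) (auto simp: order_less_le)
        have fL: "\<bar>f x\<bar> \<le> L" for x
          using Nf[of x] L by (simp add: ennreal_le_iff)
        show ?thesis
          unfolding LHS_eq[OF less_le_trans[OF zero_less_one q(1)]]
        proof (rule SUP_least)
          fix lam :: real assume "lam \<in> {0<..}"
          then have lam: "lam > 0" by simp
          \<comment> \<open>Solves A^s (2 L)^(1 - s) = lam, which leaves no height to
            optimize.\<close>
          define A where "A = (lam / (2 * L) powr (1 - s)) powr (1 / s)"
          have A: "A > 0" "A powr s = lam / (2 * L) powr (1 - s)"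
            using lam L s by (simp_all add: A_def powr_powr)
          have lamA: "A powr s * (2 * L) powr (1 - s) = lam" using A L by simp
          have mg: "mb r \<theta> (b powr r * ?w) (\<lambda>x. ennreal (norm (g x)))"
            unfolding \<theta>_def using r b by (subst morrey_norm_le_iff[symmetric]) (auto simp: Ng_def)
          obtain GA where GA [measurable]: "GA \<in> borel_measurable borel" and DA: "\<And>x. Dint A \<gamma> 1 \<gamma> f x \<le> GA x"
            and mA: "mb r \<theta> (CA * (b powr r * ?w) / A powr r) GA"
            using gradb[OF _ A(1) C1 mg] b w by auto
          have "CA * (b powr r * ?w) / A powr r = (C0 * (b / A)) powr r * ?w"
            using C0 A b by (simp add: powr_mult powr_divide)
          with mA have "mb r \<theta> ((C0 * (b / A)) powr r * ?w) GA" by simp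
          then have "mb r \<theta> ((C0 * (b / A)) powr r * ?w) (Dint lam (\<gamma> / q) s \<gamma> f)"
          proof (rule mb_mono)
            show "Dint lam (\<gamma> / q) s \<gamma> f x \<le> GA x" for x
            proof -
              have "Dint lam (\<gamma> / q) s \<gamma> f x \<le> Dint A \<gamma> 1 \<gamma> f x"
                using Dset_bounded_function[where f=f, OF A(1) L(2) s fL, of \<gamma>] unfolding lamA \<gamma>q Dint_def
                by (intro nn_integral_mono) (auto simp: indicator_def)
              with DA[of x] show ?thesis by (rule order_trans[rotated])
            qed
          qed (use r in auto)
          then have "morrey_norm \<alpha> r (Dint lam (\<gamma> / q) s \<gamma> f) \<le> ennreal (C0 * (b / A))"
            unfolding \<theta>_def using r C0 A b by (subst morrey_norm_le_iff) auto
          then have "epow (morrey_norm \<alpha> r (Dint lam (\<gamma> / q) s \<gamma> f)) (1 / q) \<le> epow (ennreal (C0 * (b / A))) (1 / q)"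
            using q by (intro epow_mono) auto
          then have "ennreal lam * epow (morrey_norm \<alpha> r (Dint lam (\<gamma> / q) s \<gamma> f)) (1 / q) \<le> ennreal lam * epow (ennreal (C0 * (b / A))) (1 / q)"
            by (rule mult_left_mono) simp
          also have "\<dots> = ennreal (lam * (C0 * (b / A)) powr s)"
            using lam C0(1) A(1) b unfolding q(2) by (subst epow_ennreal, simp, intro ennreal_mult[symmetric]) auto
          also have "lam * (C0 * (b / A)) powr s = ?C * L powr (1 - s) * b powr s"
          proof -
            have "(C0 * (b / A)) powr s = C0 powr s * (b powr s * (2 * L) powr (1 - s) / lam)"
              using A by (simp add: powr_mult powr_divide)
            then show ?thesis using lam L by (simp add: powr_mult)
          qed
          also have "ennreal \<dots> = ennreal ?C * epow Nf (1 - s) * epow Ng s"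
            using L b by (simp add: ennreal_mult)
          finally show "ennreal lam * epow (morrey_norm \<alpha> r (Dint lam (\<gamma> / q) s \<gamma> f)) (1 / q)
            \<le> ennreal ?C * epow (SUP x. ennreal \<bar>f x\<bar>) (1 - s)
                  * epow (morrey_norm \<alpha> r (\<lambda>x. ennreal (norm (g x)))) s"
            unfolding Nf_def Ng_def .
        qed
      qed
    qed
  qed
  moreover have "?C > 0" using C0 by simp
  ultimately show ?thesis by (intro exI[of _ ?C]) auto
qed

text \<open>The exponent p is real, so infinite p is a separate conjunct with 1/q = s.\<close>

theorem theorem5p2:
  fixes \<alpha> r \<gamma> s :: real
  assumes "1 \<le> r" "r \<le> \<alpha>" "\<gamma> \<noteq> 0" "0 < s" "s < 1"
    and "r = 1 \<and> \<gamma> < 0 \<Longrightarrow> \<gamma> < -1 \<and> DIM('a::euclidean_space) = 1"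
  shows "(\<forall>p q. 1 \<le> p \<and> 1 \<le> q \<and> q \<le> p \<and> 1/q = (1 - s)/p + s \<longrightarrow>
           (\<exists>C>0. \<forall>(f::'a \<Rightarrow> real) g. C1_grad_cc f g \<longrightarrow>
              LHS \<alpha> r \<gamma> s q f \<le>
                ennreal C * epow (morrey_pow_norm \<alpha> r p (\<lambda>x. ennreal \<bar>f x\<bar>)) (1 - s)
                  * epow (morrey_norm \<alpha> r (\<lambda>x. ennreal (norm (g x)))) s)) \<and>
         (\<forall>q. 1 \<le> q \<and> 1/q = s \<longrightarrow>
           (\<exists>C>0. \<forall>(f::'a \<Rightarrow> real) g. C1_grad_cc f g \<longrightarrow>
              LHS \<alpha> r \<gamma> s q f \<le>
                ennreal C * epow (SUP x. ennreal \<bar>f x\<bar>) (1 - s)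
                  * epow (morrey_norm \<alpha> r (\<lambda>x. ennreal (norm (g x)))) s))"
  using Gagliardo_Nirenberg_finite_p[OF assms] Gagliardo_Nirenberg_infinite_p[OF assms] by blast

end
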